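(* Let $p$ be a prime, $q=p^m$. For any positive integer $n\mid(q-1)$ satisfying $$\gcd \bigg(n, \frac{q -1}{p^\nu - 1}\bigg) \ll \frac{n}{p^{\nu/2}}$$ for all integers $\nu$ with $1\leq \nu < m$, $\nu \mid m$, we have $$\max_{a\in\mathbb{F}_q^{*}} |S_n(a)| \ll q^{91/128 + o(1)}n^{73/128} + q^{92/128+o(1)}n^{71/128}.$$
   Context: $\mathbb{F}_q$ is the finite field with $q=p^m$ elements and $\mathbb{F}_q^*=\mathbb{F}_q\setminus\{0\}$. Let $Tr(x)=\sum_{i=0}^{m-1}x^{p^i}$ (the trace to $\mathbb{F}_p$), $e_p(x)=\exp(2\pi i x/p)$, $\psi(x)=e_p(Tr(x))$ and $\psi_a(x)=\psi(ax)$ for $a\in\mathbb{F}_q$. The Gauss sum is $S_n(a)=\sum_{x\in\mathbb{F}_q}\psi_a(x^n)$. $X \ll Y$ means that there is an absolute constant $c>0$ with $X\leq cY$. When such notation appears in a hypothesis, it is understood with some fixed implied constant (uniform over all $\nu$), and the implied constants in the conclusion may depend on it, but not on $q$ or $n$. The symbol $o(1)$ denotes a quantity tending to $0$ as $q\to\infty$, uniformly in $n$. *)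

theory Defs
  imports "HOL-Analysis.Analysis" "HOL-Algebra.Ring" "HOL-Computational_Algebra.Primes"
begin

text \<open>
  Throughout, \<open>K\<close> is meant to be a field with \<open>p ^ m\<close> elements, \<open>p\<close> prime. Fields are
  structures with a carrier (not types of class \<open>field\<close>), so that one can quantify over
  all finite fields inside a formula and ask for constants that do not depend on the field.
  The carrier type is arbitrary; with \<open>'a = nat\<close> every finite field occurs up to isomorphism.
\<close>

definition field_trace :: "('a, 'b) ring_scheme \<Rightarrow> nat \<Rightarrow> nat \<Rightarrow> 'a \<Rightarrow> 'a" where
  "field_trace K p m x = (\<Oplus>\<^bsub>K\<^esub>i\<in>{..<m}. x [^]\<^bsub>K\<^esub> (p ^ i))"

text \<open>
  The prime subfield of \<open>K\<close> consists of the multiples \<open>k \<cdot> 1\<close> with \<open>k < p\<close>, and is identified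
  with the integers modulo \<open>p\<close> via \<open>k \<cdot> 1 \<mapsto> k\<close>. The value is meaningful only for \<open>t\<close> in the
  prime subfield, where traces lie.
\<close>

definition e_char :: "('a, 'b) ring_scheme \<Rightarrow> nat \<Rightarrow> 'a \<Rightarrow> complex" where
  "e_char K p t =
     exp (2 * of_real pi * \<i> * of_nat (THE k. k < p \<and> add_pow K k \<one>\<^bsub>K\<^esub> = t) / of_nat p)"

definition add_char :: "('a, 'b) ring_scheme \<Rightarrow> nat \<Rightarrow> nat \<Rightarrow> 'a \<Rightarrow> 'a \<Rightarrow> complex" where
  "add_char K p m a x = e_char K p (field_trace K p m (a \<otimes>\<^bsub>K\<^esub> x))"

definition gauss_sum :: "('a, 'b) ring_scheme \<Rightarrow> nat \<Rightarrow> nat \<Rightarrow> nat \<Rightarrow> 'a \<Rightarrow> complex" where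
  "gauss_sum K p m n a = (\<Sum>x\<in>carrier K. add_char K p m a (x [^]\<^bsub>K\<^esub> n))"

end

theory Submission
  imports Defs "HOL-Algebra.Multiplicative_Group"
begin

text \<open>
  Let \<open>H\<close> be the group of \<open>n\<close>-th powers in the multiplicative group of the field, \<open>h = (q - 1) / n\<close> its order, and
  \<open>S t\<close> the sum of \<open>\<psi> (t x)\<close> over \<open>x \<in> H\<close>. The Gauss sum at \<open>a\<close> is \<open>1 + n S a\<close>, and the theorem follows from
  \<open>M \<lless> q powr (35 / 128) * h powr (57 / 128)\<close>, where \<open>M\<close> is the largest \<open>|S t|\<close> with \<open>t \<noteq> 0\<close>. Parseval's identity
  gives \<open>M \<le> sqrt q\<close>. The task is to save a power of \<open>q\<close> over this when \<open>h\<close> is close to \<open>sqrt q\<close>, and this is done by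

  \<open>M ^ 103 \<lless> (log q) ^ 55 * q ^ 24 * h ^ 54\<close>      (\<open>subgroup_sum_bound\<close>),

  valid if \<open>M\<^sup>2 \<ge> 2 h\<close>, whereas smaller \<open>M\<close> satisfy the claim at once; a weighted geometric mean of the two bounds is the required one (\<open>interpolation\<close>).

  The second bound is a sum-product phenomenon. Call \<open>t\<close> large if \<open>|S t| \<ge> T\<close>. By Parseval's identity at most
  \<open>q h / T\<^sup>2\<close> elements are large, and multiplication by elements of \<open>H\<close> preserves them. On the other hand the sum of \<open>S (1 - u)\<close> over
  \<open>u \<in> H\<close> is the square of \<open>|S 1|\<close>; if \<open>M = |S 1|\<close>, many differences of elements of \<open>H\<close> must be large for a suitable
  level \<open>T\<close>. Joining the elements of \<open>H\<close> with large difference yields a dense Cayley graph of \<open>H\<close>. An argument in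
  the style of Balog, Szemeredi and Gowers (\<open>popular_walks_to_dilates\<close>) finds a big subset \<open>B\<close> of \<open>H\<close> such that \<open>x\<close> and
  \<open>b y\<close> are joined by many walks of length four, for all \<open>x, y, b \<in> B\<close>. Every walk writes \<open>x - b y\<close> as a sum of four
  large elements, and there are few of these; consequently \<open>|B - b B| \<le> K |B|\<close> for all \<open>b \<in> B\<close> with a small constant
  \<open>K\<close> (\<open>spectrum_popular_dilates\<close>).

  Such a set is either small or close to a subfield (\<open>card_le_or_subfield\<close>). Let \<open>Q\<close> be the set of the ratios
  \<open>(a - b) / (c - d)\<close> of differences of elements of \<open>B\<close>. If \<open>Q\<close> contains some \<open>\<xi>\<close> for which \<open>\<rho> = \<xi> - 1\<close> or \<open>\<rho> = e \<xi>\<close> with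
  \<open>e \<in> B\<close> is outside \<open>Q\<close>, then \<open>x + \<rho> y\<close> takes \<open>|B|\<^sup>2\<close> different values on \<open>B \<times> B\<close>; but up to a factor these values
  are sums of six dilates of \<open>B\<close>, of which there are \<open>O(K ^ 6 |B|)\<close> by the inequalities of Pluennecke and Ruzsa. Hence
  \<open>|B| = O(K ^ 6)\<close>. Otherwise \<open>Q\<close> contains a subfield \<open>F\<close> that includes \<open>B\<close>, and an average over \<open>\<xi> \<in> F\<close> shows that
  \<open>x + \<xi> y\<close> takes at least \<open>|B|\<^sup>2 / (1 + |B|\<^sup>2 / |F|)\<close> values for some \<open>\<xi>\<close> in \<open>F\<close>, while the dilates leave room for
  \<open>O(K ^ 4 |B|)\<close>. If \<open>F\<close> is a proper subfield, then \<open>|B|\<^sup>2 / |F|\<close> is bounded: the hypothesis on greatest common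
  divisors amounts to the statement that \<open>H \<inter> F\<close> has \<open>O(sqrt |F|)\<close> elements (\<open>card_powers_inter_subfield\<close>). If \<open>F\<close> is the
  whole field, \<open>|B|\<^sup>2 / |F|\<close> is at most \<open>h\<^sup>2 / q\<close>, which is at most the square of the upper bound for \<open>K\<close>. Inserting the values of \<open>|B|\<close> and
  \<open>K\<close> into \<open>|B| = O(K ^ 6)\<close> gives the bound for \<open>M ^ 103\<close>.
\<close>

section \<open>Sums and differences of sets in an abelian group\<close>

definition sumset :: "('a, 'm) ring_scheme \<Rightarrow> 'a set \<Rightarrow> 'a set \<Rightarrow> 'a set" (infixl \<open>\<boxplus>\<index>\<close> 65) where
  "A \<boxplus>\<^bsub>G\<^esub> B = (\<Union>a\<in>A. \<Union>b\<in>B. {a \<oplus>\<^bsub>G\<^esub> b})"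

definition diffset :: "('a, 'm) ring_scheme \<Rightarrow> 'a set \<Rightarrow> 'a set \<Rightarrow> 'a set" (infixl \<open>\<boxminus>\<index>\<close> 65) where
  "A \<boxminus>\<^bsub>G\<^esub> B = (\<Union>a\<in>A. \<Union>b\<in>B. {a \<ominus>\<^bsub>G\<^esub> b})"

context abelian_group
begin

lemma sumset_closed: "A \<subseteq> carrier G \<Longrightarrow> B \<subseteq> carrier G \<Longrightarrow> A \<boxplus> B \<subseteq> carrier G"
  unfolding sumset_def by auto

lemma sumset_mem: "x \<in> A \<Longrightarrow> y \<in> B \<Longrightarrow> x \<oplus> y \<in> A \<boxplus> B"
  unfolding sumset_def by auto

lemma finite_sumset: "finite A \<Longrightarrow> finite B \<Longrightarrow> finite (A \<boxplus> B)"
  unfolding sumset_def by auto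

lemma sumset_mono: "A \<subseteq> A' \<Longrightarrow> B \<subseteq> B' \<Longrightarrow> A \<boxplus> B \<subseteq> A' \<boxplus> B'"
  unfolding sumset_def by auto

lemma sumset_assoc:
  assumes "A \<subseteq> carrier G" "B \<subseteq> carrier G" "C \<subseteq> carrier G"
  shows "(A \<boxplus> B) \<boxplus> C = A \<boxplus> (B \<boxplus> C)"
proof -
  have "a \<oplus> b \<oplus> c = a \<oplus> (b \<oplus> c)" if "a \<in> A" "b \<in> B" "c \<in> C" for a b c
    using that assms by (intro a_assoc) auto
  then show ?thesis unfolding sumset_def by force
qed

lemma sumset_Un_left: "(A \<union> B) \<boxplus> C = (A \<boxplus> C) \<union> (B \<boxplus> C)"
  unfolding sumset_def by auto

lemma card_translate:
  assumes "c \<in> carrier G" "A \<subseteq> carrier G"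
  shows "card ({c} \<boxplus> A) = card A"
proof -
  have e: "{c} \<boxplus> A = (\<lambda>a. c \<oplus> a) ` A" unfolding sumset_def by auto
  have "inj_on (\<lambda>a. c \<oplus> a) A"
    using assms by (intro inj_onI) (auto simp: subset_iff)
  then show ?thesis unfolding e by (rule card_image)
qed

lemma card_sumset_ge:
  assumes "finite A" "finite B" "A \<subseteq> carrier G" "B \<subseteq> carrier G" "B \<noteq> {}"
  shows "card A \<le> card (A \<boxplus> B)"
proof -
  obtain b where b: "b \<in> B" using assms by auto
  have "inj_on (\<lambda>a. a \<oplus> b) A"
    using assms b by (intro inj_onI) (auto simp: subset_iff)
  moreover have "(\<lambda>a. a \<oplus> b) ` A \<subseteq> A \<boxplus> B" using b by (auto intro: sumset_mem)
  ultimately show ?thesis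
    using card_inj_on_le finite_sumset[OF assms(1,2)] by blast
qed

text \<open>
  Fix one representation \<open>d = p \<ominus> q\<close> for each difference \<open>d\<close>. The pair \<open>(x \<oplus> p, x \<oplus> q)\<close>
  determines \<open>d\<close>, hence \<open>p\<close>, hence \<open>x\<close>.
\<close>

lemma ruzsa_triangle:
  assumes fin: "finite X" "finite P" "finite Q"
    and car: "X \<subseteq> carrier G" "P \<subseteq> carrier G" "Q \<subseteq> carrier G"
  shows "card X * card (P \<boxminus> Q) \<le> card (X \<boxplus> P) * card (X \<boxplus> Q)"
proof -
  have "\<forall>d\<in>(P \<boxminus> Q). \<exists>pq. fst pq \<in> P \<and> snd pq \<in> Q \<and> d = fst pq \<ominus> snd pq"
    unfolding diffset_def by force
  then obtain f where f: "\<And>d. d \<in> (P \<boxminus> Q) \<Longrightarrow> fst (f d) \<in> P \<and> snd (f d) \<in> Q \<and> d = fst (f d) \<ominus> snd (f d)"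
    by metis
  define g where "g = (\<lambda>(x, d). (x \<oplus> fst (f d), x \<oplus> snd (f d)))"
  have cancel: "(x \<oplus> p) \<ominus> (x \<oplus> q) = p \<ominus> q"
    if "x \<in> carrier G" "p \<in> carrier G" "q \<in> carrier G" for x p q
  proof -
    have "(x \<oplus> p) \<ominus> (x \<oplus> q) = p \<oplus> (x \<oplus> (\<ominus> x \<oplus> \<ominus> q))"
      using that by (simp add: a_minus_def minus_add a_ac)
    then show ?thesis using that by (simp add: a_minus_def r_neg2)
  qed
  have inj: "inj_on g (X \<times> (P \<boxminus> Q))"
  proof (rule inj_onI, clarify)
    fix x d x' d'
    assume xd: "x \<in> X" "d \<in> (P \<boxminus> Q)" "x' \<in> X" "d' \<in> (P \<boxminus> Q)" and eq: "g (x, d) = g (x', d')"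
    have c: "x \<in> carrier G" "x' \<in> carrier G" "fst (f d) \<in> carrier G" "snd (f d) \<in> carrier G"
      "fst (f d') \<in> carrier G" "snd (f d') \<in> carrier G"
      using xd f car by blast+
    have e1: "x \<oplus> fst (f d) = x' \<oplus> fst (f d')" and e2: "x \<oplus> snd (f d) = x' \<oplus> snd (f d')"
      using eq by (auto simp: g_def)
    have "d = (x \<oplus> fst (f d)) \<ominus> (x \<oplus> snd (f d))" using cancel c f xd by simp
    also have "\<dots> = d'" unfolding e1 e2 using cancel c f xd by simp
    finally have "d = d'" .
    then show "x = x' \<and> d = d'" using e1 c by simp
  qed
  have im: "g ` (X \<times> (P \<boxminus> Q)) \<subseteq> (X \<boxplus> P) \<times> (X \<boxplus> Q)"
    using f by (auto simp: g_def intro: sumset_mem)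
  have "card (X \<times> (P \<boxminus> Q)) \<le> card ((X \<boxplus> P) \<times> (X \<boxplus> Q))"
    by (rule card_inj_on_le[OF inj im]) (use fin in \<open>auto intro: finite_sumset\<close>)
  then show ?thesis by (simp add: card_cartesian_product)
qed

text \<open>
  Petridis' proof of Pluennecke's inequality, run for several summands at once. The set \<open>X\<close> minimises
  the weighted expansion \<open>\<mu> X / |X|\<close>, where \<open>\<mu> X\<close> adds up the sizes \<open>|X \<boxplus> Y i|\<close> divided by
  \<open>k i\<close>. With these weights each summand contributes at most 1 for \<open>X\<^sub>0\<close>, so that the minimum is at
  most \<open>|I|\<close> even if the constants \<open>k i\<close> are of very different size. That \<open>C \<boxplus> X\<close> expands no more than
  \<open>X\<close> itself is shown by adding the elements \<open>c\<close> of \<open>C\<close> one at a time: the part of \<open>{c} \<boxplus> X\<close> that is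
  already covered is \<open>{c} \<boxplus> Z\<close> for some \<open>Z \<subseteq> X\<close>, and by minimality \<open>Z\<close> expands at least as much as \<open>X\<close>.
\<close>

lemma plunnecke_petridis:
  fixes Y :: "'i \<Rightarrow> 'a set" and k :: "'i \<Rightarrow> real"
  assumes finX: "finite X\<^sub>0" and X0: "X\<^sub>0 \<noteq> {}" "X\<^sub>0 \<subseteq> carrier G" and I: "finite I"
    and Y: "\<And>i. i \<in> I \<Longrightarrow> finite (Y i) \<and> Y i \<subseteq> carrier G"
    and k: "\<And>i. i \<in> I \<Longrightarrow> k i > 0"
    and le: "\<And>i. i \<in> I \<Longrightarrow> real (card (X\<^sub>0 \<boxplus> Y i)) \<le> k i * card X\<^sub>0"
  shows "\<exists>X. X \<noteq> {} \<and> X \<subseteq> X\<^sub>0 \<and> (\<forall>C i. finite C \<longrightarrow> C \<subseteq> carrier G \<longrightarrow> i \<in> I \<longrightarrow>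
           real (card (C \<boxplus> X \<boxplus> Y i)) \<le> card I * k i * card (C \<boxplus> X))"
proof -
  define \<mu> where "\<mu> X = (\<Sum>i\<in>I. real (card (X \<boxplus> Y i)) / k i)" for X
  define F where "F = Pow X\<^sub>0 - {{}}"
  have "finite F" "F \<noteq> {}" using finX X0 by (auto simp: F_def)
  then obtain X where X: "X \<in> F" and min: "\<And>Z. Z \<in> F \<Longrightarrow> \<mu> X / card X \<le> \<mu> Z / card Z"
    using ex_is_arg_min_if_finite[of F "\<lambda>X. \<mu> X / card X"] unfolding is_arg_min_linorder by blast
  have Xs: "X \<noteq> {}" "X \<subseteq> X\<^sub>0" using X by (auto simp: F_def)
  then have finXX: "finite X" and Xc: "X \<subseteq> carrier G" using finX X0 finite_subset by auto
  define \<kappa> where "\<kappa> = \<mu> X / card X"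
  have \<mu>X: "\<mu> X = \<kappa> * card X" using Xs finXX by (simp add: \<kappa>_def)
  have \<mu>0: "\<mu> Z \<ge> 0" for Z unfolding \<mu>_def by (intro sum_nonneg divide_nonneg_nonneg) (use k in \<open>auto intro: less_imp_le\<close>)
  have \<kappa>0: "\<kappa> \<ge> 0" unfolding \<kappa>_def using \<mu>0 by simp
  have minZ: "\<kappa> * card Z \<le> \<mu> Z" if "Z \<subseteq> X" for Z
  proof (cases "Z = {}")
    case True then show ?thesis using \<mu>0 by simp
  next
    case False
    then have "Z \<in> F" using that Xs by (auto simp: F_def)
    moreover have "card Z > 0" using False that finXX finite_subset by (metis card_gt_0_iff)
    ultimately show ?thesis using min[of Z] by (simp add: \<kappa>_def field_simps)
  qed
  have "X\<^sub>0 \<in> F" using X0 by (auto simp: F_def)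
  then have "\<kappa> \<le> \<mu> X\<^sub>0 / card X\<^sub>0" using min by (simp add: \<kappa>_def)
  also have "\<mu> X\<^sub>0 \<le> (\<Sum>i\<in>I. card X\<^sub>0)"
    unfolding \<mu>_def of_nat_sum by (intro sum_mono) (use le k in \<open>auto simp: field_simps\<close>)
  then have "\<mu> X\<^sub>0 / card X\<^sub>0 \<le> card I" using X0 finX by (simp add: pos_divide_le_eq card_gt_0_iff mult.commute)
  finally have \<kappa>I: "\<kappa> \<le> card I" .
  have main: "\<mu> (C \<boxplus> X) \<le> \<kappa> * card (C \<boxplus> X)" if "finite C" "C \<subseteq> carrier G" for C
    using that
  proof (induction C rule: finite_induct)
    case empty
    then show ?case by (simp add: \<mu>_def sumset_def)
  next
    case (insert c C)
    then have cC: "c \<in> carrier G" "C \<subseteq> carrier G" by auto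
    let ?CX = "C \<boxplus> X" and ?cX = "{c} \<boxplus> X"
    define Z where "Z = {x \<in> X. c \<oplus> x \<in> ?CX}"
    have ZX: "Z \<subseteq> X" by (auto simp: Z_def)
    have finZ: "finite Z" using ZX finXX finite_subset by auto
    have ins: "insert c C \<boxplus> X = ?CX \<union> ?cX"
      by (metis Un_commute insert_is_Un sumset_Un_left)
    have int: "?CX \<inter> ?cX = {c} \<boxplus> Z"
      unfolding Z_def sumset_def by auto
    have fin: "finite ?CX" "finite ?cX" using insert finXX by (auto intro: finite_sumset)
    have "card (?CX \<union> ?cX) + card (?CX \<inter> ?cX) = card ?CX + card ?cX"
      using card_Un_Int[OF fin] by simp
    then have c1: "real (card (insert c C \<boxplus> X)) = card ?CX + real (card X) - card Z"
      using card_translate[OF cC(1) Xc] card_translate[OF cC(1), of Z] ZX Xc unfolding ins int by auto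
    have each: "real (card (insert c C \<boxplus> X \<boxplus> Y i)) \<le> card (?CX \<boxplus> Y i) + real (card (X \<boxplus> Y i)) - card (Z \<boxplus> Y i)"
      if i: "i \<in> I" for i
    proof -
      have Yi: "finite (Y i)" "Y i \<subseteq> carrier G" using Y i by auto
      let ?XY = "{c} \<boxplus> (X \<boxplus> Y i)" and ?ZY = "{c} \<boxplus> (Z \<boxplus> Y i)"
      have asX: "?cX \<boxplus> Y i = ?XY" using sumset_assoc[of "{c}" X "Y i"] cC Xc Yi by simp
      have asZ: "({c} \<boxplus> Z) \<boxplus> Y i = ?ZY" using sumset_assoc[of "{c}" Z "Y i"] cC Xc ZX Yi by auto
      have sub: "?ZY \<subseteq> ?CX \<boxplus> Y i"
        unfolding asZ[symmetric] int[symmetric] by (intro sumset_mono) auto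
      have ZYXY: "?ZY \<subseteq> ?XY" using ZX by (intro sumset_mono) auto
      have finXY: "finite ?XY" "finite ?ZY" using finXX finZ Yi by (auto intro!: finite_sumset)
      have f2: "finite (?CX \<boxplus> Y i)" using fin Yi by (auto intro!: finite_sumset)
      have "insert c C \<boxplus> X \<boxplus> Y i = (?CX \<boxplus> Y i) \<union> ?XY" unfolding ins sumset_Un_left asX ..
      also have "\<dots> \<subseteq> (?CX \<boxplus> Y i) \<union> (?XY - ?ZY)" using sub by auto
      finally have "card (insert c C \<boxplus> X \<boxplus> Y i) \<le> card ((?CX \<boxplus> Y i) \<union> (?XY - ?ZY))"
        using f2 finXY by (intro card_mono) auto
      also have "\<dots> \<le> card (?CX \<boxplus> Y i) + card (?XY - ?ZY)" by (rule card_Un_le)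
      also have "card (?XY - ?ZY) = card ?XY - card ?ZY" using finXY ZYXY by (intro card_Diff_subset)
      finally have a: "card (insert c C \<boxplus> X \<boxplus> Y i) \<le> card (?CX \<boxplus> Y i) + (card ?XY - card ?ZY)" .
      have "card ?ZY \<le> card ?XY" using finXY ZYXY by (intro card_mono)
      moreover have "card ?ZY = card (Z \<boxplus> Y i)" "card ?XY = card (X \<boxplus> Y i)"
        using Xc ZX Yi cC by (intro card_translate sumset_closed; auto)+
      ultimately show ?thesis using a by linarith
    qed
    have "\<mu> (insert c C \<boxplus> X) \<le> (\<Sum>i\<in>I. (card (?CX \<boxplus> Y i) + real (card (X \<boxplus> Y i)) - card (Z \<boxplus> Y i)) / k i)"
      unfolding \<mu>_def by (intro sum_mono divide_right_mono each) (use k in \<open>auto intro: less_imp_le\<close>)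
    also have "\<dots> = \<mu> ?CX + \<mu> X - \<mu> Z"
      by (simp add: \<mu>_def add_divide_distrib diff_divide_distrib sum.distrib sum_subtractf)
    also have "\<dots> \<le> \<kappa> * card ?CX + \<kappa> * card X - \<kappa> * card Z"
      using insert.IH[OF cC(2)] \<mu>X minZ[OF ZX] by linarith
    finally show ?case unfolding c1 by (simp add: algebra_simps)
  qed
  have "real (card (C \<boxplus> X \<boxplus> Y i)) \<le> card I * k i * card (C \<boxplus> X)"
    if "finite C" "C \<subseteq> carrier G" "i \<in> I" for C i
  proof -
    have "real (card (C \<boxplus> X \<boxplus> Y i)) / k i \<le> \<mu> (C \<boxplus> X)"
      unfolding \<mu>_def using I \<open>i \<in> I\<close> k
      by (intro member_le_sum[where f="\<lambda>i. real (card (C \<boxplus> X \<boxplus> Y i)) / k i"]) (auto intro!: divide_nonneg_nonneg less_imp_le[OF k])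
    also have "\<dots> \<le> \<kappa> * card (C \<boxplus> X)" using main that by blast
    also have "\<dots> \<le> card I * card (C \<boxplus> X)" using \<kappa>I by (simp add: mult_right_mono)
    finally show ?thesis using k[OF \<open>i \<in> I\<close>] by (simp add: field_simps)
  qed
  then show ?thesis using Xs by blast
qed

end

text \<open>
  The Cauchy-Schwarz inequality for the sizes of the fibres of \<open>f\<close>.
\<close>

lemma card_squared_le_image_collisions:
  assumes "finite A"
  shows "(card A)\<^sup>2 \<le> card (f ` A) * card {(a, b). a \<in> A \<and> b \<in> A \<and> f a = f b}"
proof -
  define r where "r z = card {a \<in> A. f a = z}" for z
  have fin: "finite (f ` A)" using assms by simp
  have "card A = (\<Sum>z\<in>f ` A. r z)" unfolding r_def
    using sum.image_gen[OF assms, of "\<lambda>_. 1::nat" f] by simp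
  then have "real ((card A)\<^sup>2) = (\<Sum>z\<in>f ` A. real (r z))\<^sup>2" by simp
  also have "\<dots> \<le> (\<Sum>z\<in>f ` A. (real (r z))\<^sup>2) * card (f ` A)"
    by (rule sum_squared_le_sum_of_squares)
  also have "\<dots> = real (card (f ` A) * (\<Sum>z\<in>f ` A. (r z)\<^sup>2))" by simp
  finally have "(card A)\<^sup>2 \<le> card (f ` A) * (\<Sum>z\<in>f ` A. (r z)\<^sup>2)" unfolding of_nat_le_iff .
  also have "(\<Sum>z\<in>f ` A. (r z)\<^sup>2) = card (SIGMA z:f ` A. {a \<in> A. f a = z} \<times> {a \<in> A. f a = z})"
    using assms by (simp add: card_SigmaI card_cartesian_product r_def power2_eq_square)
  also have "\<dots> = card ((\<lambda>(z, a, b). (a, b)) ` (SIGMA z:f ` A. {a \<in> A. f a = z} \<times> {a \<in> A. f a = z}))"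
    by (intro card_image[symmetric]) (auto simp: inj_on_def)
  also have "(\<lambda>(z, a, b). (a, b)) ` (SIGMA z:f ` A. {a \<in> A. f a = z} \<times> {a \<in> A. f a = z})
      = {(a, b). a \<in> A \<and> b \<in> A \<and> f a = f b}"
    by (auto simp: image_iff) 
  finally show ?thesis .
qed

context abelian_group
begin

lemma sumset_comm: "A \<subseteq> carrier G \<Longrightarrow> B \<subseteq> carrier G \<Longrightarrow> A \<boxplus> B = B \<boxplus> A"
proof -
  assume "A \<subseteq> carrier G" "B \<subseteq> carrier G"
  then have "a \<oplus> b = b \<oplus> a" if "a \<in> A" "b \<in> B" for a b using that by (intro a_comm) auto
  then show ?thesis unfolding sumset_def by force
qed

lemma sumset_zero: "A \<subseteq> carrier G \<Longrightarrow> {\<zero>} \<boxplus> A = A"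
  unfolding sumset_def by (auto simp: subset_iff)

text \<open>
  The set \<open>X\<close> supplied by Petridis' argument serves all translating sets \<open>C\<close> simultaneously. Hence the
  summands can be added one after the other, those already present being put into \<open>C\<close>.
\<close>

lemma iterated_sumset_bound:
  assumes X: "X \<noteq> {}" "X \<subseteq> carrier G"
    and Y: "\<And>i. i \<in> {i1, i2, i3} \<Longrightarrow> finite (Y i) \<and> Y i \<subseteq> carrier G"
    and k: "\<And>i. i \<in> {i1, i2, i3} \<Longrightarrow> (k i :: real) > 0"
    and P: "\<And>C i. finite C \<Longrightarrow> C \<subseteq> carrier G \<Longrightarrow> i \<in> {i1, i2, i3} \<Longrightarrow>
           real (card (C \<boxplus> X \<boxplus> Y i)) \<le> m * k i * card (C \<boxplus> X)"
    and m: "m \<ge> 0"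
  shows "real (card (X \<boxplus> (Y i1 \<boxplus> Y i2 \<boxplus> Y i3))) \<le> m ^ 3 * (k i1 * k i2 * k i3) * card X"
proof -
  have Yc: "finite (Y i1)" "finite (Y i2)" "finite (Y i3)"
    "Y i1 \<subseteq> carrier G" "Y i2 \<subseteq> carrier G" "Y i3 \<subseteq> carrier G" using Y by auto
  have a: "real (card (X \<boxplus> Y i1)) \<le> m * k i1 * card X"
    using P[of "{\<zero>}" i1] X by (simp add: sumset_zero)
  have b: "real (card (Y i1 \<boxplus> X \<boxplus> Y i2)) \<le> m * k i2 * card (Y i1 \<boxplus> X)"
    using P[of "Y i1" i2] Yc by simp
  have c: "real (card (Y i1 \<boxplus> Y i2 \<boxplus> X \<boxplus> Y i3)) \<le> m * k i3 * card (Y i1 \<boxplus> Y i2 \<boxplus> X)"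
    using P[of "Y i1 \<boxplus> Y i2" i3] Yc by (simp add: finite_sumset sumset_closed)
  have e1: "Y i1 \<boxplus> X = X \<boxplus> Y i1" using sumset_comm X Yc by simp
  have e2: "Y i1 \<boxplus> Y i2 \<boxplus> X = Y i1 \<boxplus> X \<boxplus> Y i2"
    using X Yc by (simp add: sumset_assoc sumset_closed sumset_comm[of X])
  have e3: "X \<boxplus> (Y i1 \<boxplus> Y i2 \<boxplus> Y i3) = Y i1 \<boxplus> Y i2 \<boxplus> X \<boxplus> Y i3"
    using X Yc by (simp add: sumset_comm[of _ X] sumset_assoc[symmetric] sumset_closed)
  have "real (card (Y i1 \<boxplus> Y i2 \<boxplus> X \<boxplus> Y i3)) \<le> m * k i3 * (m * k i2 * (m * k i1 * card X))"
    using c b a m k[of i1] k[of i2] k[of i3] unfolding e1 e2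
    by (meson less_imp_le mult_left_mono mult_nonneg_nonneg order_trans insertCI)
  then show ?thesis unfolding e3 by (simp add: power3_eq_cube mult_ac)
qed

end

section \<open>Ratios of differences and the sum-product dichotomy\<close>

context field
begin

definition scale :: "'a \<Rightarrow> 'a set \<Rightarrow> 'a set" where "scale c B = (\<lambda>x. c \<otimes> x) ` B"

lemma scale_closed: "c \<in> carrier R \<Longrightarrow> B \<subseteq> carrier R \<Longrightarrow> scale c B \<subseteq> carrier R"
  by (auto simp: scale_def)

lemma finite_scale: "finite B \<Longrightarrow> finite (scale c B)"
  by (simp add: scale_def)

lemma inj_on_scale: "c \<in> carrier R \<Longrightarrow> c \<noteq> \<zero> \<Longrightarrow> B \<subseteq> carrier R \<Longrightarrow> inj_on (\<lambda>x. c \<otimes> x) B"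
  by (intro inj_onI) (auto simp: subset_iff m_lcancel)

lemma card_scale: "c \<in> carrier R \<Longrightarrow> c \<noteq> \<zero> \<Longrightarrow> B \<subseteq> carrier R \<Longrightarrow> card (scale c B) = card B"
  unfolding scale_def by (rule card_image[OF inj_on_scale])

text \<open>
  Expanding the coefficients turns the expression into a signed sum of one element from each of six dilates of \<open>B\<close>,
  three with a plus and three with a minus sign; the ties between these elements are given up. Each of the two
  groups of three is added to one and the same subset \<open>X\<close> of \<open>B\<close>, and the triangle inequality then removes \<open>X\<close>.
\<close>

lemma six_dilates:
  fixes e :: "nat \<Rightarrow> 'a" and k :: "nat \<Rightarrow> real"
  assumes B: "finite B" "B \<noteq> {}" "B \<subseteq> carrier R"
    and e: "\<And>i. i < 6 \<Longrightarrow> e i \<in> carrier R" and k: "\<And>i. i < 6 \<Longrightarrow> k i > 0"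
    and le: "\<And>i. i < 6 \<Longrightarrow> real (card (B \<boxplus> scale (\<ominus> e i) B)) \<le> k i * card B"
  shows "real (card ((\<lambda>(x, y). (e 0 \<ominus> e 3) \<otimes> x \<oplus> ((e 1 \<oplus> e 2) \<ominus> (e 4 \<oplus> e 5)) \<otimes> y) ` (B \<times> B)))
     \<le> 6 ^ 6 * (k 0 * k 1 * k 2 * (k 3 * k 4 * k 5)) * card B"
proof -
  define Y where "Y i = scale (\<ominus> e i) B" for i
  have Y: "finite (Y i) \<and> Y i \<subseteq> carrier R" if "i < 6" for i
    using that e B by (auto simp: Y_def finite_scale scale_closed)
  have "\<exists>X. X \<noteq> {} \<and> X \<subseteq> B \<and> (\<forall>C i. finite C \<longrightarrow> C \<subseteq> carrier R \<longrightarrow> i \<in> {..<6} \<longrightarrow>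
           real (card (C \<boxplus> X \<boxplus> Y i)) \<le> card {..<6::nat} * k i * card (C \<boxplus> X))"
  proof (rule plunnecke_petridis[OF B finite_lessThan])
    fix i :: nat assume "i \<in> {..<6}"
    then have i: "i < 6" by simp
    show "finite (Y i) \<and> Y i \<subseteq> carrier R" by (rule Y[OF i])
    show "k i > 0" by (rule k[OF i])
    show "real (card (B \<boxplus> Y i)) \<le> k i * card B" using le[OF i] by (simp add: Y_def)
  qed
  then obtain X where X: "X \<noteq> {}" "X \<subseteq> B" and ex: "\<forall>C i. finite C \<longrightarrow> C \<subseteq> carrier R \<longrightarrow> i \<in> {..<6} \<longrightarrow>
           real (card (C \<boxplus> X \<boxplus> Y i)) \<le> card {..<6::nat} * k i * card (C \<boxplus> X)" by blast
  have PP: "real (card (C \<boxplus> X \<boxplus> Y i)) \<le> 6 * k i * card (C \<boxplus> X)"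
    if "finite C" "C \<subseteq> carrier R" "i < 6" for C i
    using ex[rule_format, OF that(1,2), of i] that(3) by simp
  have Xc: "X \<subseteq> carrier R" and finX: "finite X" using X B finite_subset by auto
  define P where "P = Y 0 \<boxplus> Y 1 \<boxplus> Y 2"
  define Q where "Q = Y 3 \<boxplus> Y 4 \<boxplus> Y 5"
  have XP: "real (card (X \<boxplus> P)) \<le> 6 ^ 3 * (k 0 * k 1 * k 2) * card X" unfolding P_def
  proof (rule iterated_sumset_bound[OF X(1) Xc])
    fix i :: nat assume "i \<in> {0, 1, 2}"
    then have i: "i < 6" by auto
    show "finite (Y i) \<and> Y i \<subseteq> carrier R" "k i > 0" using Y[OF i] k[OF i] by auto
    show "real (card (C \<boxplus> X \<boxplus> Y i)) \<le> 6 * k i * card (C \<boxplus> X)"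
      if "finite C" "C \<subseteq> carrier R" for C using PP[OF that i] .
  qed simp
  have XQ: "real (card (X \<boxplus> Q)) \<le> 6 ^ 3 * (k 3 * k 4 * k 5) * card X" unfolding Q_def
  proof (rule iterated_sumset_bound[OF X(1) Xc])
    fix i :: nat assume "i \<in> {3, 4, 5}"
    then have i: "i < 6" by auto
    show "finite (Y i) \<and> Y i \<subseteq> carrier R" "k i > 0" using Y[OF i] k[OF i] by auto
    show "real (card (C \<boxplus> X \<boxplus> Y i)) \<le> 6 * k i * card (C \<boxplus> X)"
      if "finite C" "C \<subseteq> carrier R" for C using PP[OF that i] .
  qed simp
  have PQ: "finite P" "finite Q" "P \<subseteq> carrier R" "Q \<subseteq> carrier R"
    unfolding P_def Q_def by (intro finite_sumset sumset_closed conjunct1[OF Y] conjunct2[OF Y]; simp)+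
  have finPQ: "finite (P \<boxminus> Q)" using PQ by (auto simp: diffset_def)
  have "real (card X * card (P \<boxminus> Q)) \<le> real (card (X \<boxplus> P)) * real (card (X \<boxplus> Q))"
    using ruzsa_triangle[OF finX PQ(1,2) Xc PQ(3,4)] by (simp only: of_nat_le_iff of_nat_mult[symmetric])
  also have "\<dots> \<le> (6 ^ 3 * (k 0 * k 1 * k 2) * card X) * (6 ^ 3 * (k 3 * k 4 * k 5) * card X)"
    using XP XQ by (intro mult_mono order_trans[OF of_nat_0_le_iff XP]) auto
  finally have "real (card X) * card (P \<boxminus> Q) \<le> card X * (6 ^ 6 * (k 0 * k 1 * k 2 * (k 3 * k 4 * k 5)) * card X)"
    by (simp add: algebra_simps)
  then have D: "real (card (P \<boxminus> Q)) \<le> 6 ^ 6 * (k 0 * k 1 * k 2 * (k 3 * k 4 * k 5)) * card X"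
    using X finX by (simp add: card_gt_0_iff)
  also have "\<dots> \<le> 6 ^ 6 * (k 0 * k 1 * k 2 * (k 3 * k 4 * k 5)) * card B"
    using k[of 0] k[of 1] k[of 2] k[of 3] k[of 4] k[of 5] card_mono[OF B(1) X(2)]
    by (intro mult_left_mono) auto
  finally have D': "real (card (P \<boxminus> Q)) \<le> 6 ^ 6 * (k 0 * k 1 * k 2 * (k 3 * k 4 * k 5)) * card B" .
  have "(e 0 \<ominus> e 3) \<otimes> x \<oplus> ((e 1 \<oplus> e 2) \<ominus> (e 4 \<oplus> e 5)) \<otimes> y \<in> (\<lambda>z. \<ominus> z) ` (P \<boxminus> Q)"
    if "x \<in> B" "y \<in> B" for x y
  proof -
    have c: "x \<in> carrier R" "y \<in> carrier R" "e 0 \<in> carrier R" "e 1 \<in> carrier R" "e 2 \<in> carrier R"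
      "e 3 \<in> carrier R" "e 4 \<in> carrier R" "e 5 \<in> carrier R" using that B e by auto
    have p: "(\<ominus> e 0) \<otimes> x \<oplus> (\<ominus> e 1) \<otimes> y \<oplus> (\<ominus> e 2) \<otimes> y \<in> P"
      unfolding P_def Y_def scale_def using that by (intro sumset_mem imageI)
    have q: "(\<ominus> e 3) \<otimes> x \<oplus> (\<ominus> e 4) \<otimes> y \<oplus> (\<ominus> e 5) \<otimes> y \<in> Q"
      unfolding Q_def Y_def scale_def using that by (intro sumset_mem imageI)
    have "(e 0 \<ominus> e 3) \<otimes> x \<oplus> ((e 1 \<oplus> e 2) \<ominus> (e 4 \<oplus> e 5)) \<otimes> y =
      \<ominus> (((\<ominus> e 0) \<otimes> x \<oplus> (\<ominus> e 1) \<otimes> y \<oplus> (\<ominus> e 2) \<otimes> y) \<ominus> ((\<ominus> e 3) \<otimes> x \<oplus> (\<ominus> e 4) \<otimes> y \<oplus> (\<ominus> e 5) \<otimes> y))"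
      using c by algebra
    then show ?thesis using p q by (auto simp: diffset_def)
  qed
  then have "(\<lambda>(x, y). (e 0 \<ominus> e 3) \<otimes> x \<oplus> ((e 1 \<oplus> e 2) \<ominus> (e 4 \<oplus> e 5)) \<otimes> y) ` (B \<times> B) \<subseteq> (\<lambda>z. \<ominus> z) ` (P \<boxminus> Q)"
    by auto
  then have "card ((\<lambda>(x, y). (e 0 \<ominus> e 3) \<otimes> x \<oplus> ((e 1 \<oplus> e 2) \<ominus> (e 4 \<oplus> e 5)) \<otimes> y) ` (B \<times> B)) \<le> card (P \<boxminus> Q)"
    using surj_card_le[OF finPQ] by blast
  then show ?thesis using D' by linarith
qed

text \<open>
  The ratios \<open>(a - b) / (c - d)\<close>, cleared of denominators.
\<close>

definition quotient_set :: "'a set \<Rightarrow> 'a set" where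
  "quotient_set B = {\<xi> \<in> carrier R. \<exists>a\<in>B. \<exists>b\<in>B. \<exists>c\<in>B. \<exists>d\<in>B. c \<noteq> d \<and> \<xi> \<otimes> (c \<ominus> d) = a \<ominus> b}"

definition lin_image :: "'a \<Rightarrow> 'a set \<Rightarrow> 'a set" where
  "lin_image \<xi> B = (\<lambda>(x, y). x \<oplus> \<xi> \<otimes> y) ` (B \<times> B)"

text \<open>
  A coincidence \<open>x \<oplus> \<rho> \<otimes> y = x' \<oplus> \<rho> \<otimes> y'\<close> with \<open>y \<noteq> y'\<close> would exhibit \<open>\<rho>\<close> as a ratio of differences.
\<close>

lemma card_lin_image_notin_quotient_set:
  assumes "B \<subseteq> carrier R" "\<rho> \<in> carrier R" "\<rho> \<notin> quotient_set B"
  shows "card (lin_image \<rho> B) = card B ^ 2"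
proof -
  have "inj_on (\<lambda>(x, y). x \<oplus> \<rho> \<otimes> y) (B \<times> B)"
  proof (rule inj_onI, clarify)
    fix x y x' y'
    assume m: "x \<in> B" "y \<in> B" "x' \<in> B" "y' \<in> B" and eq: "x \<oplus> \<rho> \<otimes> y = x' \<oplus> \<rho> \<otimes> y'"
    have c: "x \<in> carrier R" "y \<in> carrier R" "x' \<in> carrier R" "y' \<in> carrier R" using m assms by auto
    have "\<rho> \<otimes> (y' \<ominus> y) = (x' \<oplus> \<rho> \<otimes> y') \<ominus> x' \<ominus> \<rho> \<otimes> y" using c assms(2) by algebra
    also have "\<dots> = x \<ominus> x'" unfolding eq[symmetric] using c assms(2) by algebra
    finally have "y' = y" using assms m by (force simp: quotient_set_def)
    then show "x = x' \<and> y = y'" using eq c assms(2) by simp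
  qed
  then show ?thesis unfolding lin_image_def by (simp add: card_image card_cartesian_product power2_eq_square)
qed

lemma card_lin_image_le:
  assumes B: "finite B" "B \<subseteq> carrier R" and t: "t \<in> carrier R" "t \<noteq> \<zero>" and \<rho>: "\<rho> \<in> carrier R" "t \<otimes> \<rho> = s"
  shows "card (lin_image \<rho> B) \<le> card ((\<lambda>(x, y). t \<otimes> x \<oplus> s \<otimes> y) ` (B \<times> B))"
proof -
  have "scale t (lin_image \<rho> B) = (\<lambda>(x, y). t \<otimes> x \<oplus> s \<otimes> y) ` (B \<times> B)"
    unfolding scale_def lin_image_def image_image
  proof (rule image_cong[OF refl], clarify)
    fix x y assume "x \<in> B" "y \<in> B"
    then have "x \<in> carrier R" "y \<in> carrier R" using B by auto
    then show "t \<otimes> (x \<oplus> \<rho> \<otimes> y) = t \<otimes> x \<oplus> s \<otimes> y" using t \<rho> by (simp add: r_distr m_assoc[symmetric])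
  qed
  moreover have "lin_image \<rho> B \<subseteq> carrier R" using B \<rho> by (auto simp: lin_image_def)
  ultimately show ?thesis using card_scale[OF t] by (metis order_refl)
qed

context
  fixes B :: "'a set" and K :: real
  assumes B: "finite B" "\<one> \<in> B" "B \<subseteq> carrier R" "\<zero> \<notin> B"
    and K: "\<And>b. b \<in> B \<Longrightarrow> real (card (B \<boxplus> scale (\<ominus> b) B)) \<le> K * card B"
begin

lemma dilate_const_ge_1: "K \<ge> 1"
proof -
  have "card B \<le> card (B \<boxplus> scale (\<ominus> \<one>) B)"
    using B by (intro card_sumset_ge) (auto simp: finite_scale scale_closed scale_def)
  then have "real (card B) \<le> K * card B" using K[OF B(2)] by linarith
  moreover have "card B > 0" using B card_gt_0_iff by blast
  ultimately show ?thesis by simp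
qed

lemma dilate_zero: "real (card (B \<boxplus> scale (\<ominus> \<zero>) B)) \<le> 1 * card B"
proof -
  have "scale (\<ominus> \<zero>) B = {\<zero>}" using B by (force simp: scale_def)
  then show ?thesis using B sumset_zero[of B] sumset_comm[of B "{\<zero>}"] by simp
qed

text \<open>
  The triangle inequality with \<open>scale (\<ominus> e) B\<close> in the middle: the step from \<open>B\<close> to \<open>e B\<close> and the step from
  \<open>e B\<close> to \<open>e a B\<close> each cost a factor \<open>K\<close>.
\<close>

lemma dilate_product:
  assumes "a \<in> B" "e \<in> B"
  shows "real (card (B \<boxplus> scale (\<ominus> (e \<otimes> a)) B)) \<le> K\<^sup>2 * card B"
proof -
  have c: "a \<in> carrier R" "e \<in> carrier R" "e \<noteq> \<zero>" "a \<noteq> \<zero>" using assms B by auto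
  let ?X = "scale (\<ominus> e) B" and ?Q = "scale (e \<otimes> a) B"
  have X: "finite ?X" "?X \<subseteq> carrier R" and Q: "finite ?Q" "?Q \<subseteq> carrier R"
    using B c by (auto simp: finite_scale scale_closed)
  have ne: "\<ominus> e \<noteq> \<zero>" using c by (metis add.inv_eq_1_iff)
  have "card ?X * card (B \<boxminus> ?Q) \<le> card (?X \<boxplus> B) * card (?X \<boxplus> ?Q)"
    by (rule ruzsa_triangle) (use X Q B in auto)
  moreover have "card ?X = card B" using card_scale[OF _ ne B(3)] c by simp
  moreover have "B \<boxminus> ?Q = B \<boxplus> scale (\<ominus> (e \<otimes> a)) B"
  proof -
    have "x \<ominus> (e \<otimes> a) \<otimes> y = x \<oplus> (\<ominus> (e \<otimes> a)) \<otimes> y" if "x \<in> B" "y \<in> B" for x y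
    proof -
      have "x \<in> carrier R" "y \<in> carrier R" using that B by auto
      then show ?thesis using c by algebra
    qed
    then show ?thesis unfolding diffset_def sumset_def scale_def by auto
  qed
  moreover have "?X \<boxplus> B = B \<boxplus> ?X" using sumset_comm X B by blast
  moreover have "?X \<boxplus> ?Q = scale (\<ominus> e) (B \<boxplus> scale (\<ominus> a) B)"
  proof -
    have "(\<ominus> e) \<otimes> x \<oplus> (e \<otimes> a) \<otimes> y = (\<ominus> e) \<otimes> (x \<oplus> (\<ominus> a) \<otimes> y)" if "x \<in> B" "y \<in> B" for x y
    proof -
      have "x \<in> carrier R" "y \<in> carrier R" using that B by auto
      then show ?thesis using c by algebra
    qed
    then show ?thesis unfolding sumset_def scale_def by (auto simp: image_iff)
  qed
  moreover have "card (scale (\<ominus> e) (B \<boxplus> scale (\<ominus> a) B)) = card (B \<boxplus> scale (\<ominus> a) B)"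
    using card_scale[OF _ ne] c B by (simp add: sumset_closed scale_closed)
  ultimately have "card B * card (B \<boxplus> scale (\<ominus> (e \<otimes> a)) B) \<le> card (B \<boxplus> scale (\<ominus> e) B) * card (B \<boxplus> scale (\<ominus> a) B)"
    by simp
  then have "real (card B) * card (B \<boxplus> scale (\<ominus> (e \<otimes> a)) B) \<le> real (card (B \<boxplus> scale (\<ominus> e) B)) * real (card (B \<boxplus> scale (\<ominus> a) B))"
    by (simp only: of_nat_le_iff of_nat_mult[symmetric])
  also have "\<dots> \<le> (K * card B) * (K * card B)"
    using K assms dilate_const_ge_1 by (intro mult_mono) auto
  finally have "real (card B) * card (B \<boxplus> scale (\<ominus> (e \<otimes> a)) B) \<le> card B * (K\<^sup>2 * card B)"
    by (simp add: power2_eq_square mult_ac)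
  moreover have "card B > 0" using B card_gt_0_iff by blast
  ultimately show ?thesis by simp
qed

lemma six_dilates_lin_image:
  fixes k1 k2 k3 k4 k5 k6 L :: real
  assumes e: "e1 \<in> carrier R" "e2 \<in> carrier R" "e3 \<in> carrier R" "e4 \<in> carrier R" "e5 \<in> carrier R" "e6 \<in> carrier R"
    and k: "k1 > 0" "k2 > 0" "k3 > 0" "k4 > 0" "k5 > 0" "k6 > 0"
    and le: "real (card (B \<boxplus> scale (\<ominus> e1) B)) \<le> k1 * card B" "real (card (B \<boxplus> scale (\<ominus> e2) B)) \<le> k2 * card B"
      "real (card (B \<boxplus> scale (\<ominus> e3) B)) \<le> k3 * card B" "real (card (B \<boxplus> scale (\<ominus> e4) B)) \<le> k4 * card B"
      "real (card (B \<boxplus> scale (\<ominus> e5) B)) \<le> k5 * card B" "real (card (B \<boxplus> scale (\<ominus> e6) B)) \<le> k6 * card B"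
    and ne: "e1 \<noteq> e4" and \<rho>: "\<rho> \<in> carrier R" "(e1 \<ominus> e4) \<otimes> \<rho> = (e2 \<oplus> e3) \<ominus> (e5 \<oplus> e6)"
    and kk: "k1 * k2 * k3 * (k4 * k5 * k6) = L"
  shows "real (card (lin_image \<rho> B)) \<le> 6 ^ 6 * L * card B"
proof -
  define f where "f i = [e1, e2, e3, e4, e5, e6] ! i" for i
  define k where "k i = [k1, k2, k3, k4, k5, k6] ! i" for i
  have six: "i < 6 \<longleftrightarrow> i = 0 \<or> i = 1 \<or> i = 2 \<or> i = 3 \<or> i = 4 \<or> i = 5" for i :: nat by auto
  have f: "f 0 = e1" "f 1 = e2" "f 2 = e3" "f 3 = e4" "f 4 = e5" "f 5 = e6"
    and kf: "k 0 = k1" "k 1 = k2" "k 2 = k3" "k 3 = k4" "k 4 = k5" "k 5 = k6"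
    by (simp_all add: f_def k_def)
  have "e1 \<ominus> e4 \<noteq> \<zero>" using ne e by simp
  then have "card (lin_image \<rho> B) \<le> card ((\<lambda>(x, y). (e1 \<ominus> e4) \<otimes> x \<oplus> ((e2 \<oplus> e3) \<ominus> (e5 \<oplus> e6)) \<otimes> y) ` (B \<times> B))"
    using B e \<rho> by (intro card_lin_image_le) auto
  moreover have "real (card ((\<lambda>(x, y). (f 0 \<ominus> f 3) \<otimes> x \<oplus> ((f 1 \<oplus> f 2) \<ominus> (f 4 \<oplus> f 5)) \<otimes> y) ` (B \<times> B)))
     \<le> 6 ^ 6 * (k 0 * k 1 * k 2 * (k 3 * k 4 * k 5)) * card B"
    using B e k le by (intro six_dilates) (auto simp: six f kf simp del: One_nat_def)
  ultimately show ?thesis unfolding f kf kk by linarith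
qed

lemma lin_image_quotient:
  assumes "\<xi> \<in> quotient_set B"
  shows "real (card (lin_image \<xi> B)) \<le> 6 ^ 6 * K ^ 4 * card B"
proof -
  obtain a b c d where m: "a \<in> B" "b \<in> B" "c \<in> B" "d \<in> B" "c \<noteq> d" and eq: "\<xi> \<otimes> (c \<ominus> d) = a \<ominus> b"
    and \<xi>: "\<xi> \<in> carrier R" using assms by (auto simp: quotient_set_def)
  have car: "a \<in> carrier R" "b \<in> carrier R" "c \<in> carrier R" "d \<in> carrier R" using m B by auto
  have "(c \<ominus> d) \<otimes> \<xi> = (a \<oplus> \<zero>) \<ominus> (b \<oplus> \<zero>)" using eq car \<xi> by (simp add: m_comm)
  then show ?thesis
    using car m \<xi> K dilate_zero dilate_const_ge_1
    by (intro six_dilates_lin_image[of c a \<zero> d b \<zero> K K 1 K K 1]) (auto simp: power4_eq_xxxx)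
qed

text \<open>
  A ratio \<open>\<xi>\<close> can be multiplied by an element of \<open>B\<close> and remains a combination of few dilates of \<open>B\<close>; if the
  product is no longer a ratio, the number of values taken by \<open>x \<oplus> e \<xi> y\<close> is the full \<open>|B|\<^sup>2\<close> and must fit into
  these dilates. The dilates by the products \<open>e a\<close> and \<open>e b\<close> cost \<open>K\<^sup>2\<close> each.
\<close>

lemma mult_pivot:
  assumes "\<xi> \<in> quotient_set B" "e \<in> B" "e \<otimes> \<xi> \<notin> quotient_set B"
  shows "real (card B) \<le> 6 ^ 6 * K ^ 6"
proof -
  obtain a b c d where m: "a \<in> B" "b \<in> B" "c \<in> B" "d \<in> B" "c \<noteq> d" and eq: "\<xi> \<otimes> (c \<ominus> d) = a \<ominus> b"
    and \<xi>: "\<xi> \<in> carrier R" using assms by (auto simp: quotient_set_def)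
  have car: "a \<in> carrier R" "b \<in> carrier R" "c \<in> carrier R" "d \<in> carrier R" "e \<in> carrier R" using m assms B by auto
  have "(c \<ominus> d) \<otimes> (e \<otimes> \<xi>) = e \<otimes> (\<xi> \<otimes> (c \<ominus> d))" using car \<xi> by (simp add: m_ac)
  also have "\<dots> = (e \<otimes> a \<oplus> \<zero>) \<ominus> (e \<otimes> b \<oplus> \<zero>)" unfolding eq using car by algebra
  finally have "real (card (lin_image (e \<otimes> \<xi>) B)) \<le> 6 ^ 6 * K ^ 6 * card B"
    \<comment> \<open>the third place on each side is filled by the dilate by 0, which costs nothing\<close>
    using car m \<xi> K dilate_zero dilate_const_ge_1 dilate_product assms(2)
    by (intro six_dilates_lin_image[of c "e \<otimes> a" \<zero> d "e \<otimes> b" \<zero> K "K\<^sup>2" 1 K "K\<^sup>2" 1])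
      (auto simp: eval_nat_numeral)
  moreover have "card (lin_image (e \<otimes> \<xi>) B) = card B ^ 2"
    using card_lin_image_notin_quotient_set B car \<xi> assms by simp
  moreover have "card B > 0" using B card_gt_0_iff by blast
  ultimately show ?thesis by (simp add: power2_eq_square)
qed

text \<open>
  The same with \<open>\<xi> - 1 = ((a + d) - (b + c)) / (c - d)\<close>, where all six dilates are by elements of \<open>B\<close>.
\<close>

lemma add_pivot:
  assumes "\<xi> \<in> quotient_set B" "\<xi> \<ominus> \<one> \<notin> quotient_set B"
  shows "real (card B) \<le> 6 ^ 6 * K ^ 6"
proof -
  obtain a b c d where m: "a \<in> B" "b \<in> B" "c \<in> B" "d \<in> B" "c \<noteq> d" and eq: "\<xi> \<otimes> (c \<ominus> d) = a \<ominus> b"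
    and \<xi>: "\<xi> \<in> carrier R" using assms by (auto simp: quotient_set_def)
  have car: "a \<in> carrier R" "b \<in> carrier R" "c \<in> carrier R" "d \<in> carrier R" using m B by auto
  have "(c \<ominus> d) \<otimes> (\<xi> \<ominus> \<one>) = \<xi> \<otimes> (c \<ominus> d) \<ominus> (c \<ominus> d)" using car \<xi> by algebra
  also have "\<dots> = (a \<oplus> d) \<ominus> (b \<oplus> c)" unfolding eq using car by algebra
  finally have "real (card (lin_image (\<xi> \<ominus> \<one>) B)) \<le> 6 ^ 6 * K ^ 6 * card B"
    using car m \<xi> K dilate_const_ge_1
    by (intro six_dilates_lin_image[of c a d d b c K K K K K K]) (auto simp: eval_nat_numeral)
  moreover have "card (lin_image (\<xi> \<ominus> \<one>) B) = card B ^ 2"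
    using card_lin_image_notin_quotient_set B car \<xi> assms by simp
  moreover have "card B > 0" using B card_gt_0_iff by blast
  ultimately show ?thesis by (simp add: power2_eq_square)
qed

end

text \<open>
  Two different pairs \<open>(x, y)\<close>, \<open>(x', y')\<close> have the same image under \<open>x \<oplus> \<xi> \<otimes> y\<close> for at most one \<open>\<xi>\<close>. On average
  over \<open>F\<close> there are thus at most \<open>|B|\<^sup>2 + |B|\<^sup>4 / |F|\<close> collisions, and few collisions force a large image.
\<close>

lemma average_lin_image:
  assumes B: "finite B" "B \<noteq> {}" "B \<subseteq> carrier R" and F: "finite F" "F \<noteq> {}" "F \<subseteq> carrier R"
  shows "\<exists>\<xi>\<in>F. card B ^ 2 * card F \<le> card (lin_image \<xi> B) * (card F + card B ^ 2)"
proof -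
  let ?BB = "B \<times> B"
  define f where "f \<xi> = (\<lambda>(x, y). x \<oplus> \<xi> \<otimes> y)" for \<xi>
  define Q where "Q = ?BB \<times> ?BB"
  define E where "E \<xi> = {(a, b). a \<in> ?BB \<and> b \<in> ?BB \<and> f \<xi> a = f \<xi> b}" for \<xi>
  have finQ: "finite Q" using B by (simp add: Q_def)
  have E_alt: "E \<xi> = {q \<in> Q. f \<xi> (fst q) = f \<xi> (snd q)}" for \<xi> by (auto simp: E_def Q_def)
  have count: "card {\<xi> \<in> F. f \<xi> (fst q) = f \<xi> (snd q)} \<le> (if fst q = snd q then card F else 0) + 1" if q: "q \<in> Q" for q
  proof (cases "fst q = snd q")
    case True
    then show ?thesis by (simp add: card_mono[OF F(1)])
  next
    case False
    obtain x y x' y' where q': "q = ((x, y), (x', y'))" by (metis prod.collapse)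
    then have c: "x \<in> carrier R" "y \<in> carrier R" "x' \<in> carrier R" "y' \<in> carrier R" using q B by (auto simp: Q_def)
    have "\<xi> = \<xi>'" if "\<xi> \<in> F" "\<xi>' \<in> F" and e: "x \<oplus> \<xi> \<otimes> y = x' \<oplus> \<xi> \<otimes> y'" and e': "x \<oplus> \<xi>' \<otimes> y = x' \<oplus> \<xi>' \<otimes> y'" for \<xi> \<xi>'
    proof -
      have \<xi>: "\<xi> \<in> carrier R" "\<xi>' \<in> carrier R" using that F by auto
      have "y \<noteq> y'" using False q' e \<xi> c by auto
      have *: "\<zeta> \<otimes> (y \<ominus> y') = x' \<ominus> x" if "\<zeta> \<in> carrier R" "x \<oplus> \<zeta> \<otimes> y = x' \<oplus> \<zeta> \<otimes> y'" for \<zeta>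
      proof -
        have "\<zeta> \<otimes> (y \<ominus> y') = (x \<oplus> \<zeta> \<otimes> y) \<ominus> x \<ominus> \<zeta> \<otimes> y'" using that(1) c by algebra
        also have "\<dots> = x' \<ominus> x" unfolding that(2) using that(1) c by algebra
        finally show ?thesis .
      qed
      have "\<xi> \<otimes> (y \<ominus> y') = \<xi>' \<otimes> (y \<ominus> y')" using *[OF \<xi>(1) e] *[OF \<xi>(2) e'] by simp
      moreover have "y \<ominus> y' \<noteq> \<zero>" using \<open>y \<noteq> y'\<close> c by simp
      ultimately show ?thesis using \<xi> c m_rcancel by simp
    qed
    then have "card {\<xi> \<in> F. f \<xi> (fst q) = f \<xi> (snd q)} \<le> 1"
      unfolding q' f_def One_nat_def using F by (subst card_le_Suc0_iff_eq) auto
    then show ?thesis using False by simp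
  qed
  have "(\<Sum>\<xi>\<in>F. card (E \<xi>)) = (\<Sum>q\<in>Q. card {\<xi> \<in> F. f \<xi> (fst q) = f \<xi> (snd q)})"
    unfolding E_alt using sum_multicount_gen[OF F(1) finQ, of "\<lambda>\<xi> q. f \<xi> (fst q) = f \<xi> (snd q)" "\<lambda>q. card {\<xi> \<in> F. f \<xi> (fst q) = f \<xi> (snd q)}"]
    by simp
  also have "\<dots> \<le> (\<Sum>q\<in>Q. (if fst q = snd q then card F else 0) + 1)" by (intro sum_mono count)
  also have "\<dots> = (\<Sum>q\<in>Q. (if fst q = snd q then card F else 0)) + (\<Sum>q\<in>Q. 1)" by (rule sum.distrib)
  also have "\<dots> = (\<Sum>q\<in>{q\<in>Q. fst q = snd q}. card F) + card Q"
    unfolding sum.inter_filter[OF finQ] by simp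
  also have "{q\<in>Q. fst q = snd q} = (\<lambda>b. (b, b)) ` ?BB" by (auto simp: Q_def)
  also have "(\<Sum>q\<in>(\<lambda>b. (b, b)) ` ?BB. card F) = card B ^ 2 * card F"
    by (simp add: card_image inj_on_def card_cartesian_product power2_eq_square)
  also have "card Q = card B ^ 4" by (simp add: Q_def card_cartesian_product power4_eq_xxxx)
  finally have tot: "(\<Sum>\<xi>\<in>F. card (E \<xi>)) \<le> card B ^ 2 * card F + card B ^ 4" .
  have "\<exists>\<xi>\<in>F. card F * card (E \<xi>) \<le> card B ^ 2 * card F + card B ^ 4"
  proof (rule ccontr)
    assume "\<not> ?thesis"
    then have "(\<Sum>\<xi>\<in>F. card B ^ 2 * card F + card B ^ 4) < (\<Sum>\<xi>\<in>F. card F * card (E \<xi>))"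
      using F by (intro sum_strict_mono) auto
    also have "\<dots> = card F * (\<Sum>\<xi>\<in>F. card (E \<xi>))" by (simp add: sum_distrib_left)
    also have "\<dots> \<le> card F * (card B ^ 2 * card F + card B ^ 4)" using tot by (rule mult_left_mono) simp
    finally show False by simp
  qed
  then obtain \<xi> where \<xi>: "\<xi> \<in> F" and le: "card F * card (E \<xi>) \<le> card B ^ 2 * card F + card B ^ 4" by blast
  have "(card ?BB)\<^sup>2 \<le> card (f \<xi> ` ?BB) * card (E \<xi>)"
    unfolding E_def using card_squared_le_image_collisions[of ?BB "f \<xi>"] B by simp
  then have "card F * card B ^ 4 \<le> card F * (card (lin_image \<xi> B) * card (E \<xi>))"
    by (intro mult_left_mono) (simp_all add: card_cartesian_product power2_eq_square power4_eq_xxxx f_def lin_image_def mult_ac)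
  also have "\<dots> = card (lin_image \<xi> B) * (card F * card (E \<xi>))" by simp
  also have "\<dots> \<le> card (lin_image \<xi> B) * (card B ^ 2 * card F + card B ^ 4)" using le by (rule mult_left_mono) simp
  finally have "card B ^ 2 * (card B ^ 2 * card F) \<le> card B ^ 2 * (card (lin_image \<xi> B) * (card F + card B ^ 2))"
    by (simp add: power2_eq_square power4_eq_xxxx algebra_simps)
  moreover have "card B ^ 2 > 0" using B by (simp add: card_gt_0_iff)
  ultimately have "card B ^ 2 * card F \<le> card (lin_image \<xi> B) * (card F + card B ^ 2)"
    by (metis nat_mult_le_cancel1)
  then show ?thesis using \<xi> by blast
qed

text \<open>
  The sum-product dichotomy. Either some ratio leaves the quotient set when it is multiplied by an element of
  \<open>B\<close> or shifted by 1, and then \<open>B\<close> is small; or the quotient set is stable under these operations and contains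
  a subfield that includes \<open>B\<close>. In the second case some element of that subfield gives many values of
  \<open>x \<oplus> \<xi> \<otimes> y\<close>, and being a ratio it cannot give more than four dilates of \<open>B\<close> have room for.
\<close>

lemma card_le_or_subfield:
  fixes B :: "'a set" and K :: real
  assumes fin: "finite (carrier R)" and B: "\<one> \<in> B" "B \<subseteq> carrier R" "\<zero> \<notin> B"
    and K: "\<And>b. b \<in> B \<Longrightarrow> real (card (B \<boxplus> scale (\<ominus> b) B)) \<le> K * card B"
  shows "real (card B) \<le> 6 ^ 6 * K ^ 6 \<or>
    (\<exists>F. subgroup F (add_monoid R) \<and> subgroup (F - {\<zero>}) (mult_of R) \<and> B \<subseteq> F \<and>
         real (card B * card F) \<le> 6 ^ 6 * K ^ 4 * (card F + card B ^ 2))"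
proof (unfold disj_imp, rule impI)
  assume neg: "\<not> (real (card B) \<le> 6 ^ 6 * K ^ 6)"
  have finB: "finite B" using B fin finite_subset by auto
  note B' = finB B
  have K1: "K \<ge> 1" using dilate_const_ge_1[OF B' K] .
  define Q where "Q = quotient_set B"
  have mul: "e \<otimes> \<xi> \<in> Q" if "\<xi> \<in> Q" "e \<in> B" for e \<xi>
    using mult_pivot[OF B' K] that neg unfolding Q_def by blast
  have sub: "\<xi> \<ominus> \<one> \<in> Q" if "\<xi> \<in> Q" for \<xi>
    using add_pivot[OF B' K] that neg unfolding Q_def by blast
  have Qc: "Q \<subseteq> carrier R" by (auto simp: Q_def quotient_set_def)
  have finQ: "finite Q" using Qc fin finite_subset by auto
  have "card B \<noteq> 1"
  proof
    assume "card B = 1"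
    moreover have "1 \<le> K ^ 6" using K1 by (rule one_le_power)
    ultimately show False using neg by simp
  qed
  then obtain c where c: "c \<in> B" "c \<noteq> \<one>"
    using B by (metis card_1_singleton_iff is_singletonI' is_singleton_altdef equals0D)
  have "\<zero> \<otimes> (c \<ominus> \<one>) = \<one> \<ominus> \<one>" using B c by (auto simp: a_minus_def r_neg)
  then have zQ: "\<zero> \<in> Q" using B c unfolding Q_def quotient_set_def by blast
  have negQ: "\<ominus> \<xi> \<in> Q" if \<xi>: "\<xi> \<in> Q" for \<xi>
  proof -
    obtain a b c d where m: "a \<in> B" "b \<in> B" "c \<in> B" "d \<in> B" "c \<noteq> d" and eq: "\<xi> \<otimes> (c \<ominus> d) = a \<ominus> b"
      and x: "\<xi> \<in> carrier R" using \<xi> by (auto simp: quotient_set_def Q_def)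
    have car: "a \<in> carrier R" "b \<in> carrier R" "c \<in> carrier R" "d \<in> carrier R" using m B by auto
    have "(\<ominus> \<xi>) \<otimes> (c \<ominus> d) = \<ominus> (\<xi> \<otimes> (c \<ominus> d))" using x car by algebra
    also have "\<dots> = b \<ominus> a" unfolding eq using car by algebra
    finally show ?thesis using m x unfolding Q_def quotient_set_def by blast
  qed
  \<comment> \<open>\<open>S\<close> collects the shifts that preserve \<open>Q\<close> and \<open>F\<close> the multipliers of \<open>S\<close>; the latter is closed under both operations by construction, and \<open>F \<subseteq> S \<subseteq> Q\<close> because 1 belongs to \<open>S\<close> and 0 to \<open>Q\<close>\<close>
  define S where "S = {y \<in> carrier R. \<forall>\<xi>\<in>Q. \<xi> \<ominus> y \<in> Q}"
  define F where "F = {y \<in> carrier R. \<forall>z\<in>S. y \<otimes> z \<in> S}"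
  have SC: "S \<subseteq> carrier R" and FC: "F \<subseteq> carrier R" by (auto simp: S_def F_def)
  have finF: "finite F" using FC fin finite_subset by auto
  have S_add: "y \<oplus> z \<in> S" if "y \<in> S" "z \<in> S" for y z
  proof -
    have yz: "y \<in> carrier R" "z \<in> carrier R" using that by (auto simp: S_def)
    have "\<xi> \<ominus> (y \<oplus> z) \<in> Q" if \<xi>: "\<xi> \<in> Q" for \<xi>
    proof -
      have x: "\<xi> \<in> carrier R" using \<xi> Qc by auto
      have "\<xi> \<ominus> (y \<oplus> z) = (\<xi> \<ominus> y) \<ominus> z" using yz x by algebra
      then show ?thesis using \<open>y \<in> S\<close> \<open>z \<in> S\<close> \<xi> by (auto simp: S_def)
    qed
    then show ?thesis using yz by (auto simp: S_def)
  qed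
  have S0: "\<zero> \<in> S" using Qc by (auto simp: S_def a_minus_def)
  have S1: "\<one> \<in> S" using sub by (auto simp: S_def)
  have SQ: "S \<subseteq> Q"
  proof
    fix y assume y: "y \<in> S"
    then have "\<zero> \<ominus> y \<in> Q" using zQ by (auto simp: S_def)
    then have "\<ominus> (\<zero> \<ominus> y) \<in> Q" by (rule negQ)
    then show "y \<in> Q" using y SC by (auto simp: a_minus_def)
  qed
  have F_add: "y \<oplus> z \<in> F" if "y \<in> F" "z \<in> F" for y z
  proof -
    have "(y \<oplus> z) \<otimes> s = y \<otimes> s \<oplus> z \<otimes> s" if "s \<in> S" for s
      using \<open>y \<in> F\<close> \<open>z \<in> F\<close> that FC SC by (intro l_distr) auto
    then show ?thesis using that S_add by (auto simp: F_def)
  qed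
  have F_mult: "y \<otimes> z \<in> F" if "y \<in> F" "z \<in> F" for y z
  proof -
    have "(y \<otimes> z) \<otimes> s = y \<otimes> (z \<otimes> s)" if "s \<in> S" for s
      using \<open>y \<in> F\<close> \<open>z \<in> F\<close> that FC SC by (intro m_assoc) auto
    then show ?thesis using that by (auto simp: F_def)
  qed
  have F0: "\<zero> \<in> F" using S0 SC by (auto simp: F_def)
  have F1: "\<one> \<in> F" using SC by (auto simp: F_def)
  have BF: "B \<subseteq> F"
  proof
    fix e assume e: "e \<in> B"
    have ec: "e \<in> carrier R" "e \<noteq> \<zero>" using e B by auto
    have inj: "inj_on (\<lambda>\<xi>. e \<otimes> \<xi>) Q" using inj_on_scale ec Qc by blast
    \<comment> \<open>finiteness turns \<open>e Q \<subseteq> Q\<close> into equality, so that division by \<open>e\<close> also preserves \<open>Q\<close>\<close>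
    have img: "(\<lambda>\<xi>. e \<otimes> \<xi>) ` Q = Q"
      by (rule endo_inj_surj[OF finQ _ inj]) (use mul e in auto)
    have "e \<otimes> z \<in> S" if z: "z \<in> S" for z
    proof -
      have zc: "z \<in> carrier R" using z SC by auto
      have "\<xi> \<ominus> e \<otimes> z \<in> Q" if \<xi>: "\<xi> \<in> Q" for \<xi>
      proof -
        obtain \<xi>' where x': "\<xi>' \<in> Q" "\<xi> = e \<otimes> \<xi>'" using img \<xi> by blast
        then have "\<xi>' \<in> carrier R" using Qc by auto
        then have "\<xi> \<ominus> e \<otimes> z = e \<otimes> (\<xi>' \<ominus> z)" unfolding x'(2) using ec zc by algebra
        then show ?thesis using mul e z x' by (auto simp: S_def)
      qed
      then show ?thesis using ec zc by (auto simp: S_def)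
    qed
    then show "e \<in> F" using ec by (auto simp: F_def)
  qed
  have FS: "F \<subseteq> S" using S1 FC by (auto simp: F_def subset_iff)
  then have FQ: "F \<subseteq> Q" using SQ by auto
  have addF: "subgroup F (add_monoid R)"
  proof (rule add.subgroupI)
    fix y assume y: "y \<in> F"
    then have yc: "y \<in> carrier R" using FC by auto
    have "(\<lambda>z. y \<oplus> z) ` F = F"
      by (rule endo_inj_surj[OF finF]) (use F_add y yc FC in \<open>auto simp: inj_on_def subset_iff\<close>)
    then obtain z where z: "z \<in> F" "y \<oplus> z = \<zero>" using F0 by (metis imageE)
    then have "\<ominus> y = z" using yc FC by (metis a_comm minus_equality subsetD)
    then show "\<ominus> y \<in> F" using z by simp
  qed (use F0 FC F_add in auto)
  have grp: "group (mult_of R)" by (rule field_mult_group)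
  have multF: "subgroup (F - {\<zero>}) (mult_of R)"
  proof (rule group.subgroupI[OF grp])
    fix y assume y: "y \<in> F - {\<zero>}"
    then have yc: "y \<in> carrier R" "y \<noteq> \<zero>" using FC by auto
    have "(\<lambda>z. y \<otimes> z) ` F = F"
      by (rule endo_inj_surj[OF finF]) (use F_mult y inj_on_scale[OF yc FC] in auto)
    then obtain z where z: "z \<in> F" "y \<otimes> z = \<one>" using F1 by (metis imageE)
    have zc: "z \<in> carrier R" using z FC by auto
    have "inv y = z" using z yc zc by (metis comm_inv_char)
    moreover have "z \<noteq> \<zero>" using z yc by auto
    moreover have "inv\<^bsub>mult_of R\<^esub> y = inv y" using yc by (intro m_inv_mult_of) auto
    ultimately show "inv\<^bsub>mult_of R\<^esub> y \<in> F - {\<zero>}" using z by simp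
  next
    fix y z assume "y \<in> F - {\<zero>}" "z \<in> F - {\<zero>}"
    moreover from this have "y \<in> carrier R" "z \<in> carrier R" using FC by auto
    ultimately show "y \<otimes>\<^bsub>mult_of R\<^esub> z \<in> F - {\<zero>}" using F_mult integral by auto
  qed (use F1 FC in auto)
  obtain \<xi> where \<xi>: "\<xi> \<in> F" and av: "card B ^ 2 * card F \<le> card (lin_image \<xi> B) * (card F + card B ^ 2)"
    using average_lin_image[of B F] finB B finF F0 FC by blast
  have Bpos: "card B > 0" using B finB card_gt_0_iff by blast
  have "real (card (lin_image \<xi> B)) \<le> 6 ^ 6 * K ^ 4 * card B"
    using lin_image_quotient[OF B' K] \<xi> FQ by (auto simp: Q_def)
  then have "real (card (lin_image \<xi> B)) * (card F + card B ^ 2) \<le> 6 ^ 6 * K ^ 4 * card B * (card F + card B ^ 2)"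
    by (intro mult_right_mono) auto
  moreover have "real (card B ^ 2 * card F) \<le> real (card (lin_image \<xi> B) * (card F + card B ^ 2))"
    using av unfolding of_nat_le_iff .
  ultimately have "card B * real (card B * card F) \<le> card B * (6 ^ 6 * K ^ 4 * (card F + card B ^ 2))"
    by (simp add: power2_eq_square mult_ac)
  then have "real (card B * card F) \<le> 6 ^ 6 * K ^ 4 * (card F + card B ^ 2)" using Bpos by simp
  then show "\<exists>F. subgroup F (add_monoid R) \<and> subgroup (F - {\<zero>}) (mult_of R) \<and> B \<subseteq> F \<and>
         real (card B * card F) \<le> 6 ^ 6 * K ^ 4 * (card F + card B ^ 2)"
    using addF multF BF by blast
qed

end

section \<open>Popular walks in Cayley graphs\<close>

text \<open>
  A Balog-Szemeredi-Gowers argument in a Cayley graph of degree \<open>u\<close>. Counting over all neighbourhoods, which are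
  translates of each other, shows that only few pairs in the neighbourhood \<open>N \<one>\<close> have fewer than \<open>k\<close> common
  neighbours. Two thresholds are used. Let \<open>A\<close> be the set of the \<open>x \<in> N \<one>\<close> that have at least \<open>k2\<close> common
  neighbours with all but \<open>e0\<close> elements of \<open>N \<one>\<close>. Some \<open>x0 \<in> A\<close> has at least \<open>k1\<close> common neighbours with most
  \<open>b \<in> A\<close>; after division by \<open>x0\<close> this says that the neighbourhoods \<open>N g\<close> and \<open>N (b g)\<close>, where
  \<open>g = inv x0\<close>, overlap in at least \<open>k1\<close> points. A walk from \<open>x\<close> to \<open>b y\<close> runs through a point \<open>a\<close> of this overlap: it is reached from \<open>x\<close>, and from
  \<open>b y\<close>, by \<open>k2\<close> paths of length two unless \<open>a\<close> is one of the at most \<open>e0\<close> exceptions on each side. Since the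
  exceptions must not exhaust the overlap, \<open>e0\<close> is a quarter of \<open>k1\<close>.
\<close>

lemma (in comm_group) popular_walks_to_dilates:
  fixes adj :: "'a \<Rightarrow> 'a \<Rightarrow> bool"
  assumes fin: "finite (carrier G)"
    and sym: "\<And>x y. x \<in> carrier G \<Longrightarrow> y \<in> carrier G \<Longrightarrow> adj x y \<Longrightarrow> adj y x"
    and inv: "\<And>g x y. g \<in> carrier G \<Longrightarrow> x \<in> carrier G \<Longrightarrow> y \<in> carrier G \<Longrightarrow>
                adj (g \<otimes> x) (g \<otimes> y) \<longleftrightarrow> adj x y"
    and u: "u = card {v \<in> carrier G. adj \<one> v}" "u > 0"
  shows "\<exists>B \<subseteq> carrier G. \<one> \<in> B \<and> u \<le> 2 * card B \<and> (\<forall>x\<in>B. \<forall>y\<in>B. \<forall>b\<in>B.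
     u ^ 8 \<le> 2 ^ 20 * order G ^ 5 * card {(s, a, t). s \<in> carrier G \<and> a \<in> carrier G \<and> t \<in> carrier G \<and>
        adj x s \<and> adj s a \<and> adj a t \<and> adj t (b \<otimes> y)})"
proof -
  define h where "h = order G"
  define N where "N g = {v \<in> carrier G. adj g v}" for g
  define n where "n x y = real (card (N x \<inter> N y))" for x y
  have NC: "N g \<subseteq> carrier G" for g by (auto simp: N_def)
  have NCD: "v \<in> carrier G" if "v \<in> N g" for v g using that by (auto simp: N_def)
  have finN: "finite (N g)" for g using NC fin finite_subset by blast
  have hpos: "h > 0" unfolding h_def order_def using fin one_closed card_gt_0_iff by blast
  have shift: "(g \<otimes> x \<in> N (g \<otimes> c)) = (x \<in> N c)" if "g \<in> carrier G" "x \<in> carrier G" "c \<in> carrier G" for g x c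
    using that inv by (auto simp: N_def)
  have Nimg: "N (g \<otimes> c) = (\<otimes>) g ` N c" if "g \<in> carrier G" "c \<in> carrier G" for g c
  proof
    show "(\<otimes>) g ` N c \<subseteq> N (g \<otimes> c)" using shift that by (auto dest: NCD)
    show "N (g \<otimes> c) \<subseteq> (\<otimes>) g ` N c"
    proof
      fix v assume v: "v \<in> N (g \<otimes> c)"
      then have vc: "v \<in> carrier G" using NC by auto
      have "v = g \<otimes> (inv g \<otimes> v)" using that vc by (simp add: m_assoc[symmetric])
      moreover have "inv g \<otimes> v \<in> N c" using shift[of g "inv g \<otimes> v" c] v vc that by (simp add: m_assoc[symmetric])
      ultimately show "v \<in> (\<otimes>) g ` N c" by blast
    qed
  qed
  have inj: "inj_on ((\<otimes>) g) A" if "g \<in> carrier G" "A \<subseteq> carrier G" for g A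
    using that by (intro inj_onI) (auto simp: subset_iff)
  have n_inv: "n (g \<otimes> x) (g \<otimes> y) = n x y" if "g \<in> carrier G" "x \<in> carrier G" "y \<in> carrier G" for g x y
  proof -
    have "N (g \<otimes> x) \<inter> N (g \<otimes> y) = (\<otimes>) g ` (N x \<inter> N y)"
      using Nimg that inj[of g "carrier G"] NC by (simp add: inj_on_image_Int)
    then show ?thesis unfolding n_def using card_image[OF inj[of g "N x \<inter> N y"]] that NC by auto
  qed
  have cardN: "card (N g) = u" if "g \<in> carrier G" for g
    using Nimg[of g \<one>] that card_image[OF inj[of g "N \<one>"]] NC u by (auto simp: N_def)
  define bad where "bad k c x = {a \<in> N c. n x a < k}" for k c x
  have badfin: "finite (bad k c x)" for k c x using finN by (auto simp: bad_def)
  have bad_inv: "card (bad k (g \<otimes> c) (g \<otimes> x)) = card (bad k c x)"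
    if "g \<in> carrier G" "c \<in> carrier G" "x \<in> carrier G" for k g c x
  proof -
    have "bad k (g \<otimes> c) (g \<otimes> x) = (\<otimes>) g ` bad k c x"
      unfolding bad_def Nimg[OF that(1,2)] using n_inv that by (auto dest: NCD intro!: imageI)
    then show ?thesis using card_image[OF inj[of g "bad k c x"]] that NC by (auto simp: bad_def)
  qed
  have badpairs: "(\<Sum>x\<in>N \<one>. real (card (bad k \<one> x))) \<le> k * h" if "k > 0" for k :: real
  proof -
    let ?P = "{p \<in> carrier G \<times> carrier G. n (fst p) (snd p) < k}"
    let ?R = "\<lambda>g p. fst p \<in> N g \<and> snd p \<in> N g"
    have finP: "finite ?P" using fin by auto
    have one: "(\<Sum>p\<in>?P. if ?R g p then 1 else 0) = (\<Sum>x\<in>N \<one>. real (card (bad k \<one> x)))"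
      if g: "g \<in> carrier G" for g
    proof -
      have "(\<Sum>p\<in>?P. if ?R g p then 1 else 0) = real (card {p \<in> ?P. ?R g p})"
        by (simp only: sum.inter_filter[OF finP, symmetric]) simp
      also have "{p \<in> ?P. ?R g p} = Sigma (N g) (bad k g)"
        by (auto simp: bad_def dest: NCD)
      also have "real (card (Sigma (N g) (bad k g))) = (\<Sum>x\<in>N g. real (card (bad k g x)))"
        using finN badfin by (simp add: card_SigmaI)
      also have "\<dots> = (\<Sum>x\<in>(\<otimes>) g ` N \<one>. real (card (bad k (g \<otimes> \<one>) x)))"
        using Nimg[of g \<one>] g by simp
      also have "\<dots> = (\<Sum>x\<in>N \<one>. real (card (bad k (g \<otimes> \<one>) (g \<otimes> x))))"
        using sum.reindex[OF inj[OF g NC]] by simp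
      also have "\<dots> = (\<Sum>x\<in>N \<one>. real (card (bad k \<one> x)))"
        using bad_inv[OF g one_closed] by (intro sum.cong) (auto dest: NCD)
      finally show ?thesis .
    qed
    have "h * (\<Sum>x\<in>N \<one>. real (card (bad k \<one> x))) = (\<Sum>g\<in>carrier G. \<Sum>p\<in>?P. if ?R g p then 1 else 0)"
      using one by (simp add: h_def order_def)
    also have "\<dots> = (\<Sum>p\<in>?P. \<Sum>g\<in>carrier G. if ?R g p then 1 else 0)" by (rule sum.swap)
    also have "\<dots> \<le> (\<Sum>p\<in>?P. k)"
    proof (intro sum_mono)
      fix p assume p: "p \<in> ?P"
      have "(\<Sum>g\<in>carrier G. if ?R g p then 1 else 0) = real (card {g \<in> carrier G. ?R g p})"
        by (simp only: sum.inter_filter[OF fin, symmetric]) simp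
      also have "{g \<in> carrier G. ?R g p} = N (fst p) \<inter> N (snd p)"
        using p unfolding N_def by (auto intro: sym)
      finally show "(\<Sum>g\<in>carrier G. if ?R g p then 1 else 0) \<le> k" using p by (simp add: n_def)
    qed
    also have "\<dots> = k * card ?P" by simp
    finally have le: "h * (\<Sum>x\<in>N \<one>. real (card (bad k \<one> x))) \<le> k * card ?P" .
    have "card ?P \<le> card (carrier G \<times> carrier G)" using fin by (intro card_mono) auto
    then have "card ?P \<le> h * h" by (simp add: card_cartesian_product h_def order_def)
    then have "real (card ?P) \<le> real h * real h" by (simp only: of_nat_le_iff of_nat_mult[symmetric])
    then have "k * card ?P \<le> h * (k * h)" using that by (simp add: mult_left_mono algebra_simps)
    then show ?thesis using le hpos by (smt (verit) mult_left_le_imp_le of_nat_0_less_iff)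
  qed
  have u_le: "u \<le> h" using cardN[OF one_closed] card_mono[OF fin NC[of \<one>]] by (simp add: h_def order_def)
  define H where "H = real h"
  define U where "U = real u"
  have HU: "0 < U" "U \<le> H" using u u_le by (auto simp: H_def U_def)
  \<comment> \<open>with these values at most an eighth of the pairs is bad for \<open>k1\<close>, and at most an eighth of \<open>N \<one>\<close> is lost in \<open>A\<close>\<close>
  define k1 where "k1 = U^2 / (8 * H)"
  define e0 where "e0 = k1 / 4"
  define k2 where "k2 = U^3 / (256 * H^2)"
  have k_pos: "k1 > 0" "e0 > 0" "k2 > 0" using HU by (auto simp: k1_def e0_def k2_def)
  define A where "A = {x \<in> N \<one>. card (bad k2 \<one> x) \<le> e0}"
  have A_N: "A \<subseteq> N \<one>" and finA: "finite A" using finN by (auto simp: A_def)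
  have "card (N \<one> - A) * e0 = (\<Sum>x\<in>N \<one> - A. e0)" by simp
  also have "\<dots> \<le> (\<Sum>x\<in>N \<one> - A. real (card (bad k2 \<one> x)))"
    by (intro sum_mono) (auto simp: A_def)
  also have "\<dots> \<le> (\<Sum>x\<in>N \<one>. real (card (bad k2 \<one> x)))"
    using finN by (intro sum_mono2) auto
  also have "\<dots> \<le> k2 * H" using badpairs k_pos by (simp add: H_def)
  also have "\<dots> = (U / 8) * e0" using HU by (simp add: k2_def e0_def k1_def field_simps power2_eq_square power3_eq_cube)
  finally have "card (N \<one> - A) \<le> U / 8" using k_pos by simp
  then have cardA: "card A \<ge> 7 * U / 8"
    using cardN[OF one_closed] card_Diff_subset[OF finA A_N] card_mono[OF finN A_N] by (simp add: U_def of_nat_diff)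
  have "\<exists>x\<^sub>0\<in>A. card (bad k1 \<one> x\<^sub>0) \<le> U / 7"
  proof (rule ccontr)
    assume "\<not> ?thesis"
    then have *: "\<And>x. x \<in> A \<Longrightarrow> card (bad k1 \<one> x) > U / 7" by force
    have "A \<noteq> {}" using cardA HU by auto
    have "U^2 / 8 = (7 * U / 8) * (U / 7)" by (simp add: power2_eq_square)
    also have "\<dots> \<le> card A * (U / 7)" using cardA HU by (intro mult_right_mono) auto
    also have "\<dots> = (\<Sum>x\<in>A. U / 7)" by simp
    also have "\<dots> < (\<Sum>x\<in>A. real (card (bad k1 \<one> x)))"
      using finA \<open>A \<noteq> {}\<close> * by (intro sum_strict_mono) auto
    also have "\<dots> \<le> (\<Sum>x\<in>N \<one>. real (card (bad k1 \<one> x)))"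
      using finN A_N by (intro sum_mono2) auto
    also have "\<dots> \<le> k1 * H" using badpairs k_pos by (simp add: H_def)
    also have "\<dots> = U^2 / 8" using HU by (simp add: k1_def)
    finally show False by simp
  qed
  then obtain x0 where x0: "x0 \<in> A" and x0bad: "card (bad k1 \<one> x0) \<le> U / 7" by blast
  have x0C: "x0 \<in> carrier G" using x0 A_N NC by auto
  define g where "g = inv x0"
  have gC: "g \<in> carrier G" using x0C by (simp add: g_def)
  define B0 where "B0 = {b \<in> A. n x0 b \<ge> k1}"
  have B0A: "B0 \<subseteq> A" and finB0: "finite B0" using finA by (auto simp: B0_def)
  have B0C: "B0 \<subseteq> carrier G" using B0A A_N NC by blast
  have "A - B0 \<subseteq> bad k1 \<one> x0" using A_N by (auto simp: B0_def bad_def)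
  then have "card (A - B0) \<le> card (bad k1 \<one> x0)" using badfin by (intro card_mono)
  then have cardB0: "card B0 \<ge> U / 2"
    using x0bad cardA card_Diff_subset[OF finB0 B0A] card_mono[OF finA B0A] HU by linarith
  have "n x0 x0 = U" using cardN[OF x0C] by (simp add: n_def U_def)
  moreover have "k1 \<le> U"
    using HU mult_mono[of U U U "8 * H"] by (simp add: k1_def power2_eq_square field_simps)
  ultimately have x0B0: "x0 \<in> B0" using x0 by (simp add: B0_def)
  define B where "B = (\<otimes>) g ` B0"
  have BC: "B \<subseteq> carrier G" using B0C gC by (auto simp: B_def)
  have oneB: "\<one> \<in> B" using x0B0 x0C by (force simp: B_def g_def)
  have "card B = card B0" unfolding B_def using card_image[OF inj[OF gC B0C]] .
  then have cardB: "u \<le> 2 * card B" using cardB0 by (simp add: U_def)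
  have walks: "k1 * k2^2 / 2 \<le> card {(s, a, t). s \<in> carrier G \<and> a \<in> carrier G \<and> t \<in> carrier G \<and>
        adj x s \<and> adj s a \<and> adj a t \<and> adj t (b \<otimes> y)}" (is "_ \<le> real (card ?W)")
    if xyb: "x \<in> B" "y \<in> B" "b \<in> B" for x y b
  proof -
    obtain x1 y1 b1 where x1: "x1 \<in> B0" "x = g \<otimes> x1" and y1: "y1 \<in> B0" "y = g \<otimes> y1"
      and b1: "b1 \<in> B0" "b = g \<otimes> b1" using xyb by (auto simp: B_def)
    have C: "x \<in> carrier G" "y \<in> carrier G" "b \<in> carrier G" "x1 \<in> carrier G" "y1 \<in> carrier G" "b1 \<in> carrier G"
      using xyb BC x1 y1 b1 B0C by auto
    let ?E1 = "bad k2 g x" and ?E2 = "bad k2 (b \<otimes> g) (b \<otimes> y)"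
    have E1: "card ?E1 \<le> e0"
      using bad_inv[of g \<one> x1 k2] gC C x1 B0A by (auto simp: A_def)
    have "b \<otimes> y = (b \<otimes> g) \<otimes> y1" using C gC y1 by (simp add: m_assoc)
    then have E2: "card ?E2 \<le> e0"
      using bad_inv[of "b \<otimes> g" \<one> y1 k2] gC C y1 B0A by (auto simp: A_def)
    have "n g (b \<otimes> g) = n ((x0 \<otimes> x0) \<otimes> g) ((x0 \<otimes> x0) \<otimes> (b \<otimes> g))"
      using n_inv[of "x0 \<otimes> x0" g "b \<otimes> g"] x0C gC C by simp
    also have "(x0 \<otimes> x0) \<otimes> g = x0" using x0C by (simp add: g_def m_assoc)
    \<comment> \<open>multiplying by the square of \<open>x0\<close> moves \<open>g\<close> to \<open>x0\<close> and \<open>b \<otimes> g\<close> to \<open>b1\<close>\<close>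
    also have "(x0 \<otimes> x0) \<otimes> (b \<otimes> g) = (x0 \<otimes> g) \<otimes> (x0 \<otimes> g) \<otimes> b1"
      using x0C gC C b1 by (simp add: m_ac)
    also have "\<dots> = b1" using x0C C by (simp add: g_def)
    finally have k1le: "n g (b \<otimes> g) \<ge> k1" using b1 by (simp add: B0_def)
    define D where "D = (N g \<inter> N (b \<otimes> g)) - (?E1 \<union> ?E2)"
    have finD: "finite D" using finN by (auto simp: D_def)
    have "card (N g \<inter> N (b \<otimes> g)) \<le> card D + card (?E1 \<union> ?E2)"
      unfolding D_def by (metis add.commute card_Un_le diff_card_le_card_Diff finite_UnI badfin le_diff_conv)
    moreover have "card (?E1 \<union> ?E2) \<le> card ?E1 + card ?E2" by (rule card_Un_le)
    ultimately have "real (card D) \<ge> n g (b \<otimes> g) - card ?E1 - card ?E2" unfolding n_def by linarith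
    then have cardD: "card D \<ge> k1 / 2" using k1le E1 E2 by (simp add: e0_def)
    define S where "S = (SIGMA a:D. (N x \<inter> N a) \<times> (N a \<inter> N (b \<otimes> y)))"
    have "real (card S) = (\<Sum>a\<in>D. n x a * n a (b \<otimes> y))"
      unfolding S_def n_def using finD finN by (subst card_SigmaI) (auto simp: card_cartesian_product)
    also have "\<dots> \<ge> (\<Sum>a\<in>D. k2 * k2)"
    proof (intro sum_mono mult_mono)
      fix a assume a: "a \<in> D"
      show "k2 \<le> n x a" using a by (auto simp: D_def bad_def)
      show "k2 \<le> n a (b \<otimes> y)" using a by (auto simp: D_def bad_def n_def Int_commute)
    qed (use k_pos in \<open>auto simp: n_def\<close>)
    finally have "real (card S) \<ge> card D * k2^2" by (simp add: power2_eq_square)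
    moreover have "card D * k2^2 \<ge> (k1 / 2) * k2^2" using cardD by (intro mult_right_mono) auto
    ultimately have S_ge: "real (card S) \<ge> k1 * k2^2 / 2" by simp
    have "inj_on (\<lambda>(a, s, t). (s, a, t)) S" by (auto simp: inj_on_def)
    moreover have "(\<lambda>(a, s, t). (s, a, t)) ` S \<subseteq> ?W"
    proof
      fix w assume "w \<in> (\<lambda>(a, s, t). (s, a, t)) ` S"
      then obtain s a t where w: "w = (s, a, t)" "a \<in> D" "s \<in> N x" "s \<in> N a" "t \<in> N a" "t \<in> N (b \<otimes> y)"
        unfolding S_def by auto
      have "a \<in> carrier G" "s \<in> carrier G" "t \<in> carrier G" using w NCD by (auto simp: D_def)
      moreover have "adj x s" "adj a s" "adj a t" "adj (b \<otimes> y) t" using w by (auto simp: N_def)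
      moreover have "b \<otimes> y \<in> carrier G" using C by simp
      ultimately show "w \<in> ?W" using w(1) sym C(1) by blast
    qed
    moreover have "finite ?W"
      by (rule finite_subset[of _ "carrier G \<times> carrier G \<times> carrier G"]) (use fin in auto)
    ultimately have "card S \<le> card ?W" by (rule card_inj_on_le)
    then show ?thesis using S_ge by linarith
  qed
  have k12: "k1 * k2^2 / 2 = U^8 / (2^20 * H^5)"
    by (simp add: k1_def k2_def field_simps eval_nat_numeral)
  have "u ^ 8 \<le> 2 ^ 20 * order G ^ 5 * card {(s, a, t). s \<in> carrier G \<and> a \<in> carrier G \<and> t \<in> carrier G \<and>
        adj x s \<and> adj s a \<and> adj a t \<and> adj t (b \<otimes> y)}" (is "_ \<le> _ * _ * card ?W")
    if "x \<in> B" "y \<in> B" "b \<in> B" for x y b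
  proof -
    have "U^8 \<le> 2^20 * H^5 * card ?W"
      using walks[OF that] HU unfolding k12 by (simp add: pos_divide_le_eq mult.commute)
    then have "real (u^8) \<le> real (2 ^ 20 * order G ^ 5 * card ?W)" by (simp add: U_def H_def h_def)
    then show ?thesis unfolding of_nat_le_iff .
  qed
  then show ?thesis using BC oneB cardB by blast
qed

section \<open>Additive character sums over multiplicative subgroups\<close>

text \<open>
  The values of \<open>s\<close> are sorted into the ranges between \<open>M / 2 ^ Suc j\<close> and \<open>M / 2 ^ j\<close> for \<open>j < J\<close>; what lies below
  contributes at most half of \<open>W\<close>. One of the \<open>J\<close> thresholds therefore carries a proportion \<open>1 / J\<close> of the rest.
\<close>

lemma dyadic_pigeonhole:
  fixes s :: "'a \<Rightarrow> real" and M W :: real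
  assumes fin: "finite A" and s: "\<And>a. a \<in> A \<Longrightarrow> s a \<le> M"
    and W: "W > 0" "W \<le> sum s A" and J: "card A * M \<le> 2 ^ J * (W / 2)" and M: "M > 0"
  shows "\<exists>T::real. 0 < T \<and> T \<le> M \<and> W \<le> 4 * real J * (T * card {a \<in> A. s a \<ge> T})"
proof -
  define c where "c j = {a \<in> A. s a \<ge> M / 2 ^ Suc j}" for j
  have layer: "s a \<le> M / 2 ^ J + (\<Sum>j<J. if a \<in> c j then M / 2 ^ j else 0)" if a: "a \<in> A" for a
  proof (induction J)
    case 0 then show ?case using s[OF a] by simp
  next
    case (Suc J)
    show ?case
    proof (cases "a \<in> c J")
      case True
      have "M / 2 ^ Suc J \<ge> 0" using M by simp
      then show ?thesis using Suc True by simp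
    next
      case False
      then have "s a \<le> M / 2 ^ Suc J" using a by (simp add: c_def)
      moreover have "(\<Sum>j<Suc J. if a \<in> c j then M / 2 ^ j else 0) \<ge> 0" using M by (intro sum_nonneg) auto
      ultimately show ?thesis by linarith
    qed
  qed
  have "sum s A \<le> (\<Sum>a\<in>A. M / 2 ^ J + (\<Sum>j<J. if a \<in> c j then M / 2 ^ j else 0))"
    by (intro sum_mono layer)
  also have "\<dots> = card A * M / 2 ^ J + (\<Sum>a\<in>A. \<Sum>j<J. if a \<in> c j then M / 2 ^ j else 0)"
    by (simp add: sum.distrib)
  also have "(\<Sum>a\<in>A. \<Sum>j<J. if a \<in> c j then M / 2 ^ j else 0) = (\<Sum>j<J. \<Sum>a\<in>A. if a \<in> c j then M / 2 ^ j else 0)"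
    by (rule sum.swap)
  also have "\<dots> = (\<Sum>j<J. card (c j) * (M / 2 ^ j))"
  proof (intro sum.cong refl)
    fix j
    have "(\<Sum>a\<in>A. if a \<in> c j then M / 2 ^ j else 0) = (\<Sum>a\<in>{a\<in>A. a \<in> c j}. M / 2 ^ j)"
      by (simp only: sum.inter_filter[OF fin])
    also have "{a\<in>A. a \<in> c j} = c j" by (auto simp: c_def)
    finally show "(\<Sum>a\<in>A. if a \<in> c j then M / 2 ^ j else 0) = card (c j) * (M / 2 ^ j)" by simp
  qed
  also have "card A * M / 2 ^ J \<le> W / 2" using J by (simp add: field_simps)
  finally have *: "W / 2 \<le> (\<Sum>j<J. card (c j) * (M / 2 ^ j))" using W by linarith
  have "\<exists>j<J. W \<le> 2 * real J * (card (c j) * (M / 2 ^ j))"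
  proof (rule ccontr)
    assume "\<not> ?thesis"
    then have lt: "\<And>j. j < J \<Longrightarrow> 2 * real J * (card (c j) * (M / 2 ^ j)) < W" by force
    have "J \<noteq> 0" using * W by (intro notI) simp
    have "real J * (W / 2) \<le> real J * (\<Sum>j<J. card (c j) * (M / 2 ^ j))" using * by (rule mult_left_mono) simp
    then have "real J * W \<le> 2 * real J * (\<Sum>j<J. card (c j) * (M / 2 ^ j))" by (simp add: mult.assoc)
    also have "\<dots> = (\<Sum>j<J. 2 * real J * (card (c j) * (M / 2 ^ j)))" by (simp add: sum_distrib_left)
    also have "\<dots> < (\<Sum>j<J. W)" using \<open>J \<noteq> 0\<close> lt by (intro sum_strict_mono) auto
    finally show False by simp
  qed
  then obtain j where "W \<le> 2 * real J * (card (c j) * (M / 2 ^ j))" by blast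
  then have "W \<le> 4 * real J * (M / 2 ^ Suc j * card (c j))" by (simp add: field_simps)
  moreover have "M / 2 ^ Suc j \<le> M" 
    using mult_left_mono[OF one_le_power[of "2::real" "Suc j"], of M] M by (simp add: pos_divide_le_eq)
  ultimately show ?thesis using M unfolding c_def by (intro exI[of _ "M / 2 ^ Suc j"]) auto
qed

locale additive_character = field R for R (structure) +
  fixes \<psi> :: "'a \<Rightarrow> complex"
  assumes fin: "finite (carrier R)"
    and char_add: "x \<in> carrier R \<Longrightarrow> y \<in> carrier R \<Longrightarrow> \<psi> (x \<oplus> y) = \<psi> x * \<psi> y"
    and char_norm: "x \<in> carrier R \<Longrightarrow> cmod (\<psi> x) = 1"
    and char_nontrivial: "\<exists>x\<in>carrier R. \<psi> x \<noteq> 1"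
begin

lemma char_zero: "\<psi> \<zero> = 1"
proof -
  have "\<psi> \<zero> = \<psi> \<zero> * \<psi> \<zero>" using char_add[of \<zero> \<zero>] by simp
  moreover have "\<psi> \<zero> \<noteq> 0" using char_norm[of \<zero>] by auto
  ultimately show ?thesis by simp
qed

lemma char_neg: assumes "x \<in> carrier R" shows "\<psi> (\<ominus> x) = cnj (\<psi> x)"
proof -
  have "\<psi> x * \<psi> (\<ominus> x) = 1" using char_add[of x "\<ominus> x"] assms by (simp add: r_neg char_zero)
  moreover have "\<psi> x * cnj (\<psi> x) = 1" using char_norm[OF assms] by (simp add: complex_norm_square[symmetric])
  moreover have "\<psi> x \<noteq> 0" using char_norm[OF assms] by auto
  ultimately show ?thesis by (metis mult_left_cancel)
qed

lemma char_diff: "x \<in> carrier R \<Longrightarrow> y \<in> carrier R \<Longrightarrow> \<psi> (x \<ominus> y) = \<psi> x * cnj (\<psi> y)"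
  by (simp add: a_minus_def char_add char_neg)

lemma char_orthogonality:
  assumes z: "z \<in> carrier R"
  shows "(\<Sum>t\<in>carrier R. \<psi> (t \<otimes> z)) = (if z = \<zero> then of_nat (card (carrier R)) else 0)"
proof (cases "z = \<zero>")
  case True then show ?thesis by (simp add: char_zero)
next
  case False
  obtain x where x: "x \<in> carrier R" "\<psi> x \<noteq> 1" using char_nontrivial by blast
  define y where "y = inv z \<otimes> x"
  have iz: "inv z \<in> carrier R" using z False by (simp add: field_Units)
  have y: "y \<in> carrier R" "y \<otimes> z = x"
    using z False x iz by (auto simp: y_def m_ac field_Units)
  have inj: "inj_on (\<lambda>t. t \<oplus> y) (carrier R)" using y by (auto simp: inj_on_def)
  have img: "(\<lambda>t. t \<oplus> y) ` carrier R = carrier R"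
    by (rule endo_inj_surj[OF fin _ inj]) (use y in auto)
  have "(\<Sum>t\<in>carrier R. \<psi> (t \<otimes> z)) = (\<Sum>t\<in>(\<lambda>t. t \<oplus> y) ` carrier R. \<psi> (t \<otimes> z))" using img by simp
  also have "\<dots> = (\<Sum>t\<in>carrier R. \<psi> ((t \<oplus> y) \<otimes> z))" using sum.reindex[OF inj] by simp
  also have "\<dots> = (\<Sum>t\<in>carrier R. \<psi> x * \<psi> (t \<otimes> z))"
    using y z x by (intro sum.cong) (auto simp: l_distr char_add mult.commute)
  also have "\<dots> = \<psi> x * (\<Sum>t\<in>carrier R. \<psi> (t \<otimes> z))" by (simp add: sum_distrib_left)
  finally have "(1 - \<psi> x) * (\<Sum>t\<in>carrier R. \<psi> (t \<otimes> z)) = 0" by (simp add: algebra_simps)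
  then show ?thesis using x False by simp
qed

definition char_sum :: "'a set \<Rightarrow> 'a \<Rightarrow> complex" where
  "char_sum H t = (\<Sum>x\<in>H. \<psi> (t \<otimes> x))"

lemma parseval:
  assumes H: "H \<subseteq> carrier R"
  shows "(\<Sum>t\<in>carrier R. (cmod (char_sum H t))\<^sup>2) = card (carrier R) * card H"
proof -
  have finH: "finite H" using H fin finite_subset by auto
  have "complex_of_real (\<Sum>t\<in>carrier R. (cmod (char_sum H t))\<^sup>2) = (\<Sum>t\<in>carrier R. char_sum H t * cnj (char_sum H t))"
    by (simp only: of_real_sum complex_norm_square)
  also have "\<dots> = (\<Sum>t\<in>carrier R. \<Sum>x\<in>H. \<Sum>y\<in>H. \<psi> (t \<otimes> x) * cnj (\<psi> (t \<otimes> y)))"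
    by (simp add: char_sum_def sum_product)
  also have "\<dots> = (\<Sum>t\<in>carrier R. \<Sum>x\<in>H. \<Sum>y\<in>H. \<psi> (t \<otimes> (x \<ominus> y)))"
  proof (intro sum.cong refl)
    fix t x y assume "t \<in> carrier R" "x \<in> H" "y \<in> H"
    then have c: "t \<in> carrier R" "x \<in> carrier R" "y \<in> carrier R" using H by auto
    then have "t \<otimes> (x \<ominus> y) = t \<otimes> x \<ominus> t \<otimes> y" by algebra
    then show "\<psi> (t \<otimes> x) * cnj (\<psi> (t \<otimes> y)) = \<psi> (t \<otimes> (x \<ominus> y))" using c by (simp add: char_diff)
  qed
  also have "\<dots> = (\<Sum>x\<in>H. \<Sum>t\<in>carrier R. \<Sum>y\<in>H. \<psi> (t \<otimes> (x \<ominus> y)))" by (rule sum.swap)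
  also have "\<dots> = (\<Sum>x\<in>H. \<Sum>y\<in>H. \<Sum>t\<in>carrier R. \<psi> (t \<otimes> (x \<ominus> y)))" by (intro sum.cong refl sum.swap)
  also have "\<dots> = (\<Sum>x\<in>H. \<Sum>y\<in>H. if x = y then of_nat (card (carrier R)) else 0)"
  proof (intro sum.cong refl)
    fix x y assume "x \<in> H" "y \<in> H"
    then have "x \<in> carrier R" "y \<in> carrier R" using H by auto
    then show "(\<Sum>t\<in>carrier R. \<psi> (t \<otimes> (x \<ominus> y))) = (if x = y then of_nat (card (carrier R)) else 0)"
      by (subst char_orthogonality) auto
  qed
  also have "\<dots> = of_nat (card (carrier R) * card H)" using finH by (simp add: sum.delta)
  finally show ?thesis by (metis of_real_eq_iff of_real_of_nat_eq of_nat_mult)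
qed

end

locale subgroup_character = additive_character +
  fixes H :: "'a set"
  assumes H: "subgroup H (mult_of R)"
begin

abbreviation S where "S \<equiv> char_sum H"

lemma H_sub: "H \<subseteq> carrier R" and H_nonzero: "\<zero> \<notin> H" and one_H: "\<one> \<in> H"
  and H_mult: "x \<in> H \<Longrightarrow> y \<in> H \<Longrightarrow> x \<otimes> y \<in> H"
  using subgroup.subset[OF H] subgroup.one_closed[OF H] subgroup.m_closed[OF H] by auto

lemma H_carrier: "x \<in> H \<Longrightarrow> x \<in> carrier R" using H_sub by auto

lemma finite_H: "finite H" using H_sub fin finite_subset by auto

lemma card_H_pos: "card H > 0" using finite_H one_H card_gt_0_iff by blast

lemma char_sum_invariant:
  assumes "t \<in> carrier R" "u \<in> H" shows "S (t \<otimes> u) = S t"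
proof -
  have inj: "inj_on (\<lambda>x. u \<otimes> x) H" using inj_on_scale[of u H] assms H_sub H_nonzero by auto
  have img: "(\<lambda>x. u \<otimes> x) ` H = H"
    by (rule endo_inj_surj[OF finite_H _ inj]) (use assms H_mult in auto)
  have "S t = (\<Sum>x\<in>(\<lambda>x. u \<otimes> x) ` H. \<psi> (t \<otimes> x))" unfolding img char_sum_def ..
  also have "\<dots> = (\<Sum>x\<in>H. \<psi> (t \<otimes> (u \<otimes> x)))" using sum.reindex[OF inj] by simp
  also have "\<dots> = S (t \<otimes> u)" unfolding char_sum_def
    using assms by (intro sum.cong) (auto simp: m_assoc H_carrier)
  finally show ?thesis ..
qed

lemma char_sum_neg: assumes "t \<in> carrier R" shows "S (\<ominus> t) = cnj (S t)"
  unfolding char_sum_def cnj_sum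
  using assms by (intro sum.cong) (auto simp: l_minus char_neg H_carrier)

lemma char_sum_le_card: assumes "t \<in> carrier R" shows "cmod (S t) \<le> card H"
proof -
  have "cmod (S t) \<le> (\<Sum>x\<in>H. cmod (\<psi> (t \<otimes> x)))" unfolding char_sum_def by (rule norm_sum)
  also have "\<dots> = (\<Sum>x\<in>H. 1)" using assms by (intro sum.cong) (auto simp: char_norm H_carrier)
  finally show ?thesis by simp
qed

text \<open>
  Many differences of elements of \<open>H\<close> have a large character sum: expanding \<open>S (\<one> \<ominus> u)\<close> and summing over
  \<open>u\<close> first gives \<open>cnj (S x)\<close>, which is the same for all \<open>x \<in> H\<close>.
\<close>

lemma sum_char_sum_differences: "(\<Sum>u\<in>H. S (\<one> \<ominus> u)) = (cmod (S \<one>))\<^sup>2"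
proof -
  have "(\<Sum>u\<in>H. S (\<one> \<ominus> u)) = (\<Sum>u\<in>H. \<Sum>x\<in>H. \<psi> x * cnj (\<psi> (x \<otimes> u)))"
    unfolding char_sum_def
  proof (intro sum.cong refl)
    fix u x assume "u \<in> H" "x \<in> H"
    then have c: "u \<in> carrier R" "x \<in> carrier R" by (auto simp: H_carrier)
    then have "(\<one> \<ominus> u) \<otimes> x = x \<ominus> x \<otimes> u" by algebra
    then show "\<psi> ((\<one> \<ominus> u) \<otimes> x) = \<psi> x * cnj (\<psi> (x \<otimes> u))" using c by (simp add: char_diff)
  qed
  also have "\<dots> = (\<Sum>x\<in>H. \<Sum>u\<in>H. \<psi> x * cnj (\<psi> (x \<otimes> u)))" by (rule sum.swap)
  also have "\<dots> = (\<Sum>x\<in>H. \<psi> x * cnj (S (\<one> \<otimes> x)))"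
    unfolding char_sum_def cnj_sum sum_distrib_left using H_sub by (intro sum.cong) (auto simp: H_carrier)
  also have "\<dots> = (\<Sum>x\<in>H. \<psi> (\<one> \<otimes> x)) * cnj (S \<one>)"
    unfolding sum_distrib_right
  proof (intro sum.cong refl)
    fix x assume x: "x \<in> H"
    show "\<psi> x * cnj (S (\<one> \<otimes> x)) = \<psi> (\<one> \<otimes> x) * cnj (S \<one>)"
      using char_sum_invariant[OF one_closed x] x by (simp add: H_carrier)
  qed
  also have "\<dots> = S \<one> * cnj (S \<one>)" by (simp only: char_sum_def)
  also have "\<dots> = (cmod (S \<one>))\<^sup>2" by (simp only: complex_norm_square of_real_power[symmetric])
  finally show ?thesis .
qed

lemma card_large_spectrum:
  assumes "T \<ge> 0"
  shows "T\<^sup>2 * card {t \<in> carrier R. cmod (S t) \<ge> T} \<le> card (carrier R) * card H"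
proof -
  let ?L = "{t \<in> carrier R. cmod (S t) \<ge> T}"
  have "T\<^sup>2 * card ?L = (\<Sum>t\<in>?L. T\<^sup>2)" by simp
  also have "\<dots> \<le> (\<Sum>t\<in>?L. (cmod (S t))\<^sup>2)" using assms by (intro sum_mono power_mono) auto
  also have "\<dots> \<le> (\<Sum>t\<in>carrier R. (cmod (S t))\<^sup>2)" using fin by (intro sum_mono2) auto
  also have "\<dots> = card (carrier R) * card H" by (rule parseval[OF H_sub])
  finally show ?thesis .
qed

text \<open>
  The value \<open>S \<one>\<close> is repeated on all of \<open>H\<close> in Parseval's identity.
\<close>

lemma char_sum_one_squared_le: "(cmod (S \<one>))\<^sup>2 \<le> card (carrier R)"
proof -
  have "card H * (cmod (S \<one>))\<^sup>2 = (\<Sum>t\<in>H. (cmod (S (\<one> \<otimes> t)))\<^sup>2)"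
    by (simp add: char_sum_invariant)
  also have "\<dots> = (\<Sum>t\<in>H. (cmod (S t))\<^sup>2)" by (intro sum.cong) (auto simp: H_carrier)
  also have "\<dots> \<le> (\<Sum>t\<in>carrier R. (cmod (S t))\<^sup>2)" using fin H_sub by (intro sum_mono2) auto
  also have "\<dots> = card H * card (carrier R)" using parseval[OF H_sub] by simp
  finally show ?thesis using card_H_pos by simp
qed

text \<open>
  Join two different elements of \<open>H\<close> if their difference lies in the large spectrum. As the spectrum is invariant
  under \<open>H\<close>, this is a Cayley graph of \<open>H\<close>. A walk of length four from \<open>x\<close> to \<open>b \<otimes> y\<close> writes \<open>x \<ominus> b \<otimes> y\<close> as a sum of
  four elements of the spectrum, and different walks give different quadruples. Since there are many walks for
  each value, there are few values.
\<close>

lemma spectrum_popular_dilates: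
  assumes T: "u = card {v \<in> H - {\<one>}. cmod (S (\<one> \<ominus> v)) \<ge> T}" "u > 0"
  shows "\<exists>B \<subseteq> H. \<one> \<in> B \<and> u \<le> 2 * card B \<and> (\<forall>b\<in>B.
     card (B \<boxplus> scale (\<ominus> b) B) * u ^ 8 \<le> 2 ^ 20 * card H ^ 5 * card {t \<in> carrier R. cmod (S t) \<ge> T} ^ 4)"
proof -
  define L where "L = {t \<in> carrier R. cmod (S t) \<ge> T}"
  define adj where "adj x y \<longleftrightarrow> x \<noteq> y \<and> cmod (S (x \<ominus> y)) \<ge> T" for x y
  let ?G = "(mult_of R)\<lparr>carrier := H\<rparr>"
  have grp: "group (mult_of R)" by (rule field_mult_group)
  have "group ?G" by (rule subgroup.subgroup_is_group[OF H grp])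
  then have "comm_group ?G"
    by (rule group.group_comm_groupI) (auto simp: m_comm H_carrier)
  then interpret G: comm_group ?G .
  have "\<exists>B \<subseteq> carrier ?G. \<one>\<^bsub>?G\<^esub> \<in> B \<and> u \<le> 2 * card B \<and> (\<forall>x\<in>B. \<forall>y\<in>B. \<forall>b\<in>B.
     u ^ 8 \<le> 2 ^ 20 * order ?G ^ 5 * card {(s, a, t). s \<in> carrier ?G \<and> a \<in> carrier ?G \<and> t \<in> carrier ?G \<and>
        adj x s \<and> adj s a \<and> adj a t \<and> adj t (b \<otimes>\<^bsub>?G\<^esub> y)})"
  proof (rule G.popular_walks_to_dilates)
    show "finite (carrier ?G)" by (simp add: finite_H)
    show "adj y x" if "x \<in> carrier ?G" "y \<in> carrier ?G" "adj x y" for x y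
    proof -
      have c: "x \<in> carrier R" "y \<in> carrier R" using that by (auto simp: H_carrier)
      then have "y \<ominus> x = \<ominus> (x \<ominus> y)" by algebra
      then show ?thesis using that c by (auto simp: adj_def char_sum_neg)
    qed
    show "adj (g \<otimes>\<^bsub>?G\<^esub> x) (g \<otimes>\<^bsub>?G\<^esub> y) \<longleftrightarrow> adj x y"
      if "g \<in> carrier ?G" "x \<in> carrier ?G" "y \<in> carrier ?G" for g x y
    proof -
      have c: "x \<in> carrier R" "y \<in> carrier R" "g \<in> H" "g \<in> carrier R" "g \<noteq> \<zero>" using that H_nonzero by (auto simp: H_carrier)
      then have "g \<otimes> x \<ominus> g \<otimes> y = (x \<ominus> y) \<otimes> g" by algebra
      then have "S (g \<otimes> x \<ominus> g \<otimes> y) = S (x \<ominus> y)" using c by (simp add: char_sum_invariant)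
      then show ?thesis using c by (auto simp: adj_def m_lcancel)
    qed
    have "{v \<in> carrier ?G. adj \<one>\<^bsub>?G\<^esub> v} = {v \<in> H - {\<one>}. cmod (S (\<one> \<ominus> v)) \<ge> T}"
      by (auto simp: adj_def)
    then show "u = card {v \<in> carrier ?G. adj \<one>\<^bsub>?G\<^esub> v}" using T by simp
    show "u > 0" by (rule T)
  qed
  then obtain B where B: "B \<subseteq> H" "\<one> \<in> B" "u \<le> 2 * card B" and walk: "\<And>x y b. x \<in> B \<Longrightarrow> y \<in> B \<Longrightarrow> b \<in> B \<Longrightarrow>
     u ^ 8 \<le> 2 ^ 20 * card H ^ 5 * card {(s, a, t). s \<in> H \<and> a \<in> H \<and> t \<in> H \<and>
        adj x s \<and> adj s a \<and> adj a t \<and> adj t (b \<otimes> y)}"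
    by (auto simp: order_def)
  have adjL: "x \<ominus> y \<in> L" if "adj x y" "x \<in> carrier R" "y \<in> carrier R" for x y
    using that by (auto simp: adj_def L_def)
  have finB: "finite B" using B finite_H finite_subset by auto
  have finL: "finite L" using fin by (auto simp: L_def)
  have "card (B \<boxplus> scale (\<ominus> b) B) * u ^ 8 \<le> 2 ^ 20 * card H ^ 5 * card L ^ 4" if b: "b \<in> B" for b
  proof -
    let ?D = "B \<boxplus> scale (\<ominus> b) B"
    have bc: "b \<in> carrier R" using b B H_carrier by auto
    have Bc: "x \<in> carrier R" if "x \<in> B" for x using that B H_carrier by auto
    have finD: "finite ?D" using finB by (intro finite_sumset finite_scale)
    have "\<forall>d\<in>?D. \<exists>p. fst p \<in> B \<and> snd p \<in> B \<and> d = fst p \<ominus> b \<otimes> snd p"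
    proof
      fix d assume "d \<in> ?D"
      then obtain x y where xy: "x \<in> B" "y \<in> B" "d = x \<oplus> (\<ominus> b) \<otimes> y" by (auto simp: sumset_def scale_def)
      then have "d = x \<ominus> b \<otimes> y" using bc Bc by (simp add: a_minus_def l_minus)
      then show "\<exists>p. fst p \<in> B \<and> snd p \<in> B \<and> d = fst p \<ominus> b \<otimes> snd p" using xy by (intro exI[of _ "(x, y)"]) simp
    qed
    then obtain f where f: "\<And>d. d \<in> ?D \<Longrightarrow> fst (f d) \<in> B \<and> snd (f d) \<in> B \<and> d = fst (f d) \<ominus> b \<otimes> snd (f d)"
      by metis
    define W where "W d = {(s, a, t). s \<in> H \<and> a \<in> H \<and> t \<in> H \<and>
        adj (fst (f d)) s \<and> adj s a \<and> adj a t \<and> adj t (b \<otimes> snd (f d))}" for d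
    have finW: "finite (W d)" for d
      by (rule finite_subset[of _ "H \<times> H \<times> H"]) (auto simp: W_def finite_H)
    define g where "g = (\<lambda>(d, s, a, t). (fst (f d) \<ominus> s, s \<ominus> a, a \<ominus> t, t \<ominus> b \<otimes> snd (f d)))"
    have inj: "inj_on g (Sigma ?D W)"
    proof (rule inj_onI)
      fix z z' assume zz: "z \<in> Sigma ?D W" "z' \<in> Sigma ?D W" and eq': "g z = g z'"
      obtain d s a t where z: "z = (d, s, a, t)" by (metis prod.collapse)
      obtain d' s' a' t' where z': "z' = (d', s', a', t')" by (metis prod.collapse)
      have d: "d \<in> ?D" "d' \<in> ?D" and w: "(s, a, t) \<in> W d" "(s', a', t') \<in> W d'"
        and eq: "g (d, s, a, t) = g (d', s', a', t')" using zz eq' z z' by auto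
      have c: "fst (f d) \<in> carrier R" "snd (f d) \<in> carrier R" "fst (f d') \<in> carrier R" "snd (f d') \<in> carrier R"
        "s \<in> carrier R" "a \<in> carrier R" "t \<in> carrier R" "s' \<in> carrier R" "a' \<in> carrier R" "t' \<in> carrier R"
        using f[OF d(1)] f[OF d(2)] w Bc by (auto simp: W_def H_carrier)
      have sum: "x \<ominus> z = (x \<ominus> s) \<oplus> (s \<ominus> a) \<oplus> (a \<ominus> t) \<oplus> (t \<ominus> z)"
        if "x \<in> carrier R" "z \<in> carrier R" "s \<in> carrier R" "a \<in> carrier R" "t \<in> carrier R" for x z s a t
        using that by algebra
      have e: "fst (f d) \<ominus> s = fst (f d') \<ominus> s'" "s \<ominus> a = s' \<ominus> a'" "a \<ominus> t = a' \<ominus> t'"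
        "t \<ominus> b \<otimes> snd (f d) = t' \<ominus> b \<otimes> snd (f d')" using eq by (auto simp: g_def)
      have "d = (fst (f d) \<ominus> s) \<oplus> (s \<ominus> a) \<oplus> (a \<ominus> t) \<oplus> (t \<ominus> b \<otimes> snd (f d))"
        using sum[of "fst (f d)" "b \<otimes> snd (f d)" s a t] c bc f[OF d(1)] by simp
      also have "\<dots> = d'" unfolding e
        using sum[of "fst (f d')" "b \<otimes> snd (f d')" s' a' t'] c bc f[OF d(2)] by simp
      finally have dd: "d = d'" .
      have cancel: "y = y'" if "x \<ominus> y = x \<ominus> y'" "x \<in> carrier R" "y \<in> carrier R" "y' \<in> carrier R" for x y y'
      proof -
        have "y = x \<ominus> (x \<ominus> y)" using that(2-4) by algebra
        also have "\<dots> = y'" unfolding that(1) using that(2-4) by algebra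
        finally show ?thesis .
      qed
      have "s = s'" using cancel e(1) c dd by auto
      moreover have "a = a'" using cancel e(2) c \<open>s = s'\<close> by auto
      moreover have "t = t'" using cancel e(3) c \<open>a = a'\<close> by auto
      ultimately show "z = z'" using dd z z' by simp
    qed
    have im: "g ` Sigma ?D W \<subseteq> L \<times> L \<times> L \<times> L"
    proof (rule image_subsetI, clarify)
      fix d s a t assume d: "d \<in> ?D" and w: "(s, a, t) \<in> W d"
      have c: "fst (f d) \<in> carrier R" "b \<otimes> snd (f d) \<in> carrier R" "s \<in> carrier R" "a \<in> carrier R" "t \<in> carrier R"
        using f[OF d] w Bc bc by (auto simp: W_def H_carrier)
      show "g (d, s, a, t) \<in> L \<times> L \<times> L \<times> L" using w c adjL by (auto simp: g_def W_def)
    qed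
    have "card ?D * u ^ 8 = (\<Sum>d\<in>?D. u ^ 8)" by simp
    also have "\<dots> \<le> (\<Sum>d\<in>?D. 2 ^ 20 * card H ^ 5 * card (W d))"
      unfolding W_def by (intro sum_mono walk) (use f b in auto)
    also have "\<dots> = 2 ^ 20 * card H ^ 5 * card (Sigma ?D W)"
      using finD finW by (simp add: sum_distrib_left)
    also have "card (Sigma ?D W) \<le> card (L \<times> L \<times> L \<times> L)"
      by (rule card_inj_on_le[OF inj im]) (simp add: finL)
    also have "card (L \<times> L \<times> L \<times> L) = card L ^ 4" by (simp add: card_cartesian_product eval_nat_numeral)
    finally show ?thesis by simp
  qed
  then show ?thesis using B unfolding L_def by blast
qed

end

text \<open>
  The left-hand side is the dilation constant delivered by the walks, for a spectrum of size \<open>L\<close> and a graph of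
  degree \<open>u\<close>. The unknown level \<open>T\<close> and degree \<open>u\<close> are eliminated: the ninth power of the pigeonhole inequality has
  eight factors \<open>T\<close> for \<open>L ^ 4\<close>, and one more that is bounded by \<open>M\<close>.
\<close>

lemma dilate_const_le:
  fixes q h u M T J L :: real
  assumes pos: "u > 0" "M > 0" "T > 0" "J \<ge> 0" "L \<ge> 0" "h \<ge> 0"
    and L: "T\<^sup>2 * L \<le> q * h" and TM: "T \<le> M" and w: "M\<^sup>2 \<le> 8 * J * (T * u)"
  shows "2 ^ 21 * L ^ 4 * h ^ 5 / u ^ 9 \<le> 2 ^ 48 * J ^ 9 * q ^ 4 * h ^ 9 / M ^ 17"
    and "M \<le> 8 * J * u"
proof -
  have "M * M \<le> 8 * J * (T * u)" using w by (simp add: power2_eq_square)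
  also have "\<dots> \<le> M * (8 * J * u)"
    using mult_right_mono[OF TM, of "8 * J * u"] pos by (simp add: mult_ac)
  finally show "M \<le> 8 * J * u" using pos by simp
  have "M * M ^ 17 = (M\<^sup>2) ^ 9" by (simp add: power_mult[symmetric] power_Suc[symmetric] del: power_Suc)
  also have "\<dots> \<le> (8 * J * (T * u)) ^ 9" using w by (rule power_mono) simp
  also have "\<dots> = T * (2 ^ 27 * J ^ 9 * T ^ 8 * u ^ 9)" by (simp add: power_mult_distrib eval_nat_numeral)
  also have "\<dots> \<le> M * (2 ^ 27 * J ^ 9 * T ^ 8 * u ^ 9)"
    using TM pos by (intro mult_right_mono mult_nonneg_nonneg zero_le_power) auto
  finally have M17: "M ^ 17 \<le> 2 ^ 27 * J ^ 9 * T ^ 8 * u ^ 9" using pos by simp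
  have "T ^ 8 * L ^ 4 = (T\<^sup>2 * L) ^ 4" by (simp add: power_mult_distrib power_mult[symmetric])
  also have "\<dots> \<le> (q * h) ^ 4" using L pos by (intro power_mono) auto
  finally have LT: "T ^ 8 * L ^ 4 \<le> q ^ 4 * h ^ 4" by (simp add: power_mult_distrib)
  have "L ^ 4 * M ^ 17 \<le> L ^ 4 * (2 ^ 27 * J ^ 9 * T ^ 8 * u ^ 9)"
    using M17 pos by (intro mult_left_mono) auto
  also have "\<dots> = 2 ^ 27 * J ^ 9 * u ^ 9 * (T ^ 8 * L ^ 4)" by (simp add: mult_ac)
  also have "\<dots> \<le> 2 ^ 27 * J ^ 9 * u ^ 9 * (q ^ 4 * h ^ 4)" using LT pos by (intro mult_left_mono) auto
  finally have "2 ^ 21 * h ^ 5 * (L ^ 4 * M ^ 17) \<le> 2 ^ 21 * h ^ 5 * (2 ^ 27 * J ^ 9 * u ^ 9 * (q ^ 4 * h ^ 4))"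
    using pos by (intro mult_left_mono) auto
  also have "\<dots> = 2 ^ 48 * J ^ 9 * q ^ 4 * h ^ 9 * u ^ 9"
    by (simp add: mult_ac power_add[symmetric] eval_nat_numeral)
  finally show "2 ^ 21 * L ^ 4 * h ^ 5 / u ^ 9 \<le> 2 ^ 48 * J ^ 9 * q ^ 4 * h ^ 9 / M ^ 17"
    using pos by (simp add: divide_simps mult_ac)
qed

text \<open>
  If \<open>M = |S \<one>|\<close> is the largest nontrivial sum, then \<open>H\<close> contains a set \<open>B\<close> of at least \<open>M / (16 J)\<close> elements whose
  difference sets with its own dilates \<open>b B\<close>, \<open>b \<in> B\<close>, have at most \<open>K' |B|\<close> elements, and the sum-product dichotomy
  applies to \<open>B\<close>. A proper subfield
  containing \<open>B\<close> has at least \<open>(|B| / A)\<^sup>2\<close> elements by hypothesis. If the subfield is everything, the quotient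
  \<open>|B|\<^sup>2 / q\<close> has to be absorbed: it is at most the square of \<open>K'\<close> because \<open>M\<^sup>2 \<le> q\<close> and \<open>M \<le> h\<close>. In all cases
  \<open>|B|\<close> is at most a constant times \<open>K' ^ 6\<close>.
\<close>

lemma (in subgroup_character) subgroup_sum_bound:
  fixes A :: real and J :: nat
  assumes max: "\<And>t. t \<in> carrier R \<Longrightarrow> t \<noteq> \<zero> \<Longrightarrow> cmod (S t) \<le> cmod (S \<one>)"
    and large: "2 * card H \<le> (cmod (S \<one>))\<^sup>2" and J: "4 * card H \<le> 2 ^ J"
    and sub: "\<And>F. subgroup F (add_monoid R) \<Longrightarrow> subgroup (F - {\<zero>}) (mult_of R) \<Longrightarrow> F \<noteq> carrier R \<Longrightarrow>
                card (H \<inter> F) \<le> A * sqrt (card F)"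
  shows "cmod (S \<one>) ^ 103 \<le> 16 * 6 ^ 6 * 2 ^ 288 * (2 + A\<^sup>2) * real J ^ 55 * real (card (carrier R)) ^ 24 * real (card H) ^ 54"
proof -
  define M where "M = cmod (S \<one>)"
  define q where "q = real (card (carrier R))"
  define h where "h = real (card H)"
  have hpos: "h \<ge> 1" using card_H_pos by (simp add: h_def)
  have M2h: "2 * h \<le> M\<^sup>2" using large by (simp add: M_def h_def)
  have M1: "M \<ge> 1"
  proof (rule ccontr)
    assume "\<not> M \<ge> 1"
    then have "M\<^sup>2 \<le> 1" by (intro power_le_one) (auto simp: M_def)
    then show False using M2h hpos by linarith
  qed
  have Mq: "M\<^sup>2 \<le> q" using char_sum_one_squared_le by (simp add: M_def q_def)
  have Mh: "M \<le> h" using char_sum_le_card[of \<one>] by (simp add: M_def h_def)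
  have qpos: "q > 0" using Mq M1 by (smt (verit) one_le_power)
  have J2: "4 * h \<le> 2 ^ J" using J by (simp add: h_def) (metis J of_nat_le_iff of_nat_mult of_nat_numeral of_nat_power)
  have J1: "real J \<ge> 1"
  proof -
    have "J \<noteq> 0" using J2 hpos by (intro notI) simp
    then show ?thesis by simp
  qed
  define s where "s v = cmod (S (\<one> \<ominus> v))" for v
  have "M\<^sup>2 = cmod (\<Sum>u\<in>H. S (\<one> \<ominus> u))"
    unfolding sum_char_sum_differences M_def by (simp add: norm_power)
  also have "\<dots> \<le> (\<Sum>u\<in>H. s u)" unfolding s_def by (rule norm_sum)
  also have "\<dots> = s \<one> + (\<Sum>u\<in>H - {\<one>}. s u)" using finite_H one_H by (rule sum.remove)
  also have "s \<one> \<le> h" unfolding s_def h_def by (rule char_sum_le_card) auto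
  finally have W: "M\<^sup>2 / 2 \<le> sum s (H - {\<one>})" using M2h by linarith
  have "\<exists>T::real. 0 < T \<and> T \<le> M \<and> M\<^sup>2 / 2 \<le> 4 * real J * (T * card {v \<in> H - {\<one>}. s v \<ge> T})"
  proof (rule dyadic_pigeonhole)
    show "finite (H - {\<one>})" using finite_H by simp
    show "s v \<le> M" if "v \<in> H - {\<one>}" for v
      unfolding s_def M_def using that by (intro max) (auto simp: H_carrier)
    show "0 < M\<^sup>2 / 2" "0 < M" using M1 by auto
    show "M\<^sup>2 / 2 \<le> sum s (H - {\<one>})" by (rule W)
    have "card (H - {\<one>}) \<le> card H" using finite_H by (intro card_mono) auto
    then have "card (H - {\<one>}) * M \<le> h * M" using M1 by (intro mult_right_mono) (auto simp: h_def)
    also have "\<dots> \<le> h * M\<^sup>2" using M1 hpos by (intro mult_left_mono) (auto simp: power2_eq_square)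
    also have "\<dots> \<le> 2 ^ J / 4 * M\<^sup>2" using J2 by (intro mult_right_mono) auto
    finally show "card (H - {\<one>}) * M \<le> 2 ^ J * (M\<^sup>2 / 2 / 2)" by simp
  qed
  then obtain T where T: "0 < T" "T \<le> M" and TW: "M\<^sup>2 / 2 \<le> 4 * real J * (T * card {v \<in> H - {\<one>}. s v \<ge> T})"
    by blast
  define u where "u = card {v \<in> H - {\<one>}. cmod (S (\<one> \<ominus> v)) \<ge> T}"
  have w: "M\<^sup>2 \<le> 8 * real J * (T * real u)" using TW by (simp add: u_def s_def)
  have upos: "u > 0" using w M1 by (intro gr0I) auto
  define L where "L = card {t \<in> carrier R. cmod (S t) \<ge> T}"
  have LT: "T\<^sup>2 * real L \<le> q * h" using card_large_spectrum[of T] T by (simp add: L_def q_def h_def)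
  obtain B where B: "B \<subseteq> H" "\<one> \<in> B" "u \<le> 2 * card B"
    and dil: "\<And>b. b \<in> B \<Longrightarrow> card (B \<boxplus> scale (\<ominus> b) B) * u ^ 8 \<le> 2 ^ 20 * card H ^ 5 * L ^ 4"
    using spectrum_popular_dilates[OF u_def upos] unfolding L_def by blast
  have finB: "finite B" using B finite_H finite_subset by auto
  have Bc: "B \<subseteq> carrier R" "\<zero> \<notin> B" using B H_sub H_nonzero by auto
  define K where "K = 2 ^ 21 * real L ^ 4 * h ^ 5 / real u ^ 9"
  have K: "real (card (B \<boxplus> scale (\<ominus> b) B)) \<le> K * card B" if b: "b \<in> B" for b
  proof -
    have "real (card (B \<boxplus> scale (\<ominus> b) B) * u ^ 8) \<le> real (2 ^ 20 * card H ^ 5 * L ^ 4)"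
      using dil[OF b] unfolding of_nat_le_iff .
    then have "real (card (B \<boxplus> scale (\<ominus> b) B)) * u ^ 8 \<le> 2 ^ 20 * h ^ 5 * real L ^ 4" by (simp add: h_def)
    then have "real (card (B \<boxplus> scale (\<ominus> b) B)) * u ^ 9 \<le> 2 ^ 20 * h ^ 5 * real L ^ 4 * u"
      using mult_right_mono[of _ _ "real u"] by (fastforce simp: eval_nat_numeral mult_ac)
    also have "\<dots> \<le> 2 ^ 20 * h ^ 5 * real L ^ 4 * (2 * real (card B))"
      using B(3) hpos by (intro mult_left_mono) auto
    finally show ?thesis using upos by (simp add: K_def field_simps)
  qed
  define K' where "K' = 2 ^ 48 * real J ^ 9 * q ^ 4 * h ^ 9 / M ^ 17"
  have KK': "K \<le> K'" and Mu: "M \<le> 8 * real J * u"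
    unfolding K_def K'_def using dilate_const_le[of "real u" M T "real J" "real L" h q] upos M1 T J1 hpos LT w by auto
  have K1: "K \<ge> 1" by (rule dilate_const_ge_1[OF finB B(2) Bc K])
  have K'1: "K' \<ge> 1" using K1 KK' by simp
  have K4: "K ^ 4 \<le> K' ^ 4" "K ^ 6 \<le> K' ^ 6" using KK' K1 by (auto intro: power_mono)
  have K'46: "K' ^ 4 \<le> K' ^ 6" using K'1 by (intro power_increasing) auto
  have hq: "h\<^sup>2 / q \<le> K'\<^sup>2"
  proof -
    have "M ^ 34 = (M\<^sup>2) ^ 9 * M ^ 16" by (simp add: power_mult[symmetric] power_add[symmetric])
    also have "\<dots> \<le> q ^ 9 * h ^ 16"
      using Mq Mh M1 qpos by (intro mult_mono power_mono) auto
    also have "\<dots> \<le> (2 ^ 96 * real J ^ 18) * (q ^ 9 * h ^ 16)"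
    proof -
      have "1 * 1 \<le> (2::real) ^ 96 * real J ^ 18" using J1 by (intro mult_mono one_le_power) auto
      then show ?thesis using mult_right_mono[of 1 "2 ^ 96 * real J ^ 18" "q ^ 9 * h ^ 16"] qpos hpos by simp
    qed
    finally have "h\<^sup>2 * M ^ 34 \<le> h\<^sup>2 * ((2 ^ 96 * real J ^ 18) * (q ^ 9 * h ^ 16))"
      by (intro mult_left_mono) auto
    also have "\<dots> = q * (2 ^ 48 * real J ^ 9 * q ^ 4 * h ^ 9)\<^sup>2"
      by (simp add: power_mult_distrib power_mult[symmetric] power_add[symmetric] eval_nat_numeral mult_ac)
    finally have "h\<^sup>2 \<le> q * ((2 ^ 48 * real J ^ 9 * q ^ 4 * h ^ 9)\<^sup>2 / M ^ 34)"
      using M1 by (simp add: pos_le_divide_eq)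
    also have "(2 ^ 48 * real J ^ 9 * q ^ 4 * h ^ 9)\<^sup>2 / M ^ 34 = K'\<^sup>2"
      by (simp add: K'_def power_divide power_mult[symmetric])
    finally show ?thesis using qpos by (simp add: pos_divide_le_eq mult.commute)
  qed
  have bB: "real (card B) \<le> 6 ^ 6 * (2 + A\<^sup>2) * K' ^ 6"
  proof -
    consider "real (card B) \<le> 6 ^ 6 * K ^ 6" | F where "subgroup F (add_monoid R)"
      "subgroup (F - {\<zero>}) (mult_of R)" "B \<subseteq> F" "real (card B * card F) \<le> 6 ^ 6 * K ^ 4 * (card F + card B ^ 2)"
      using card_le_or_subfield[OF fin B(2) Bc K] by blast
    then show ?thesis
    proof cases
      case 1
      also have "6 ^ 6 * K ^ 6 \<le> 6 ^ 6 * K' ^ 6" using K4 by simp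
      also have "\<dots> \<le> 6 ^ 6 * (2 + A\<^sup>2) * K' ^ 6" using K'1 by (simp add: mult_right_mono)
      finally show ?thesis .
    next
      case 2
      have Fc: "F \<subseteq> carrier R" using subgroup.subset[OF 2(1)] by simp
      have finF: "finite F" using Fc fin finite_subset by auto
      have fpos: "real (card F) > 0" using finF 2(3) B(2) by (auto simp: card_gt_0_iff)
      have "K' ^ 4 * (1 + (real (card B))\<^sup>2 / card F) \<le> (2 + A\<^sup>2) * K' ^ 6"
      proof (cases "F = carrier R")
        case True
        have "card B \<le> card H" using B finite_H by (intro card_mono)
        then have "(real (card B))\<^sup>2 \<le> h\<^sup>2" unfolding h_def by (intro power_mono) auto
        then have "(real (card B))\<^sup>2 / card F \<le> h\<^sup>2 / q"
          using True qpos by (simp add: q_def divide_right_mono)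
        then have "(real (card B))\<^sup>2 / card F \<le> K'\<^sup>2" using hq by simp
        then have "K' ^ 4 * (1 + (real (card B))\<^sup>2 / card F) \<le> K' ^ 4 * (1 + K'\<^sup>2)"
          using K'1 by (intro mult_left_mono) auto
        also have "\<dots> = K' ^ 4 + K' ^ 6" by (simp add: algebra_simps power_add[symmetric])
        also have "\<dots> \<le> 2 * K' ^ 6" using K'46 by simp
        also have "\<dots> \<le> (2 + A\<^sup>2) * K' ^ 6" using K'1 by (intro mult_right_mono) auto
        finally show ?thesis .
      next
        case False
        have "card B \<le> card (H \<inter> F)" using B 2 finite_H by (intro card_mono) auto
        then have "real (card B) \<le> A * sqrt (card F)" using sub[OF 2(1,2) False] by linarith
        then have "(real (card B))\<^sup>2 \<le> (A * sqrt (card F))\<^sup>2" by (intro power_mono) auto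
        then have "(real (card B))\<^sup>2 / card F \<le> A\<^sup>2" using fpos by (simp add: power_mult_distrib pos_divide_le_eq)
        then have "K' ^ 4 * (1 + (real (card B))\<^sup>2 / card F) \<le> K' ^ 6 * (1 + A\<^sup>2)"
          using K'1 K'46 by (intro mult_mono) auto
        also have "\<dots> \<le> K' ^ 6 * (2 + A\<^sup>2)" using K'1 by (intro mult_left_mono) auto
        finally show ?thesis by (simp add: mult.commute)
      qed
      moreover have "real (card B) \<le> 6 ^ 6 * (K ^ 4 * (1 + (real (card B))\<^sup>2 / card F))"
        using 2(4) fpos by (simp add: field_simps)
      moreover have "K ^ 4 * (1 + (real (card B))\<^sup>2 / card F) \<le> K' ^ 4 * (1 + (real (card B))\<^sup>2 / card F)"
        using K4 by (intro mult_right_mono) auto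
      ultimately have "K ^ 4 * (1 + (real (card B))\<^sup>2 / card F) \<le> (2 + A\<^sup>2) * K' ^ 6"
        and *: "real (card B) \<le> 6 ^ 6 * (K ^ 4 * (1 + (real (card B))\<^sup>2 / card F))" by (blast intro: order_trans)+
      then have "6 ^ 6 * (K ^ 4 * (1 + (real (card B))\<^sup>2 / card F)) \<le> 6 ^ 6 * ((2 + A\<^sup>2) * K' ^ 6)"
        by (intro mult_left_mono) auto
      with * show ?thesis by (simp only: mult.assoc)
    qed
  qed
  have "real u \<le> 2 * real (card B)" using B(3) by linarith
  then have "8 * real J * real u \<le> 8 * real J * (2 * real (card B))" by (intro mult_left_mono) auto
  with Mu have "M \<le> 8 * real J * (2 * real (card B))" by linarith
  also have "\<dots> \<le> 8 * real J * (2 * (6 ^ 6 * (2 + A\<^sup>2) * K' ^ 6))"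
    using bB by (intro mult_left_mono) auto
  finally have "M * M ^ 102 \<le> 8 * real J * (2 * (6 ^ 6 * (2 + A\<^sup>2) * K' ^ 6)) * M ^ 102"
    using M1 by (intro mult_right_mono) auto
  also have "\<dots> = 16 * 6 ^ 6 * (2 + A\<^sup>2) * real J * (K' ^ 6 * M ^ 102)" by simp
  also have "K' ^ 6 * M ^ 102 = (2 ^ 48 * real J ^ 9 * q ^ 4 * h ^ 9) ^ 6"
    using M1 by (simp add: K'_def power_divide power_mult[symmetric])
  also have "\<dots> = 2 ^ 288 * real J ^ 54 * q ^ 24 * h ^ 54"
    by (simp add: power_mult_distrib power_mult[symmetric])
  also have "16 * 6 ^ 6 * (2 + A\<^sup>2) * real J * (2 ^ 288 * real J ^ 54 * q ^ 24 * h ^ 54) =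
     16 * 6 ^ 6 * 2 ^ 288 * (2 + A\<^sup>2) * (real J * real J ^ 54) * q ^ 24 * h ^ 54" by (simp only: mult_ac)
  also have "real J * real J ^ 54 = real J ^ 55" by (simp flip: power_Suc)
  also have "M * M ^ 102 = M ^ 103" by (simp flip: power_Suc)
  finally show ?thesis by (simp add: M_def q_def h_def)
qed

section \<open>The trace character of a finite field\<close>

lemma (in cring) binomial_theorem:
  assumes x: "x \<in> carrier R" and y: "y \<in> carrier R"
  shows "(x \<oplus> y) [^] (n::nat) = (\<Oplus>k\<in>{..n}. [(n choose k)] \<cdot> (x [^] k \<otimes> y [^] (n - k)))"
proof (induction n)
  case 0
  then show ?case using x y by simp
next
  case (Suc n)
  define f where "f n k = [(n choose k)] \<cdot> (x [^] k \<otimes> y [^] (n - k))" for n k :: nat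
  have fC: "f n k \<in> carrier R" for n k using x y by (simp add: f_def)
  have step: "f (Suc n) (Suc k) = f n k \<otimes> x \<oplus> f n (Suc k) \<otimes> y" for k
  proof -
    have xk: "x [^] k \<in> carrier R" "y [^] j \<in> carrier R" for k j :: nat using x y by auto
    have a: "f n k \<otimes> x = [(n choose k)] \<cdot> (x [^] Suc k \<otimes> y [^] (n - k))"
      unfolding f_def using x y xk by (simp add: add_pow_ldistr add_pow_rdistr m_ac)
    have b: "f n (Suc k) \<otimes> y = [(n choose Suc k)] \<cdot> (x [^] Suc k \<otimes> y [^] (n - k))"
    proof (cases "k < n")
      case True
      then have "n - k = Suc (n - Suc k)" by simp
      then show ?thesis unfolding f_def using x y xk by (simp add: add_pow_ldistr add_pow_rdistr m_ac)
    next
      case False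
      then show ?thesis unfolding f_def using x y xk by (simp add: binomial_eq_0 add_pow_ldistr)
    qed
    show ?thesis unfolding a b using x y
      by (simp add: f_def add.nat_pow_mult add.m_comm)
  qed
  have zero: "f (Suc n) 0 = f n 0 \<otimes> y" unfolding f_def using x y by (simp add: add_pow_ldistr)
  have top: "f n (Suc n) = \<zero>" unfolding f_def using x y by (simp add: binomial_eq_0)
  have "(x \<oplus> y) [^] Suc n = (\<Oplus>k\<in>{..n}. f n k) \<otimes> (x \<oplus> y)" using Suc by (simp add: f_def)
  also have "\<dots> = (\<Oplus>k\<in>{..n}. f n k) \<otimes> x \<oplus> (\<Oplus>k\<in>{..n}. f n k) \<otimes> y"
    using x y fC by (intro r_distr) auto
  also have "(\<Oplus>k\<in>{..n}. f n k) \<otimes> x = (\<Oplus>k\<in>{..n}. f n k \<otimes> x)" using x fC by (intro finsum_ldistr) auto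
  also have "(\<Oplus>k\<in>{..n}. f n k) = (\<Oplus>k\<in>{..Suc n}. f n k)"
    using fC top by (simp add: finsum_Suc)
  also have "(\<Oplus>k\<in>{..Suc n}. f n k) \<otimes> y = (\<Oplus>k\<in>{..Suc n}. f n k \<otimes> y)" using y fC by (intro finsum_ldistr) auto
  also have "\<dots> = (\<Oplus>k\<in>{..n}. f n (Suc k) \<otimes> y) \<oplus> f n 0 \<otimes> y"
    using y fC by (subst finsum_Suc2) auto
  also have "(\<Oplus>k\<in>{..n}. f n k \<otimes> x) \<oplus> ((\<Oplus>k\<in>{..n}. f n (Suc k) \<otimes> y) \<oplus> f n 0 \<otimes> y)
     = (\<Oplus>k\<in>{..n}. f n k \<otimes> x \<oplus> f n (Suc k) \<otimes> y) \<oplus> f n 0 \<otimes> y"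
    using x y fC by (subst finsum_addf) (auto simp: a_assoc)
  also have "\<dots> = (\<Oplus>k\<in>{..n}. f (Suc n) (Suc k)) \<oplus> f (Suc n) 0" by (simp add: step zero)
  also have "\<dots> = (\<Oplus>k\<in>{..Suc n}. f (Suc n) k)" using fC by (subst finsum_Suc2) auto
  finally show ?case by (simp add: f_def)
qed

lemma (in cring) frobenius_add:
  fixes p i :: nat
  assumes p: "prime p" "[p] \<cdot> \<one> = \<zero>" and x: "x \<in> carrier R" and y: "y \<in> carrier R"
  shows "(x \<oplus> y) [^] (p ^ i) = x [^] (p ^ i) \<oplus> y [^] (p ^ i)"
proof -
  have pz: "[p] \<cdot> z = \<zero>" if "z \<in> carrier R" for z
    using add_pow_ldistr[of \<one> z p] that p by simp
  have one: "(x \<oplus> y) [^] p = x [^] p \<oplus> y [^] p" if x: "x \<in> carrier R" and y: "y \<in> carrier R" for x y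
  proof -
    have p0: "0 < p" using p prime_gt_0_nat by blast
    then obtain p' where p': "p = Suc p'" by (cases p) auto
    define f where "f k = [(p choose k)] \<cdot> (x [^] k \<otimes> y [^] (p - k))" for k :: nat
    have fC: "f k \<in> carrier R" for k using x y by (simp add: f_def)
    have mid: "f k = \<zero>" if k: "0 < k" "k < p" for k
    proof -
      have "p dvd (p choose k)" by (rule dvd_choose_prime) (use k p in auto)
      then obtain c where c: "p choose k = p * c" by (elim dvdE)
      have "f k = [c] \<cdot> ([p] \<cdot> (x [^] k \<otimes> y [^] (p - k)))"
        unfolding f_def c using x y by (simp add: add.nat_pow_pow)
      then show ?thesis using pz x y by simp
    qed
    have "(x \<oplus> y) [^] p = (\<Oplus>k\<in>{..p}. f k)" unfolding f_def by (rule binomial_theorem[OF x y])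
    also have "\<dots> = (\<Oplus>k\<in>{0, p}. f k)"
      by (rule add.finprod_mono_neutral_cong_right) (use mid fC in auto)
    also have "\<dots> = f 0 \<oplus> f p" using p0 fC by simp
    finally show ?thesis using x y by (simp add: f_def a_comm)
  qed
  show ?thesis
  proof (induction i)
    case 0 then show ?case using x y by simp
  next
    case (Suc i)
    have "(x \<oplus> y) [^] (p ^ Suc i) = ((x \<oplus> y) [^] (p ^ i)) [^] p"
      using x y by (simp add: nat_pow_pow mult.commute)
    also have "\<dots> = (x [^] (p ^ i)) [^] p \<oplus> (y [^] (p ^ i)) [^] p"
      unfolding Suc.IH using x y by (intro one) auto
    finally show ?case using x y by (simp add: nat_pow_pow mult.commute)
  qed
qed

locale prime_power_field = field R for R (structure) +
  fixes p m :: nat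
  assumes prime: "prime p" and m_pos: "m \<ge> 1" and card_carrier: "card (carrier R) = p ^ m"
begin

lemma p_gt_1: "p > 1" using prime prime_gt_1_nat by blast

lemma finite_carrier: "finite (carrier R)"
  using card_carrier p_gt_1 by (metis card.infinite power_not_zero not_one_less_zero)

lemma characteristic: "[p] \<cdot> \<one> = \<zero>"
proof -
  have "[(p ^ k)] \<cdot> \<one> = ([p] \<cdot> \<one>) [^] k" for k :: nat
  proof (induction k)
    case 0 then show ?case by simp
  next
    case (Suc k)
    have "[(p ^ Suc k)] \<cdot> \<one> = [(p ^ k)] \<cdot> ([p] \<cdot> \<one>)" by (simp add: add.nat_pow_pow)
    also have "\<dots> = ([(p ^ k)] \<cdot> \<one>) \<otimes> ([p] \<cdot> \<one>)" using add_pow_ldistr[of \<one> "[p] \<cdot> \<one>" "p ^ k"] by simp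
    finally show ?case using Suc by simp
  qed
  moreover have "[(p ^ m)] \<cdot> \<one> = \<zero>"
    using add.pow_order_eq_1[of \<one>] card_carrier by (simp add: order_def)
  ultimately have "([p] \<cdot> \<one>) [^] m = \<zero>" by simp
  moreover have "a [^] k = \<zero> \<longrightarrow> a = \<zero>" if "a \<in> carrier R" for a and k :: nat
    using that by (induction k) (auto dest: integral)
  ultimately show ?thesis by simp
qed

lemmas frobenius = frobenius_add[OF prime characteristic]

lemma pow_order_minus_one:
  assumes "x \<in> carrier R" "x \<noteq> \<zero>" shows "x [^] (p ^ m - 1) = \<one>"
proof -
  interpret G: group "mult_of R" rewrites "([^]\<^bsub>mult_of R\<^esub>) = (([^]) :: _ \<Rightarrow> nat \<Rightarrow> _)" and "\<one>\<^bsub>mult_of R\<^esub> = \<one>"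
    by (rule field_mult_group) (simp_all add: nat_pow_mult_of)
  show ?thesis using G.pow_order_eq_1[of x] assms order_mult_of[OF finite_carrier] card_carrier
    by (simp add: order_def)
qed

lemma pow_order: assumes "x \<in> carrier R" shows "x [^] (p ^ m) = x"
proof (cases "x = \<zero>")
  case True
  then show ?thesis using p_gt_1 by (simp add: nat_pow_zero)
next
  case False
  have "p ^ m = Suc (p ^ m - 1)" using p_gt_1 by simp
  then have "x [^] (p ^ m) = x [^] (p ^ m - 1) \<otimes> x" by (metis nat_pow_Suc)
  then show ?thesis using pow_order_minus_one[OF assms False] assms by simp
qed

abbreviation tr :: "'a \<Rightarrow> 'a" where "tr \<equiv> field_trace R p m"

lemma tr_closed: "x \<in> carrier R \<Longrightarrow> tr x \<in> carrier R"
  unfolding field_trace_def by (intro finsum_closed) auto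

lemma tr_add: "x \<in> carrier R \<Longrightarrow> y \<in> carrier R \<Longrightarrow> tr (x \<oplus> y) = tr x \<oplus> tr y"
  unfolding field_trace_def by (simp add: frobenius finsum_addf)

text \<open>
  The Frobenius map permutes the conjugates \<open>x [^] (p ^ i)\<close> cyclically.
\<close>

lemma tr_pow_p: assumes x: "x \<in> carrier R" shows "tr x [^] p = tr x"
proof -
  define g where "g i = x [^] (p ^ i)" for i :: nat
  have gC: "g i \<in> carrier R" for i using x by (simp add: g_def)
  have gp: "g i [^] p = g (Suc i)" for i using x by (simp add: g_def nat_pow_pow mult.commute)
  have fr: "(a \<oplus> b) [^] p = a [^] p \<oplus> b [^] p" if "a \<in> carrier R" "b \<in> carrier R" for a b
    using frobenius[OF that, of 1] by simp
  obtain k where k: "m = Suc k" using m_pos by (cases m) auto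
  have pw: "(\<Oplus>i\<in>{..k}. g i) [^] p = (\<Oplus>i\<in>{..k}. g (Suc i))" for k
  proof (induction k)
    case 0 then show ?case using gC gp by simp
  next
    case (Suc k)
    then show ?case using gC fr gp by (simp add: finsum_Suc)
  qed
  have T: "tr x = (\<Oplus>i\<in>{..k}. g i)" unfolding field_trace_def g_def k lessThan_Suc_atMost ..
  have "(\<Oplus>i\<in>{..k}. g (Suc i)) \<oplus> g 0 = (\<Oplus>i\<in>{..Suc k}. g i)" using gC by (subst finsum_Suc2) auto
  also have "\<dots> = g (Suc k) \<oplus> (\<Oplus>i\<in>{..k}. g i)" using gC by (subst finsum_Suc) auto
  also have "g (Suc k) = g 0" using pow_order[OF x] x by (simp add: g_def k)
  also have "g 0 \<oplus> (\<Oplus>i\<in>{..k}. g i) = (\<Oplus>i\<in>{..k}. g i) \<oplus> g 0" using gC by (intro a_comm) auto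
  finally have "(\<Oplus>i\<in>{..k}. g (Suc i)) = (\<Oplus>i\<in>{..k}. g i)" using gC by simp
  then show ?thesis unfolding T pw .
qed

lemma one_multiple_eq_zero: "[k] \<cdot> \<one> = \<zero> \<longleftrightarrow> p dvd k" for k :: nat
proof
  assume k: "[k] \<cdot> \<one> = \<zero>"
  show "p dvd k"
  proof (rule ccontr)
    assume "\<not> p dvd k"
    then have "coprime p k" using prime by (simp add: prime_imp_coprime)
    moreover have "k \<noteq> 0" using \<open>\<not> p dvd k\<close> by (intro notI) simp
    ultimately obtain a b where ab: "k * a = p * b + 1"
      using bezout_nat[of k p] by (auto simp: coprime_iff_gcd_eq_1 gcd.commute)
    have "[(k * a)] \<cdot> \<one> = [a] \<cdot> ([k] \<cdot> \<one>)" by (simp add: add.nat_pow_pow)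
    moreover have "[(p * b + 1)] \<cdot> \<one> = [b] \<cdot> ([p] \<cdot> \<one>) \<oplus> \<one>"
      by (simp add: add.nat_pow_pow add.nat_pow_mult[symmetric])
    ultimately show False using k characteristic ab by simp
  qed
next
  assume "p dvd k"
  then obtain c where "k = p * c" by (elim dvdE)
  then have "[k] \<cdot> \<one> = [c] \<cdot> ([p] \<cdot> \<one>)" by (simp add: add.nat_pow_pow)
  then show "[k] \<cdot> \<one> = \<zero>" using characteristic by simp
qed

lemma one_multiple_mod: "[(k mod p)] \<cdot> \<one> = [k] \<cdot> \<one>" for k :: nat
proof -
  have "[k] \<cdot> \<one> = [(p * (k div p) + k mod p)] \<cdot> \<one>" by simp
  also have "\<dots> = [(p * (k div p))] \<cdot> \<one> \<oplus> [(k mod p)] \<cdot> \<one>" by (simp only: add.nat_pow_mult[OF one_closed])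
  also have "[(p * (k div p))] \<cdot> \<one> = \<zero>" by (simp add: one_multiple_eq_zero)
  finally show ?thesis by simp
qed

lemma inj_one_multiple: "inj_on (\<lambda>k::nat. [k] \<cdot> \<one>) {..<p}"
proof (rule linorder_inj_onI)
  fix i j :: nat assume ij: "i < j" "i \<in> {..<p}" "j \<in> {..<p}"
  show "[i] \<cdot> \<one> \<noteq> [j] \<cdot> \<one>"
  proof
    assume eq: "[i] \<cdot> \<one> = [j] \<cdot> \<one>"
    have "[j] \<cdot> \<one> = [i] \<cdot> \<one> \<oplus> [(j - i)] \<cdot> \<one>" using ij by (simp add: add.nat_pow_mult)
    then have "[(j - i)] \<cdot> \<one> = \<zero>" unfolding eq[symmetric] by (metis add.l_cancel_one add.nat_pow_closed one_closed)
    then have "p dvd j - i" by (simp add: one_multiple_eq_zero)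
    then show False using ij by (auto dest: dvd_imp_le)
  qed
qed auto

text \<open>
  The multiples of \<open>\<one>\<close> are \<open>p\<close> solutions of \<open>y [^] p = y\<close>, as many as a polynomial of degree \<open>p\<close> can have.
\<close>

lemma fixed_by_frobenius:
  assumes y: "y \<in> carrier R" "y [^] p = y"
  shows "\<exists>k::nat. y = [k] \<cdot> \<one>"
proof -
  let ?P = "(\<lambda>k::nat. [k] \<cdot> \<one>) ` {..<p}" and ?Q = "{y \<in> carrier R. y [^] p = y}"
  have fr: "([k] \<cdot> \<one>) [^] p = [k] \<cdot> \<one>" for k :: nat
  proof (induction k)
    case 0 then show ?case using p_gt_1 by (simp add: nat_pow_zero)
  next
    case (Suc k)
    have "[(Suc k)] \<cdot> \<one> = [k] \<cdot> \<one> \<oplus> \<one>" by simp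
    then show ?case using frobenius[of "[k] \<cdot> \<one>" \<one> 1] Suc by simp
  qed
  have PQ: "?P \<subseteq> ?Q" using fr by auto
  have "?Q \<subseteq> insert \<zero> {y \<in> carrier R. y [^] (p - 1) = \<one>}"
  proof
    fix y assume y: "y \<in> ?Q"
    have "p = Suc (p - 1)" using p_gt_1 by simp
    then have "y [^] (p - 1) \<otimes> y = y" using y by (metis (mono_tags, lifting) mem_Collect_eq nat_pow_Suc)
    then have "y [^] (p - 1) \<otimes> y = \<one> \<otimes> y" using y by simp
    then show "y \<in> insert \<zero> {y \<in> carrier R. y [^] (p - 1) = \<one>}" using y m_rcancel[of y "y [^] (p - 1)" \<one>] by auto
  qed
  then have "card ?Q \<le> card (insert \<zero> {y \<in> carrier R. y [^] (p - 1) = \<one>})"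
    using finite_carrier by (intro card_mono) auto
  also have "\<dots> \<le> Suc (card {y \<in> carrier R. y [^] (p - 1) = \<one>})" by (rule card_insert_le_m1) auto
  also have "\<dots> \<le> Suc (p - 1)" using num_roots_le_deg[OF finite_carrier, of "p - 1"] p_gt_1 by simp
  also have "\<dots> = card ?P" using card_image[OF inj_one_multiple] p_gt_1 by simp
  finally have "?P = ?Q" using PQ finite_carrier by (intro card_seteq) auto
  then show ?thesis using y by blast
qed

lemma tr_prime_field: "x \<in> carrier R \<Longrightarrow> \<exists>k::nat. tr x = [k] \<cdot> \<one>"
  using fixed_by_frobenius tr_closed tr_pow_p by blast

text \<open>
  The trace is a polynomial function of degree \<open>p ^ (m - 1)\<close>, which is less than the number of elements of the field.
\<close>

lemma tr_nonzero: "\<exists>x\<in>carrier R. tr x \<noteq> \<zero>"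
proof (rule ccontr)
  assume "\<not> ?thesis"
  then have all: "\<And>x. x \<in> carrier R \<Longrightarrow> tr x = \<zero>" by blast
  interpret U: UP_domain R "UP R" by (unfold_locales)
  have ex: "\<exists>f\<in>carrier (UP R). deg R f = p ^ k \<and>
      (\<forall>a\<in>carrier R. eval R R id a f = (\<Oplus>i\<in>{..k}. a [^] (p ^ i)))" for k
  proof (induction k)
    case 0
    have "monom (UP R) \<one> 1 \<in> carrier (UP R)" "deg R (monom (UP R) \<one> 1) = p ^ 0" by simp_all
    moreover have "\<forall>a\<in>carrier R. eval R R id a (monom (UP R) \<one> 1) = (\<Oplus>i\<in>{..0}. a [^] (p ^ i))"
      using U.evalRR_monom[of \<one> _ 1] by simp
    ultimately show ?case by blast
  next
    case (Suc k)
    then obtain f where f: "f \<in> carrier (UP R)" "deg R f = p ^ k"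
      "\<And>a. a \<in> carrier R \<Longrightarrow> eval R R id a f = (\<Oplus>i\<in>{..k}. a [^] (p ^ i))" by blast
    let ?g = "monom (UP R) \<one> (p ^ Suc k) \<oplus>\<^bsub>UP R\<^esub> f"
    have lt: "p ^ k < p ^ Suc k" using p_gt_1 by simp
    have "deg R ?g = p ^ Suc k"
      using f lt by (subst U.deg_add_eq) (auto simp del: power_Suc)
    moreover have "\<forall>a\<in>carrier R. eval R R id a ?g = (\<Oplus>i\<in>{..Suc k}. a [^] (p ^ i))"
      using f by (simp add: U.evalRR_simps finsum_Suc del: power_Suc)
    moreover have "?g \<in> carrier (UP R)" using f(1) by simp
    ultimately show ?case by blast
  qed
  obtain k where k: "m = Suc k" using m_pos by (cases m) auto
  obtain f where f: "f \<in> carrier (UP R)" "deg R f = p ^ k"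
    "\<And>a. a \<in> carrier R \<Longrightarrow> eval R R id a f = (\<Oplus>i\<in>{..k}. a [^] (p ^ i))" using ex by blast
  have "f \<noteq> \<zero>\<^bsub>UP R\<^esub>" using f(2) p_gt_1 by (intro U.deg_nzero_nzero) simp
  then have "card {a \<in> carrier R. eval R R id a f = \<zero>} \<le> p ^ k"
    using U.roots_bound[OF f(1) _ finite_carrier] f(2) by simp
  moreover have "{a \<in> carrier R. eval R R id a f = \<zero>} = carrier R"
    using all f(3) unfolding field_trace_def k lessThan_Suc_atMost by auto
  ultimately have "p ^ Suc k \<le> p ^ k" using card_carrier k by simp
  then show False using p_gt_1 by simp
qed

text \<open>
  This removes the reduction modulo \<open>p\<close>, so that additivity of the character becomes the functional equation of
  the exponential function.
\<close>

lemma e_char_multiple: "e_char R p ([k] \<cdot> \<one>) = exp (2 * of_real pi * \<i> * of_nat k / of_nat p)" for k :: nat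
proof -
  have "(THE j. j < p \<and> [j] \<cdot> \<one> = [k] \<cdot> \<one>) = k mod p"
  proof (rule the_equality)
    show "k mod p < p \<and> [(k mod p)] \<cdot> \<one> = [k] \<cdot> \<one>" using p_gt_1 by (simp add: one_multiple_mod)
    fix j assume j: "j < p \<and> [j] \<cdot> \<one> = [k] \<cdot> \<one>"
    then show "j = k mod p"
      using p_gt_1 inj_onD[OF inj_one_multiple, of j "k mod p"] by (simp add: one_multiple_mod)
  qed
  then have "e_char R p ([k] \<cdot> \<one>) = exp (2 * of_real pi * \<i> * of_nat (k mod p) / of_nat p)"
    by (simp add: e_char_def)
  also have "\<dots> = exp (2 * of_real pi * \<i> * of_nat (k mod p) / of_nat p) * exp (2 * of_real pi * \<i> * of_nat (k div p))"
    using exp_integer_2pi[of "of_nat (k div p)"] by (simp add: mult_ac)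
  also have "\<dots> = exp (2 * of_real pi * \<i> * (of_nat (k mod p) / of_nat p + of_nat (k div p)))"
    by (simp add: exp_add[symmetric] algebra_simps)
  also have "of_nat (k mod p) / of_nat p + of_nat (k div p) = (of_nat k / of_nat p :: complex)"
  proof -
    have "(of_nat k :: complex) = of_nat (p * (k div p) + k mod p)" by simp
    then show ?thesis using p_gt_1 unfolding of_nat_add of_nat_mult by (simp add: field_simps)
  qed
  finally show ?thesis by simp
qed

lemma e_char_nontrivial: "\<not> p dvd k \<Longrightarrow> e_char R p ([k] \<cdot> \<one>) \<noteq> 1" for k :: nat
proof
  assume k: "\<not> p dvd k" and "e_char R p ([k] \<cdot> \<one>) = 1"
  then have "exp (2 * of_real pi * \<i> * of_nat k / of_nat p) = (1::complex)" by (simp add: e_char_multiple)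
  then obtain j :: int where "Im (2 * of_real pi * \<i> * of_nat k / of_nat p) = of_int (2 * j) * pi"
    unfolding exp_eq_1 by blast
  then have "2 * pi * (real k / real p) = 2 * pi * of_int j" by (simp add: Im_divide_of_nat mult_ac)
  then have "real k / real p = of_int j" using mult_left_cancel[of "2 * pi"] by fastforce
  then have "of_int (int k) = (of_int (j * int p) :: real)" using p_gt_1 by (simp add: field_simps)
  then have "int k = j * int p" unfolding of_int_eq_iff .
  then show False using k by (metis dvd_triv_right int_dvd_int_iff)
qed

lemma add_char_add:
  assumes "a \<in> carrier R" "x \<in> carrier R" "y \<in> carrier R"
  shows "add_char R p m a (x \<oplus> y) = add_char R p m a x * add_char R p m a y"
proof -
  obtain j k :: nat where jk: "tr (a \<otimes> x) = [j] \<cdot> \<one>" "tr (a \<otimes> y) = [k] \<cdot> \<one>"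
    using tr_prime_field assms by (meson m_closed)
  then have "tr (a \<otimes> (x \<oplus> y)) = [(j + k)] \<cdot> \<one>"
    using assms by (simp add: r_distr tr_add add.nat_pow_mult)
  then show ?thesis unfolding add_char_def
    by (simp add: jk e_char_multiple exp_add[symmetric] add_divide_distrib algebra_simps)
qed

lemma add_char_norm:
  assumes "a \<in> carrier R" "x \<in> carrier R"
  shows "cmod (add_char R p m a x) = 1"
proof -
  obtain j :: nat where "tr (a \<otimes> x) = [j] \<cdot> \<one>"
    using tr_prime_field assms by (meson m_closed)
  then show ?thesis by (simp add: add_char_def e_char_multiple norm_exp_eq_Re)
qed

lemma add_char_nontrivial:
  assumes "a \<in> carrier R" "a \<noteq> \<zero>"
  shows "\<exists>x\<in>carrier R. add_char R p m a x \<noteq> 1"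
proof -
  obtain z where z: "z \<in> carrier R" "tr z \<noteq> \<zero>" using tr_nonzero by blast
  obtain k :: nat where k: "tr z = [k] \<cdot> \<one>" using tr_prime_field z by blast
  have ia: "inv a \<in> carrier R" "a \<otimes> inv a = \<one>" using assms by (auto simp: field_Units)
  then have "a \<otimes> (inv a \<otimes> z) = z" using assms z by (simp add: m_assoc[symmetric])
  then have "add_char R p m a (inv a \<otimes> z) \<noteq> 1"
    using e_char_nontrivial[of k] k z by (simp add: add_char_def one_multiple_eq_zero)
  then show ?thesis using ia z by blast
qed

end

section \<open>Groups of powers and their intersection with subfields\<close>

text \<open>
  Euclid's algorithm on the exponents: \<open>p ^ (\<nu> + k) - 1\<close> and \<open>p ^ k - 1\<close> are congruent modulo \<open>p ^ \<nu> - 1\<close>.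
\<close>

lemma exponent_dvd_if_pow_minus_one_dvd:
  fixes p :: nat
  assumes p: "p > 1" and \<nu>: "\<nu> > 0" and dvd: "p ^ \<nu> - 1 dvd p ^ m - 1"
  shows "\<nu> dvd m"
  using dvd
proof (induction m rule: less_induct)
  case (less m)
  show ?case
  proof (cases "m < \<nu>")
    case True
    then have "p ^ m - 1 < p ^ \<nu> - 1" using p by (simp add: diff_less_mono)
    then have "p ^ m - 1 = 0" using less.prems by (meson dvd_imp_le not_le gr0I)
    then have "m = 0" using one_less_power[OF p, of m] by (intro ccontr[of "m = 0"]) simp
    then show ?thesis by simp
  next
    case False
    then obtain k where m: "m = \<nu> + k" using le_Suc_ex by (metis not_le)
    have "p ^ m - 1 = p ^ k * (p ^ \<nu> - 1) + (p ^ k - 1)"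
      using p by (simp add: m power_add algebra_simps)
    then have "p ^ \<nu> - 1 dvd p ^ k - 1" using less.prems by (metis dvd_add_right_iff dvd_triv_right)
    then have "\<nu> dvd k" using less.IH[of k] m \<nu> by simp
    then show ?thesis by (simp add: m)
  qed
qed

lemma gcd_cofactors:
  fixes h n f d :: nat
  assumes "h * n = Q" "f * d = Q" "Q > 0"
  shows "gcd h f * n = f * gcd n d"
proof -
  have "gcd h f * n * d = gcd (h * n * d) (f * d * n)"
    by (simp add: gcd_mult_distrib_nat mult_ac)
  also have "\<dots> = Q * gcd d n" unfolding assms by (simp add: gcd_mult_distrib_nat)
  also have "\<dots> = f * gcd n d * d" using assms by (simp add: mult_ac gcd.commute)
  finally show ?thesis using assms by (cases "d = 0") auto
qed

context prime_power_field
begin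

lemma order_gt_1: "p ^ m > 1"
  using one_less_power[OF p_gt_1, of m] m_pos by linarith

lemma mult_comm_group: "comm_group (mult_of R)"
  by (rule group.group_comm_groupI[OF field_mult_group]) (auto simp: m_comm)

definition powers :: "nat \<Rightarrow> 'a set" where
  "powers n = (\<lambda>x. x [^] n) ` (carrier R - {\<zero>})"

lemma powers_carrier: "y \<in> powers n \<Longrightarrow> y \<in> carrier R" by (auto simp: powers_def)

lemma pow_nonzero: "x \<in> carrier R \<Longrightarrow> x \<noteq> \<zero> \<Longrightarrow> x [^] (n::nat) \<noteq> \<zero>"
  by (induction n) (auto dest: integral)

lemma subgroup_powers: "subgroup (powers n) (mult_of R)"
proof -
  interpret G: comm_group "mult_of R" rewrites "([^]\<^bsub>mult_of R\<^esub>) = (([^]) :: _ \<Rightarrow> nat \<Rightarrow> _)" and "\<one>\<^bsub>mult_of R\<^esub> = \<one>"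
    by (rule mult_comm_group) (simp_all add: nat_pow_mult_of)
  show ?thesis
  proof (rule G.subgroupI)
    show "powers n \<subseteq> carrier (mult_of R)" using pow_nonzero by (auto simp: powers_def)
    show "powers n \<noteq> {}" unfolding powers_def using one_not_zero one_closed by blast
    fix y assume "y \<in> powers n"
    then obtain x where x: "x \<in> carrier R - {\<zero>}" "y = x [^] n" by (auto simp: powers_def)
    then have "inv\<^bsub>mult_of R\<^esub> y = (inv\<^bsub>mult_of R\<^esub> x) [^] n" using G.nat_pow_inv[of x n] by simp
    then show "inv\<^bsub>mult_of R\<^esub> y \<in> powers n" using G.inv_closed[of x] x by (auto simp: powers_def)
  next
    fix y z assume "y \<in> powers n" "z \<in> powers n"
    then obtain x x' where x: "x \<in> carrier R - {\<zero>}" "y = x [^] n" "x' \<in> carrier R - {\<zero>}" "z = x' [^] n"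
      by (auto simp: powers_def)
    then have "y \<otimes>\<^bsub>mult_of R\<^esub> z = (x \<otimes> x') [^] n" by (simp add: nat_pow_distrib)
    moreover have "x \<otimes> x' \<in> carrier R - {\<zero>}" using x integral by auto
    ultimately show "y \<otimes>\<^bsub>mult_of R\<^esub> z \<in> powers n" by (auto simp: powers_def)
  qed
qed

text \<open>
  All fibres of the power map have the size of its kernel. Counting roots bounds the kernel by \<open>n\<close> and the image by
  \<open>(p ^ m - 1) / n\<close>; the product of the two sizes is \<open>p ^ m - 1\<close>, so both bounds are attained.
\<close>

lemma
  assumes n: "n > 0" "n dvd p ^ m - 1"
  shows card_powers: "card (powers n) * n = p ^ m - 1"
    and card_power_fibre: "y \<in> powers n \<Longrightarrow> card {x \<in> carrier R - {\<zero>}. x [^] n = y} = n"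
proof -
  let ?N = "carrier R - {\<zero>}"
  let ?fib = "\<lambda>y. {x \<in> ?N. x [^] n = y}"
  have finN: "finite ?N" using finite_carrier by simp
  obtain h where h: "p ^ m - 1 = n * h" using n by (elim dvdE)
  have cardN: "card ?N = n * h" using card_carrier finite_carrier h by (simp add: card_Diff_subset)
  have "p ^ m > 1" by (rule order_gt_1)
  then have hpos: "h > 0" using h by (intro gr0I) simp
  have k: "card (?fib \<one>) \<le> n"
  proof -
    have "card (?fib \<one>) \<le> card {x \<in> carrier R. x [^] n = \<one>}" using finite_carrier by (intro card_mono) auto
    also have "\<dots> \<le> n" using num_roots_le_deg[OF finite_carrier, of n] n by simp
    finally show ?thesis .
  qed
  have H: "card (powers n) \<le> h"
  proof -
    have "powers n \<subseteq> {y \<in> carrier R. y [^] h = \<one>}"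
      using pow_order_minus_one[unfolded h] by (auto simp: powers_def nat_pow_pow)
    then have "card (powers n) \<le> card {y \<in> carrier R. y [^] h = \<one>}" using finite_carrier by (intro card_mono) auto
    also have "\<dots> \<le> h" using num_roots_le_deg[OF finite_carrier, of h] hpos by simp
    finally show ?thesis .
  qed
  have fib: "card (?fib y) = card (?fib \<one>)" if y: "y \<in> powers n" for y
  proof -
    obtain x where x: "x \<in> carrier R" "x \<noteq> \<zero>" "y = x [^] n" using y by (auto simp: powers_def)
    have ix: "inv x \<in> carrier R" "inv x \<noteq> \<zero>" "x \<otimes> inv x = \<one>"
      using x field_Units Units_inv_closed by (auto simp: field_Units) (metis Units_r_inv field_Units DiffI r_null singletonD one_not_zero)
    have "?fib y = (\<lambda>z. x \<otimes> z) ` ?fib \<one>"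
    proof
      show "(\<lambda>z. x \<otimes> z) ` ?fib \<one> \<subseteq> ?fib y" using x by (auto simp: nat_pow_distrib dest: integral)
      show "?fib y \<subseteq> (\<lambda>z. x \<otimes> z) ` ?fib \<one>"
      proof
        fix w assume w: "w \<in> ?fib y"
        have "w = x \<otimes> (inv x \<otimes> w)" using w x ix by (simp add: m_assoc[symmetric])
        moreover have "(inv x \<otimes> w) [^] n = (inv x \<otimes> x) [^] n" using w x ix by (simp add: nat_pow_distrib)
        then have "(inv x \<otimes> w) [^] n = \<one>" using x ix by (simp add: m_comm)
        moreover have "inv x \<otimes> w \<in> ?N" using w ix integral by auto
        ultimately show "w \<in> (\<lambda>z. x \<otimes> z) ` ?fib \<one>" by blast
      qed
    qed
    moreover have "inj_on (\<lambda>z. x \<otimes> z) (?fib \<one>)" using x by (intro inj_on_scale) auto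
    ultimately show ?thesis by (simp add: card_image)
  qed
  have "n * h = (\<Sum>x\<in>?N. 1)" using cardN by simp
  also have "\<dots> = (\<Sum>y\<in>powers n. \<Sum>x\<in>?fib y. 1)" unfolding powers_def by (rule sum.image_gen[OF finN])
  also have "\<dots> = card (powers n) * card (?fib \<one>)" using fib by simp
  finally have eq: "n * h = card (powers n) * card (?fib \<one>)" .
  have "card (powers n) * card (?fib \<one>) \<le> h * card (?fib \<one>)" using H by simp
  then have "n * h \<le> card (?fib \<one>) * h" unfolding eq by (simp only: mult.commute)
  then have "n \<le> card (?fib \<one>)" using hpos by simp
  then have kn: "card (?fib \<one>) = n" using k by simp
  show "card (powers n) * n = p ^ m - 1" using eq kn h by simp
  show "y \<in> powers n \<Longrightarrow> card (?fib y) = n" using fib kn by simp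
qed

lemma add_char_zero: "a \<in> carrier R \<Longrightarrow> add_char R p m a \<zero> = 1"
  using add_char_add[of a \<zero> \<zero>] add_char_norm[of a \<zero>] by auto

lemma gauss_sum_eq:
  assumes n: "n > 0" "n dvd p ^ m - 1" and a: "a \<in> carrier R"
  shows "gauss_sum R p m n a = 1 + of_nat n * (\<Sum>y\<in>powers n. add_char R p m a y)"
proof -
  let ?N = "carrier R - {\<zero>}" and ?f = "add_char R p m a"
  have "gauss_sum R p m n a = ?f (\<zero> [^] n) + (\<Sum>x\<in>?N. ?f (x [^] n))"
    unfolding gauss_sum_def using finite_carrier by (subst sum.remove[of _ \<zero>]) auto
  also have "?f (\<zero> [^] n) = 1" using n a by (simp add: nat_pow_zero add_char_zero)
  also have "(\<Sum>x\<in>?N. ?f (x [^] n)) = (\<Sum>y\<in>powers n. \<Sum>x\<in>{x \<in> ?N. x [^] n = y}. ?f (x [^] n))"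
    unfolding powers_def using finite_carrier by (intro sum.image_gen) simp
  also have "\<dots> = (\<Sum>y\<in>powers n. \<Sum>x\<in>{x \<in> ?N. x [^] n = y}. ?f y)" by (intro sum.cong) auto
  also have "\<dots> = (\<Sum>y\<in>powers n. of_nat n * ?f y)" using card_power_fibre[OF n] by simp
  finally show ?thesis by (simp add: sum_distrib_left)
qed

text \<open>
  This is what the hypothesis on greatest common divisors means. A subfield has \<open>f = p ^ \<nu>\<close> elements with \<open>\<nu>\<close>
  dividing \<open>m\<close>. Its nonzero elements satisfy \<open>x [^] (f - 1) = \<one>\<close> and the \<open>n\<close>-th powers satisfy
  \<open>x [^] h = \<one>\<close>, so that their intersection has at most \<open>gcd h (f - 1)\<close> elements. Passing to the cofactors \<open>n\<close> of
  \<open>h\<close> and \<open>d\<close> of \<open>f - 1\<close> in \<open>p ^ m - 1\<close>, this is \<open>(f - 1) / n\<close> times \<open>gcd n d\<close>.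
\<close>

lemma card_powers_inter_subfield:
  assumes n: "n > 0" "n dvd p ^ m - 1"
    and gcds: "\<forall>\<nu>::nat. 1 \<le> \<nu> \<and> \<nu> < m \<and> \<nu> dvd m \<longrightarrow>
             real (gcd n ((p ^ m - 1) div (p ^ \<nu> - 1))) \<le> A * (real n / real p powr (real \<nu> / 2))"
    and A: "A > 0"
    and F: "subgroup F (add_monoid R)" "subgroup (F - {\<zero>}) (mult_of R)" "F \<noteq> carrier R"
  shows "card (powers n \<inter> F) \<le> A * sqrt (card F)"
proof -
  define f where "f = card F"
  define h where "h = card (powers n)"
  define Q where "Q = p ^ m - 1"
  have hn: "h * n = Q" using card_powers[OF n] by (simp add: h_def Q_def)
  have pm: "p ^ m > 1" by (rule order_gt_1)
  then have Qpos: "Q > 0" by (simp add: Q_def)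
  have hpos: "h > 0" using hn Qpos by (intro gr0I) simp
  have Fc: "F \<subseteq> carrier R" using subgroup.subset[OF F(1)] by simp
  have finF: "finite F" using Fc finite_carrier finite_subset by auto
  have F0: "\<zero> \<in> F" using subgroup.one_closed[OF F(1)] by simp
  have F1: "\<one> \<in> F" using subgroup.one_closed[OF F(2)] by simp
  have "f dvd p ^ m"
    using group.lagrange[OF a_group F(1)] card_carrier unfolding f_def order_def by (metis dvd_triv_right partial_object.select_convs(1) monoid.surjective)
  then obtain \<nu> where \<nu>: "\<nu> \<le> m" "f = p ^ \<nu>" using prime divides_primepow_nat by blast
  have "card {\<zero>, \<one>} \<le> f" unfolding f_def using F0 F1 finF by (intro card_mono) auto
  then have f2: "f \<ge> 2" by simp
  then have \<nu>1: "\<nu> \<ge> 1" using \<nu> by (cases \<nu>) auto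
  have "f \<noteq> p ^ m" using card_subset_eq[OF finite_carrier Fc] card_carrier F(3) by (auto simp: f_def)
  then have \<nu>m: "\<nu> < m" using \<nu> by (metis le_neq_implies_less)
  have cF: "card (F - {\<zero>}) = f - 1" using F0 finF by (simp add: f_def)
  interpret G: comm_group "mult_of R" rewrites "([^]\<^bsub>mult_of R\<^esub>) = (([^]) :: _ \<Rightarrow> nat \<Rightarrow> _)" and "\<one>\<^bsub>mult_of R\<^esub> = \<one>"
    by (rule mult_comm_group) (simp_all add: nat_pow_mult_of)
  have oG: "order (mult_of R) = Q" using order_mult_of[OF finite_carrier] card_carrier by (simp add: order_def Q_def)
  have dvd: "f - 1 dvd Q" using G.lagrange[OF F(2)] cF oG by (metis dvd_triv_right)
  then obtain d where d: "(f - 1) * d = Q" by (metis dvdE)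
  have "\<nu> dvd m"
    using exponent_dvd_if_pow_minus_one_dvd[OF p_gt_1 _ dvd[unfolded Q_def \<nu>(2)]] \<nu>1 by simp
  moreover have "Q div (p ^ \<nu> - 1) = d" using d f2 unfolding \<nu>(2) by (metis Qpos mult_is_0 nonzero_mult_div_cancel_left not_gr0)
  ultimately have gd: "real (gcd n d) \<le> A * (real n / real p powr (real \<nu> / 2))"
    using gcds \<nu>1 \<nu>m by (auto simp: Q_def)
  have sq: "real p powr (real \<nu> / 2) = sqrt f"
  proof -
    have "real p powr (real \<nu> / 2) = (real p powr \<nu>) powr (1 / 2)" by (simp add: powr_powr)
    also have "real p powr \<nu> = f" using p_gt_1 by (simp add: powr_realpow \<nu>(2))
    finally show ?thesis by (simp add: powr_half_sqrt)
  qed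
  have pow1: "x [^] gcd h (f - 1) = \<one>" if x: "x \<in> powers n \<inter> F" for x
  proof -
    have xc: "x \<in> carrier (mult_of R)" using x subgroup.subset[OF subgroup_powers[of n]] by auto
    have pw: "x [^] card K = \<one>" if K: "subgroup K (mult_of R)" "x \<in> K" for K
    proof -
      interpret K: group "(mult_of R)\<lparr>carrier := K\<rparr>" by (rule subgroup.subgroup_is_group[OF K(1) G.is_group])
      have "x [^]\<^bsub>(mult_of R)\<lparr>carrier := K\<rparr>\<^esub> card K = \<one>\<^bsub>(mult_of R)\<lparr>carrier := K\<rparr>\<^esub>"
        using K.pow_order_eq_1[of x] K by (simp add: order_def)
      moreover have "x [^]\<^bsub>(mult_of R)\<lparr>carrier := K\<rparr>\<^esub> j = x [^] j" for j :: nat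
        by (simp add: nat_pow_def)
      ultimately show ?thesis by simp
    qed
    have "x [^] h = \<one>" using pw[OF subgroup_powers] x by (simp add: h_def)
    moreover have "x [^] (f - 1) = \<one>" using pw[OF F(2)] x xc cF by auto
    ultimately show ?thesis using G.pow_eq_id[OF xc] by simp
  qed
  have "card (powers n \<inter> F) \<le> card {x \<in> carrier R. x [^] gcd h (f - 1) = \<one>}"
    using finite_carrier pow1 Fc by (intro card_mono) auto
  also have "\<dots> \<le> gcd h (f - 1)" using num_roots_le_deg[OF finite_carrier, of "gcd h (f - 1)"] hpos by simp
  finally have "card (powers n \<inter> F) * n \<le> gcd h (f - 1) * n" by (rule mult_right_mono) simp
  then have "real (card (powers n \<inter> F)) * n \<le> real (gcd h (f - 1) * n)"
    by (simp only: of_nat_le_iff of_nat_mult[symmetric])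
  also have "\<dots> = real (f - 1) * real (gcd n d)" unfolding gcd_cofactors[OF hn d Qpos] by simp
  also have "\<dots> \<le> real f * (A * (real n / sqrt f))"
    using gd unfolding sq by (intro mult_mono) auto
  also have "\<dots> = A * sqrt f * n"
    using f2 by (simp add: field_simps)
  finally show ?thesis using n by (simp add: f_def)
qed

end

section \<open>The bound for Gauss sums\<close>

text \<open>
  A weighted geometric mean of the bound for \<open>M ^ 103\<close> and of \<open>M\<^sup>2 \<le> q\<close>. The exponent of \<open>h\<close> comes out as
  \<open>57 / 128\<close> if the first bound is given the weight \<open>(57 / 128) / (54 / 103) = 5871 / 6912\<close>. The exponent of \<open>q\<close> is then
  smaller than \<open>35 / 128\<close> by \<open>1.5 / 6912\<close>, and this surplus pays for the logarithm: the 55th power of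
  \<open>J\<close>, taken to the power \<open>57 / 6912\<close>, stays below it if \<open>J\<close> is of order \<open>q powr (1 / 2100)\<close>.
\<close>

lemma interpolation:
  fixes M q h C :: real and J :: nat
  assumes q: "1 \<le> q" and h: "1 \<le> h" "h \<le> q" and M: "M \<ge> 0" "M\<^sup>2 \<le> q" and C: "C > 0"
    and J: "real J \<le> 4203 * q powr (1 / 2100)"
    and main: "2 * h \<le> M\<^sup>2 \<Longrightarrow> M ^ 103 \<le> C * real J ^ 55 * q ^ 24 * h ^ 54"
  shows "M \<le> (2 + (C * 4203 ^ 55) powr (57 / 6912)) * (q powr (35 / 128) * h powr (57 / 128))"
proof (cases "2 * h \<le> M\<^sup>2")
  case False
  have "M\<^sup>2 \<le> 2\<^sup>2 * h" using False h by simp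
  also have "\<dots> = (2 * h powr (1 / 2))\<^sup>2" using h by (simp add: power_mult_distrib powr_half_sqrt)
  finally have "M \<le> 2 * h powr (1 / 2)" by (rule power2_le_imp_le) simp
  also have "h powr (1 / 2) = h powr (7 / 128) * h powr (57 / 128)" by (simp add: powr_add[symmetric])
  also have "2 * (h powr (7 / 128) * h powr (57 / 128)) \<le> 2 * (q powr (35 / 128) * h powr (57 / 128))"
  proof -
    have "h powr (7 / 128) \<le> q powr (7 / 128)" using h by (intro powr_mono2) auto
    also have "\<dots> \<le> q powr (35 / 128)" using q by (intro powr_mono) auto
    finally show ?thesis by (simp add: mult_right_mono)
  qed
  also have "\<dots> \<le> (2 + (C * 4203 ^ 55) powr (57 / 6912)) * (q powr (35 / 128) * h powr (57 / 128))"
    by (intro mult_right_mono) auto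
  finally show ?thesis .
next
  case True
  then have Mpos: "M > 0" using M h by (cases "M = 0") auto
  define D where "D = C * 4203 ^ 55"
  have D: "D > 0" using C by (simp add: D_def)
  have "M powr 103 \<le> C * real J ^ 55 * q ^ 24 * h ^ 54" using main[OF True] Mpos by (simp add: powr_realpow)
  also have "\<dots> \<le> C * (4203 * q powr (1 / 2100)) ^ 55 * q ^ 24 * h ^ 54"
    using J C q h by (intro mult_right_mono mult_left_mono power_mono) auto
  also have "\<dots> = D * ((q powr (1 / 2100)) powr 55 * q powr 24 * h powr 54)"
    using q h by (simp add: D_def power_mult_distrib powr_realpow)
  also have "(q powr (1 / 2100)) powr 55 * q powr 24 = q powr (55 / 2100 + 24)" by (simp add: powr_powr powr_add[symmetric] del: powr_numeral)
  finally have "(M powr 103) powr (57 / 6912) \<le> (D * (q powr (55 / 2100 + 24) * h powr 54)) powr (57 / 6912)"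
    by (intro powr_mono2) auto
  also have "\<dots> = D powr (57 / 6912) * (q powr ((55 / 2100 + 24) * (57 / 6912)) * h powr (57 / 128))"
    using D q h by (simp add: powr_mult powr_powr del: powr_numeral)
  finally have a: "M powr (5871 / 6912) \<le> D powr (57 / 6912) * (q powr ((55 / 2100 + 24) * (57 / 6912)) * h powr (57 / 128))"
    by (simp add: powr_powr)
  have "(M powr 2) powr (1041 / 13824) \<le> q powr (1041 / 13824)"
    using M Mpos by (intro powr_mono2) (auto simp: powr_realpow)
  then have b: "M powr (1041 / 6912) \<le> q powr (1041 / 13824)" by (simp add: powr_powr)
  have "M = M powr (5871 / 6912) * M powr (1041 / 6912)" using Mpos by (simp add: powr_add[symmetric])
  also have "\<dots> \<le> (D powr (57 / 6912) * (q powr ((55 / 2100 + 24) * (57 / 6912)) * h powr (57 / 128))) * q powr (1041 / 13824)"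
    using a b by (intro mult_mono) auto
  also have "\<dots> = D powr (57 / 6912) * (q powr ((55 / 2100 + 24) * (57 / 6912) + 1041 / 13824) * h powr (57 / 128))"
    unfolding powr_add by (simp only: mult_ac)
  also have "\<dots> \<le> D powr (57 / 6912) * (q powr (35 / 128) * h powr (57 / 128))"
    using q by (intro mult_left_mono mult_right_mono powr_mono) auto
  also have "\<dots> \<le> (2 + D powr (57 / 6912)) * (q powr (35 / 128) * h powr (57 / 128))"
    by (intro mult_right_mono) auto
  finally show ?thesis by (simp add: D_def)
qed

text \<open>
  The constant of the interpolated bound for the sums over a subgroup, increased by 1 to account for the
  term \<open>x = 0\<close> of the Gauss sum.
\<close>

definition gauss_const :: "real \<Rightarrow> real" where
  "gauss_const A = 3 + (16 * 6 ^ 6 * 2 ^ 288 * (2 + A\<^sup>2) * 4203 ^ 55) powr (57 / 6912)"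

text \<open>
  Twisting by the element \<open>a0\<close> for which the sum over the powers is largest makes \<open>S \<one>\<close> the maximum, as required for the
  bound on subgroup sums. The number \<open>J\<close> of dyadic levels is the binary logarithm of \<open>4 h\<close>, rounded up.
\<close>

lemma (in prime_power_field) gauss_sum_bound:
  assumes n: "n > 0" "n dvd p ^ m - 1" and A: "A > 0"
    and gcds: "\<forall>\<nu>::nat. 1 \<le> \<nu> \<and> \<nu> < m \<and> \<nu> dvd m \<longrightarrow>
             real (gcd n ((p ^ m - 1) div (p ^ \<nu> - 1))) \<le> A * (real n / real p powr (real \<nu> / 2))"
    and a: "a \<in> carrier R - {\<zero>}"
  shows "cmod (gauss_sum R p m n a) \<le> gauss_const A * (real (p ^ m) powr (92 / 128) * real n powr (71 / 128))"
proof -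
  define s where "s b = cmod (\<Sum>y\<in>powers n. add_char R p m b y)" for b
  define q where "q = real (p ^ m)"
  define h where "h = card (powers n)"
  have fin: "finite (s ` (carrier R - {\<zero>}))" using finite_carrier by simp
  have "Max (s ` (carrier R - {\<zero>})) \<in> s ` (carrier R - {\<zero>})" using a by (intro Max_in fin) auto
  then obtain a0 where a0': "Max (s ` (carrier R - {\<zero>})) = s a0" "a0 \<in> carrier R - {\<zero>}"
    by (rule imageE)
  then have a0: "a0 \<in> carrier R" "a0 \<noteq> \<zero>" by auto
  have amax: "s b \<le> s a0" if "b \<in> carrier R" "b \<noteq> \<zero>" for b
    using Max_ge[OF fin, of "s b"] that unfolding a0'(1) by simp
  interpret C: subgroup_character R "add_char R p m a0" "powers n"
    by (intro subgroup_character.intro additive_character.intro additive_character_axioms.intro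
        subgroup_character_axioms.intro field_axioms finite_carrier add_char_add add_char_norm
        add_char_nontrivial subgroup_powers a0)
  have St: "cmod (C.char_sum (powers n) t) = s (a0 \<otimes> t)" if "t \<in> carrier R" for t
  proof -
    have "add_char R p m a0 (t \<otimes> x) = add_char R p m (a0 \<otimes> t) x" if "x \<in> powers n" for x
      using \<open>t \<in> carrier R\<close> powers_carrier[OF that] a0 by (simp add: add_char_def m_assoc)
    then show ?thesis unfolding C.char_sum_def s_def by simp
  qed
  have S1: "cmod (C.char_sum (powers n) \<one>) = s a0" using St a0 by simp
  have hn: "h * n = p ^ m - 1" using card_powers[OF n] by (simp add: h_def)
  have pm: "p ^ m > 1" by (rule order_gt_1)
  have "h \<noteq> 0" using hn pm by (intro notI) simp
  then have hpos: "h \<ge> 1" by simp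
  have hq: "real h * real n \<le> q"
  proof -
    have "h * n \<le> p ^ m" using hn by simp
    then show ?thesis unfolding q_def by (simp only: of_nat_le_iff of_nat_mult[symmetric])
  qed
  have "real 1 \<le> q" unfolding q_def of_nat_le_iff using pm by simp
  then have q1: "q \<ge> 1" by simp
  have n1: "real n \<ge> 1" using n by simp
  have hleq: "real h \<le> q" using hq n1 hpos by (metis mult.right_neutral mult_left_mono of_nat_0_le_iff order_trans)
  define J where "J = nat \<lceil>log 2 (4 * real h)\<rceil>"
  have J2: "4 * h \<le> 2 ^ J"
  proof -
    have "log 2 (4 * real h) \<le> real J" unfolding J_def by linarith
    then have "4 * real h \<le> 2 powr real J" using hpos by (simp add: log_le_iff)
    then have "real (4 * h) \<le> real (2 ^ J)" by (simp add: powr_realpow)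
    then show ?thesis unfolding of_nat_le_iff .
  qed
  have Jle: "real J \<le> 4203 * q powr (1 / 2100)"
  proof -
    have "log 2 (4 * real h) \<ge> 0" using hpos by simp
    then have "real J \<le> log 2 (4 * real h) + 1" unfolding J_def by linarith
    also have "log 2 (4 * real h) = log 2 (2 ^ 2) + log 2 h" using hpos by (simp add: log_mult)
    also have "log 2 (2 ^ 2) = (2 :: real)" by (subst log_pow_cancel) auto
    also have "log 2 h \<le> log 2 q" using hleq hpos by simp
    also have "log 2 q = ln q / ln 2" by (simp add: log_def)
    also have "\<dots> \<le> ln q / (1 / 2)" using ln2_ge_two_thirds q1 by (intro divide_left_mono) auto
    also have "ln q \<le> q powr (1 / 2100) / (1 / 2100)" using q1 by (intro ln_powr_bound) auto
    finally have "real J \<le> 4200 * q powr (1 / 2100) + 3" by simp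
    moreover have "1 \<le> q powr (1 / 2100)" using q1 by (simp add: ge_one_powr_ge_zero)
    ultimately show ?thesis by linarith
  qed
  have max: "cmod (C.char_sum (powers n) t) \<le> cmod (C.char_sum (powers n) \<one>)" if "t \<in> carrier R" "t \<noteq> \<zero>" for t
    unfolding St[OF that(1)] S1 using that a0 by (intro amax) (auto dest: integral)
  have bound: "s a0 \<le> (2 + ((16 * 6 ^ 6 * 2 ^ 288 * (2 + A\<^sup>2)) * 4203 ^ 55) powr (57 / 6912)) *
      (q powr (35 / 128) * real h powr (57 / 128))"
  proof (rule interpolation[OF q1 _ hleq _ _ _ Jle])
    show "1 \<le> real h" using hpos by simp
    show "0 \<le> s a0" by (simp add: s_def)
    show "(s a0)\<^sup>2 \<le> q" using C.char_sum_one_squared_le card_carrier unfolding S1 q_def by simp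
    show "0 < 16 * 6 ^ 6 * 2 ^ 288 * (2 + A\<^sup>2)" by (simp add: add_pos_nonneg)
    assume "2 * real h \<le> (s a0)\<^sup>2"
    then show "s a0 ^ 103 \<le> 16 * 6 ^ 6 * 2 ^ 288 * (2 + A\<^sup>2) * real J ^ 55 * q ^ 24 * real h ^ 54"
      using C.subgroup_sum_bound[OF max _ J2[unfolded h_def] card_powers_inter_subfield[OF n gcds A]]
      unfolding S1 card_carrier q_def h_def by simp
  qed
  have hn': "real n * (q powr (35 / 128) * real h powr (57 / 128)) \<le> q powr (92 / 128) * real n powr (71 / 128)"
  proof -
    have "real h \<le> q / n" using hq n1 by (simp add: field_simps)
    then have "real h powr (57 / 128) \<le> (q / n) powr (57 / 128)" by (intro powr_mono2) auto
    also have "\<dots> = q powr (57 / 128) / n powr (57 / 128)" using q1 n1 by (simp add: powr_divide)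
    finally have "real n * (q powr (35 / 128) * real h powr (57 / 128)) \<le> real n * (q powr (35 / 128) * (q powr (57 / 128) / n powr (57 / 128)))"
      by (intro mult_left_mono) auto
    also have "\<dots> = n powr 1 * (q powr (35 / 128) * (q powr (57 / 128) / n powr (57 / 128)))" using n1 by simp
    also have "\<dots> = (q powr (35 / 128) * q powr (57 / 128)) * (n powr 1 / n powr (57 / 128))" by simp
    also have "\<dots> = q powr (92 / 128) * n powr (71 / 128)"
      unfolding powr_add[symmetric] powr_diff[symmetric] by simp
    finally show ?thesis .
  qed
  have one: "1 \<le> q powr (92 / 128) * real n powr (71 / 128)"
    using q1 n1 mult_mono[of 1 "q powr (92 / 128)" 1 "real n powr (71 / 128)"] by (simp add: ge_one_powr_ge_zero)
  have "cmod (gauss_sum R p m n a) \<le> 1 + n * s a"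
    unfolding gauss_sum_eq[OF n] s_def using a gauss_sum_eq[OF n, of a]
    by (auto intro!: order_trans[OF norm_triangle_ineq] simp: norm_mult)
  also have "\<dots> \<le> 1 + n * s a0" using amax a by (simp add: mult_left_mono)
  also have "\<dots> \<le> q powr (92 / 128) * real n powr (71 / 128) + (gauss_const A - 1) * (q powr (92 / 128) * real n powr (71 / 128))"
  proof -
    have "n * s a0 \<le> n * ((gauss_const A - 1) * (q powr (35 / 128) * real h powr (57 / 128)))"
      using bound by (intro mult_left_mono) (auto simp: gauss_const_def)
    also have "\<dots> = (gauss_const A - 1) * (n * (q powr (35 / 128) * real h powr (57 / 128)))" by simp
    also have "\<dots> \<le> (gauss_const A - 1) * (q powr (92 / 128) * real n powr (71 / 128))"
      using hn' by (intro mult_left_mono) (auto simp: gauss_const_def)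
    finally show ?thesis using one by linarith
  qed
  finally show ?thesis by (simp add: q_def algebra_simps)
qed

text \<open>
  The bound holds with \<open>\<epsilon>\<^sub>1 = \<epsilon>\<^sub>2 = 0\<close>, since the interpolation absorbs the logarithm into a power of \<open>q\<close>.
\<close>

theorem theorem6:
  shows "\<forall>A::real. A > 0 \<longrightarrow>
    (\<exists>(C::real) (\<epsilon>\<^sub>1 :: nat \<Rightarrow> nat \<Rightarrow> real) (\<epsilon>\<^sub>2 :: nat \<Rightarrow> nat \<Rightarrow> real).
       C > 0 \<and>
       uniform_limit UNIV \<epsilon>\<^sub>1 (\<lambda>n. 0) sequentially \<and>
       uniform_limit UNIV \<epsilon>\<^sub>2 (\<lambda>n. 0) sequentially \<and>
       (\<forall>(K :: ('a, 'b) ring_scheme) (p::nat) (m::nat) (q::nat) (n::nat).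
          field K \<longrightarrow> prime p \<longrightarrow> m \<ge> 1 \<longrightarrow> q = p ^ m \<longrightarrow> card (carrier K) = q \<longrightarrow>
          n > 0 \<longrightarrow> n dvd (q - 1) \<longrightarrow>
          (\<forall>\<nu>::nat. 1 \<le> \<nu> \<and> \<nu> < m \<and> \<nu> dvd m \<longrightarrow>
             real (gcd n ((q - 1) div (p ^ \<nu> - 1))) \<le> A * (real n / real p powr (real \<nu> / 2))) \<longrightarrow>
          Max ((\<lambda>a. cmod (gauss_sum K p m n a)) ` (carrier K - {\<zero>\<^bsub>K\<^esub>})) \<le>
            C * (real q powr (91/128 + \<epsilon>\<^sub>1 q n) * real n powr (73/128) +
                 real q powr (92/128 + \<epsilon>\<^sub>2 q n) * real n powr (71/128))))"
proof (intro allI impI)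
  fix A :: real assume A: "A > 0"
  have C: "gauss_const A > 0" unfolding gauss_const_def by (simp add: add_pos_nonneg)
  have bound: "Max ((\<lambda>a. cmod (gauss_sum K p m n a)) ` (carrier K - {\<zero>\<^bsub>K\<^esub>})) \<le>
            gauss_const A * (real q powr (91/128 + 0) * real n powr (73/128) +
                 real q powr (92/128 + 0) * real n powr (71/128))"
    if K: "field K" "prime p" "m \<ge> 1" "q = p ^ m" "card (carrier K) = q" and n: "n > 0" "n dvd (q - 1)"
      and gcds: "\<forall>\<nu>::nat. 1 \<le> \<nu> \<and> \<nu> < m \<and> \<nu> dvd m \<longrightarrow>
             real (gcd n ((q - 1) div (p ^ \<nu> - 1))) \<le> A * (real n / real p powr (real \<nu> / 2))"
    for K :: "('a, 'b) ring_scheme" and p m q n :: nat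
  proof -
    interpret field K by (rule K)
    interpret prime_power_field K p m by unfold_locales (use K in auto)
    have "cmod (gauss_sum K p m n a) \<le> gauss_const A * (real q powr (91/128 + 0) * real n powr (73/128) +
                 real q powr (92/128 + 0) * real n powr (71/128))" if a: "a \<in> carrier K - {\<zero>\<^bsub>K\<^esub>}" for a
    proof -
      have "cmod (gauss_sum K p m n a) \<le> gauss_const A * (real q powr (92 / 128) * real n powr (71 / 128))"
        using gauss_sum_bound[of n A a] n A gcds a K by simp
      also have "\<dots> \<le> gauss_const A * (real q powr (91/128 + 0) * real n powr (73/128) +
                 real q powr (92/128 + 0) * real n powr (71/128))"
        using C by (intro mult_left_mono) auto
      finally show ?thesis .
    qed
    moreover have "carrier K - {\<zero>\<^bsub>K\<^esub>} \<noteq> {}" using one_closed one_not_zero by blast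
    ultimately show ?thesis using finite_carrier by (subst Max_le_iff) auto
  qed
  have lim: "uniform_limit UNIV (\<lambda>_ _. 0 :: real) (\<lambda>n :: nat. 0) sequentially"
    by (rule uniform_limit_const)
  show "\<exists>(C::real) (\<epsilon>\<^sub>1 :: nat \<Rightarrow> nat \<Rightarrow> real) (\<epsilon>\<^sub>2 :: nat \<Rightarrow> nat \<Rightarrow> real).
       C > 0 \<and>
       uniform_limit UNIV \<epsilon>\<^sub>1 (\<lambda>n. 0) sequentially \<and>
       uniform_limit UNIV \<epsilon>\<^sub>2 (\<lambda>n. 0) sequentially \<and>
       (\<forall>(K :: ('a, 'b) ring_scheme) (p::nat) (m::nat) (q::nat) (n::nat).
          field K \<longrightarrow> prime p \<longrightarrow> m \<ge> 1 \<longrightarrow> q = p ^ m \<longrightarrow> card (carrier K) = q \<longrightarrow>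
          n > 0 \<longrightarrow> n dvd (q - 1) \<longrightarrow>
          (\<forall>\<nu>::nat. 1 \<le> \<nu> \<and> \<nu> < m \<and> \<nu> dvd m \<longrightarrow>
             real (gcd n ((q - 1) div (p ^ \<nu> - 1))) \<le> A * (real n / real p powr (real \<nu> / 2))) \<longrightarrow>
          Max ((\<lambda>a. cmod (gauss_sum K p m n a)) ` (carrier K - {\<zero>\<^bsub>K\<^esub>})) \<le>
            C * (real q powr (91/128 + \<epsilon>\<^sub>1 q n) * real n powr (73/128) +
                 real q powr (92/128 + \<epsilon>\<^sub>2 q n) * real n powr (71/128)))"
    by (rule exI[of _ "gauss_const A"], rule exI[of _ "\<lambda>_ _. 0"], rule exI[of _ "\<lambda>_ _. 0"],
        rule conjI, rule C, rule conjI, rule lim, rule conjI, rule lim, intro allI impI, rule bound; assumption)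
qed

end
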